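(* Let $R$ be a commutative ring, $q\in R^\times$, $n\ge 1$, and let $\mathcal{D}^\pm(n)$ be the chain complex of $\mathcal{HB}_n$-modules defined in the context. Then $H_d(\mathcal{D}^\pm(n))=0$ for all $d\le n-2$.
   Context: For $n\ge 1$, $\mathcal{HB}_n$ is the associative unital $R$-algebra with generators $U,T_1,\dots,T_{n-1}$ and relations $UT_1UT_1=T_1UT_1U$; $UT_i=T_iU$ for $i>1$; $T_iT_{i+1}T_i=T_{i+1}T_iT_{i+1}$; $T_iT_j=T_jT_i$ for $|i-j|>1$; $(U+1)(U-q)=0$; $(T_i+1)(T_i-q)=0$ for all $i$. By convention $\mathcal{HB}_0=R$. For $m\le n$, $\mathcal{HB}_m$ is identified with the subalgebra of $\mathcal{HB}_n$ generated by $U,T_1,\dots,T_{m-1}$ (respectively $R$ if $m=0$). The trivial module $\mathbf{1}$ is $R$ with every generator acting as multiplication by $q$. For $n\ge a\ge b\ge 1$ put $T_{a,b}=T_{a-1}T_{a-2}\cdots T_b$, with $T_{a,a}=1$. The complex $\mathcal{D}^\pm(n)$ is zero outside degrees $-1\le r\le n-1$, and in those degrees $$\mathcal{D}^\pm(n)_r=\mathcal{HB}_n\otimes_{\mathcal{HB}_{n-r-1}}\mathbf{1},$$ with differential $\partial^r:\mathcal{D}^\pm(n)_r\to\mathcal{D}^\pm(n)_{r-1}$ (for $0\le r\le n-1$) given by $\partial^r=\sum_{j=0}^r(-1)^jq^{-j}\partial^r_j$, where $\partial^r_j(x\otimes 1)=xT_{n-r+j,n-r}\otimes 1$. *)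

theory Defs
  imports "HOL-Algebra.Algebra"
begin

section \<open>Free associative unital algebras\<close>

text \<open>
  An element of the free algebra on \<open>G\<close> over \<open>R\<close> is a finitely supported family of coefficients
  indexed by the words over \<open>G\<close>. The product is the bilinear extension of concatenation: the
  coefficient at \<open>w\<close> sums over the splittings of \<open>w\<close> into a prefix and a suffix.
\<close>

definition free_algebra :: "('a, 'm) ring_scheme \<Rightarrow> 'g set \<Rightarrow> ('a, 'g list \<Rightarrow> 'a) module" where
  "free_algebra R G =
    \<lparr>carrier = {f. (\<forall>w. f w \<in> carrier R) \<and> finite {w. f w \<noteq> \<zero>\<^bsub>R\<^esub>} \<and>
        (\<forall>w. w \<notin> lists G \<longrightarrow> f w = \<zero>\<^bsub>R\<^esub>)},
     monoid.mult = (\<lambda>f g w. \<Oplus>\<^bsub>R\<^esub>i\<in>{..length w}. f (take i w) \<otimes>\<^bsub>R\<^esub> g (drop i w)),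
     one = (\<lambda>w. if w = [] then \<one>\<^bsub>R\<^esub> else \<zero>\<^bsub>R\<^esub>),
     ring.zero = (\<lambda>w. \<zero>\<^bsub>R\<^esub>),
     add = (\<lambda>f g w. f w \<oplus>\<^bsub>R\<^esub> g w),
     smult = (\<lambda>c f w. c \<otimes>\<^bsub>R\<^esub> f w)\<rparr>"

lemma (in cring) finsum_triple_split:
  assumes a: "\<And>j. a j \<in> carrier R" and b: "\<And>j i. b j i \<in> carrier R" and c: "\<And>i. c i \<in> carrier R"
  shows "(\<Oplus>i\<in>{..k::nat}. (\<Oplus>j\<in>{..i}. a j \<otimes> b j i) \<otimes> c i)
       = (\<Oplus>j\<in>{..k}. a j \<otimes> (\<Oplus>i\<in>{..k-j}. b j (j+i) \<otimes> c (j+i)))"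
proof (induction k)
  case 0 show ?case using a b c by (simp add: m_assoc)
next
  case (Suc k)
  have cl: "(\<Oplus>i\<in>{..m}. b j (j+i) \<otimes> c (j+i)) \<in> carrier R" for m j using b c by auto
  have "(\<Oplus>j\<in>{..Suc k}. a j \<otimes> (\<Oplus>i\<in>{..Suc k-j}. b j (j+i) \<otimes> c (j+i)))
    = a (Suc k) \<otimes> (b (Suc k) (Suc k) \<otimes> c (Suc k)) \<oplus> (\<Oplus>j\<in>{..k}. a j \<otimes> (\<Oplus>i\<in>{..Suc k-j}. b j (j+i) \<otimes> c (j+i)))"
    using a b c cl by (subst finsum_Suc) (auto)
  also have "(\<Oplus>j\<in>{..k}. a j \<otimes> (\<Oplus>i\<in>{..Suc k-j}. b j (j+i) \<otimes> c (j+i))) =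
     (\<Oplus>j\<in>{..k}. (a j \<otimes> b j (Suc k)) \<otimes> c (Suc k) \<oplus> a j \<otimes> (\<Oplus>i\<in>{..k-j}. b j (j+i) \<otimes> c (j+i)))"
  proof (rule finsum_cong')
    fix j assume "j \<in> {..k}" then have j: "j \<le> k" by simp
    then have "Suc k - j = Suc (k - j)" "j + Suc (k - j) = Suc k" by auto
    then show "a j \<otimes> (\<Oplus>i\<in>{..Suc k-j}. b j (j+i) \<otimes> c (j+i)) =
     (a j \<otimes> b j (Suc k)) \<otimes> c (Suc k) \<oplus> a j \<otimes> (\<Oplus>i\<in>{..k-j}. b j (j+i) \<otimes> c (j+i))"
      using a b c cl by (simp add: finsum_Suc r_distr m_assoc)
  qed (use a b c cl in auto)
  also have "\<dots> = (\<Oplus>j\<in>{..k}. (a j \<otimes> b j (Suc k)) \<otimes> c (Suc k)) \<oplus> (\<Oplus>j\<in>{..k}. a j \<otimes> (\<Oplus>i\<in>{..k-j}. b j (j+i) \<otimes> c (j+i)))"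
    using a b c cl by (intro finsum_addf) auto
  also have "(\<Oplus>j\<in>{..k}. (a j \<otimes> b j (Suc k)) \<otimes> c (Suc k)) = (\<Oplus>j\<in>{..k}. a j \<otimes> b j (Suc k)) \<otimes> c (Suc k)"
    using a b c by (subst finsum_ldistr) auto
  finally have R: "(\<Oplus>j\<in>{..Suc k}. a j \<otimes> (\<Oplus>i\<in>{..Suc k-j}. b j (j+i) \<otimes> c (j+i))) =
     a (Suc k) \<otimes> (b (Suc k) (Suc k) \<otimes> c (Suc k)) \<oplus> ((\<Oplus>j\<in>{..k}. a j \<otimes> b j (Suc k)) \<otimes> c (Suc k) \<oplus>
      (\<Oplus>i\<in>{..k}. (\<Oplus>j\<in>{..i}. a j \<otimes> b j i) \<otimes> c i))"
    using Suc by simp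
  have "(\<Oplus>i\<in>{..Suc k}. (\<Oplus>j\<in>{..i}. a j \<otimes> b j i) \<otimes> c i) =
    (\<Oplus>j\<in>{..Suc k}. a j \<otimes> b j (Suc k)) \<otimes> c (Suc k) \<oplus> (\<Oplus>i\<in>{..k}. (\<Oplus>j\<in>{..i}. a j \<otimes> b j i) \<otimes> c i)"
    using a b c by (subst finsum_Suc) auto
  also have "(\<Oplus>j\<in>{..Suc k}. a j \<otimes> b j (Suc k)) = a (Suc k) \<otimes> b (Suc k) (Suc k) \<oplus> (\<Oplus>j\<in>{..k}. a j \<otimes> b j (Suc k))"
    using a b c by (subst finsum_Suc) auto
  finally show ?case unfolding R using a b c by (simp add: l_distr a_assoc m_assoc)
qed

lemma free_algebra_simps:
  "x \<otimes>\<^bsub>free_algebra R G\<^esub> y = (\<lambda>w. \<Oplus>\<^bsub>R\<^esub>i\<in>{..length w}. x (take i w) \<otimes>\<^bsub>R\<^esub> y (drop i w))"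
  "x \<oplus>\<^bsub>free_algebra R G\<^esub> y = (\<lambda>w. x w \<oplus>\<^bsub>R\<^esub> y w)"
  "\<zero>\<^bsub>free_algebra R G\<^esub> = (\<lambda>w. \<zero>\<^bsub>R\<^esub>)"
  "\<one>\<^bsub>free_algebra R G\<^esub> = (\<lambda>w. if w = [] then \<one>\<^bsub>R\<^esub> else \<zero>\<^bsub>R\<^esub>)"
  by (auto simp: free_algebra_def)

lemma (in cring) free_algebra_carrier: "f \<in> carrier (free_algebra R G) \<longleftrightarrow> (\<forall>w. f w \<in> carrier R) \<and> finite {w. f w \<noteq> \<zero>} \<and> (\<forall>w. w \<notin> lists G \<longrightarrow> f w = \<zero>)"
  by (auto simp: free_algebra_def)

lemma (in cring) free_algebra_ring: "ring (free_algebra R G)"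
proof (rule ringI)
  show "abelian_group (free_algebra R G)"
  proof (rule abelian_groupI)
    fix x y assume x: "x \<in> carrier (free_algebra R G)" and y: "y \<in> carrier (free_algebra R G)"
    have "{w. x w \<oplus> y w \<noteq> \<zero>} \<subseteq> {w. x w \<noteq> \<zero>} \<union> {w. y w \<noteq> \<zero>}" by auto
    then show "x \<oplus>\<^bsub>free_algebra R G\<^esub> y \<in> carrier (free_algebra R G)" using x y
      by (auto simp: free_algebra_carrier free_algebra_simps intro: finite_subset[OF _ finite_UnI])
    show "x \<oplus>\<^bsub>free_algebra R G\<^esub> y = y \<oplus>\<^bsub>free_algebra R G\<^esub> x" using x y
      by (auto simp: free_algebra_carrier free_algebra_simps a_comm)
    show "\<zero>\<^bsub>free_algebra R G\<^esub> \<oplus>\<^bsub>free_algebra R G\<^esub> x = x" using x by (auto simp: free_algebra_carrier free_algebra_simps)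
    show "\<exists>y\<in>carrier (free_algebra R G). y \<oplus>\<^bsub>free_algebra R G\<^esub> x = \<zero>\<^bsub>free_algebra R G\<^esub>"
    proof (rule bexI[of _ "\<lambda>w. \<ominus> x w"])
      have "{w. \<ominus> x w \<noteq> \<zero>} \<subseteq> {w. x w \<noteq> \<zero>}" by auto
      then show "(\<lambda>w. \<ominus> x w) \<in> carrier (free_algebra R G)" using x
        by (auto simp: free_algebra_carrier free_algebra_simps intro: finite_subset)
    qed (use x in \<open>auto simp: free_algebra_carrier free_algebra_simps l_neg\<close>)
  next
    show "\<zero>\<^bsub>free_algebra R G\<^esub> \<in> carrier (free_algebra R G)" by (auto simp: free_algebra_carrier free_algebra_simps)
  next
    fix x y z assume "x \<in> carrier (free_algebra R G)" "y \<in> carrier (free_algebra R G)" "z \<in> carrier (free_algebra R G)"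
    then show "x \<oplus>\<^bsub>free_algebra R G\<^esub> y \<oplus>\<^bsub>free_algebra R G\<^esub> z = x \<oplus>\<^bsub>free_algebra R G\<^esub> (y \<oplus>\<^bsub>free_algebra R G\<^esub> z)"
      by (auto simp: free_algebra_carrier free_algebra_simps a_assoc)
  qed
next
  show "monoid (free_algebra R G)"
  proof (rule monoidI)
    show "\<one>\<^bsub>free_algebra R G\<^esub> \<in> carrier (free_algebra R G)" by (auto simp: free_algebra_carrier free_algebra_simps)
  next
    fix x y assume x: "x \<in> carrier (free_algebra R G)" and y: "y \<in> carrier (free_algebra R G)"
    have z: "(\<Oplus>i\<in>{..length w}. x (take i w) \<otimes> y (drop i w)) = \<zero>" 
      if "\<And>i. x (take i w) = \<zero> \<or> y (drop i w) = \<zero>" for w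
      using that x y by (intro add.finprod_one_eqI) (auto simp: free_algebra_carrier, metis l_null r_null)
    have "{w. (x \<otimes>\<^bsub>free_algebra R G\<^esub> y) w \<noteq> \<zero>} \<subseteq> (\<lambda>(u,v). u @ v) ` ({w. x w \<noteq> \<zero>} \<times> {w. y w \<noteq> \<zero>})"
    proof 
      fix w assume "w \<in> {w. (x \<otimes>\<^bsub>free_algebra R G\<^esub> y) w \<noteq> \<zero>}"
      then obtain i where "x (take i w) \<noteq> \<zero>" "y (drop i w) \<noteq> \<zero>" using z by (auto simp: free_algebra_simps)
      then show "w \<in> (\<lambda>(u,v). u @ v) ` ({w. x w \<noteq> \<zero>} \<times> {w. y w \<noteq> \<zero>})"
        by (intro image_eqI[of _ _ "(take i w, drop i w)"]) auto
    qed
    then have f: "finite {w. (x \<otimes>\<^bsub>free_algebra R G\<^esub> y) w \<noteq> \<zero>}"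
      using x y by (elim finite_subset) (auto simp: free_algebra_carrier)
    have l: "(x \<otimes>\<^bsub>free_algebra R G\<^esub> y) w = \<zero>" if "w \<notin> lists G" for w
      unfolding free_algebra_simps
    proof (rule z)
      fix i 
      have "take i w \<notin> lists G \<or> drop i w \<notin> lists G"
        using that append_in_lists_conv[of "take i w" "drop i w" G] by auto
      then show "x (take i w) = \<zero> \<or> y (drop i w) = \<zero>" using x y by (auto simp: free_algebra_carrier)
    qed
    show "x \<otimes>\<^bsub>free_algebra R G\<^esub> y \<in> carrier (free_algebra R G)"
      using f l x y unfolding free_algebra_carrier by (auto simp: free_algebra_simps free_algebra_carrier)
  next
    fix x y z assume x: "x \<in> carrier (free_algebra R G)" and y: "y \<in> carrier (free_algebra R G)" and z: "z \<in> carrier (free_algebra R G)"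
    show "x \<otimes>\<^bsub>free_algebra R G\<^esub> y \<otimes>\<^bsub>free_algebra R G\<^esub> z = x \<otimes>\<^bsub>free_algebra R G\<^esub> (y \<otimes>\<^bsub>free_algebra R G\<^esub> z)"
    proof
      fix w
      let ?b = "\<lambda>j i. y (drop j (take i w))"
      have "(x \<otimes>\<^bsub>free_algebra R G\<^esub> y \<otimes>\<^bsub>free_algebra R G\<^esub> z) w = 
         (\<Oplus>i\<in>{..length w}. (\<Oplus>j\<in>{..i}. x (take j w) \<otimes> ?b j i) \<otimes> z (drop i w))"
        unfolding free_algebra_simps using x y z
        by (intro finsum_cong') (auto simp: free_algebra_carrier min_absorb2 min_absorb1 intro!: arg_cong2[where f="(\<otimes>)"] finsum_cong')
      also have "\<dots> = (\<Oplus>j\<in>{..length w}. x (take j w) \<otimes> (\<Oplus>i\<in>{..length w-j}. ?b j (j+i) \<otimes> z (drop (j+i) w)))"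
        using x y z by (intro finsum_triple_split) (auto simp: free_algebra_carrier)
      also have "\<dots> = (x \<otimes>\<^bsub>free_algebra R G\<^esub> (y \<otimes>\<^bsub>free_algebra R G\<^esub> z)) w"
        unfolding free_algebra_simps using x y z
        by (intro finsum_cong') (auto simp: free_algebra_carrier drop_take add.commute intro!: arg_cong2[where f="(\<otimes>)"] finsum_cong')
      finally show "(x \<otimes>\<^bsub>free_algebra R G\<^esub> y \<otimes>\<^bsub>free_algebra R G\<^esub> z) w = (x \<otimes>\<^bsub>free_algebra R G\<^esub> (y \<otimes>\<^bsub>free_algebra R G\<^esub> z)) w" .
    qed
  next
    fix x assume x: "x \<in> carrier (free_algebra R G)"
    show "\<one>\<^bsub>free_algebra R G\<^esub> \<otimes>\<^bsub>free_algebra R G\<^esub> x = x"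
    proof
      fix w
      have "(\<one>\<^bsub>free_algebra R G\<^esub> \<otimes>\<^bsub>free_algebra R G\<^esub> x) w = (\<Oplus>i\<in>{..length w}. if i = 0 then x (drop i w) else \<zero>)"
        unfolding free_algebra_simps using x by (intro finsum_cong') (auto simp: free_algebra_carrier)
      also have "\<dots> = x w" using x by (subst add.finprod_singleton_swap) (auto simp: free_algebra_carrier)
      finally show "(\<one>\<^bsub>free_algebra R G\<^esub> \<otimes>\<^bsub>free_algebra R G\<^esub> x) w = x w" .
    qed
    show "x \<otimes>\<^bsub>free_algebra R G\<^esub> \<one>\<^bsub>free_algebra R G\<^esub> = x"
    proof
      fix w
      have "(x \<otimes>\<^bsub>free_algebra R G\<^esub> \<one>\<^bsub>free_algebra R G\<^esub>) w = (\<Oplus>i\<in>{..length w}. if i = length w then x (take i w) else \<zero>)"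
        unfolding free_algebra_simps using x by (intro finsum_cong') (auto simp: free_algebra_carrier)
      also have "\<dots> = x w" using x by (subst add.finprod_singleton_swap) (auto simp: free_algebra_carrier)
      finally show "(x \<otimes>\<^bsub>free_algebra R G\<^esub> \<one>\<^bsub>free_algebra R G\<^esub>) w = x w" .
    qed
  qed
next
  fix x y z assume x: "x \<in> carrier (free_algebra R G)" and y: "y \<in> carrier (free_algebra R G)" and z: "z \<in> carrier (free_algebra R G)"
  have c: "x w \<in> carrier R" "y w \<in> carrier R" "z w \<in> carrier R" for w using x y z by (auto simp: free_algebra_carrier)
  show "(x \<oplus>\<^bsub>free_algebra R G\<^esub> y) \<otimes>\<^bsub>free_algebra R G\<^esub> z = x \<otimes>\<^bsub>free_algebra R G\<^esub> z \<oplus>\<^bsub>free_algebra R G\<^esub> y \<otimes>\<^bsub>free_algebra R G\<^esub> z"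
    unfolding free_algebra_simps using c by (auto simp: l_distr finsum_addf)
  show "z \<otimes>\<^bsub>free_algebra R G\<^esub> (x \<oplus>\<^bsub>free_algebra R G\<^esub> y) = z \<otimes>\<^bsub>free_algebra R G\<^esub> x \<oplus>\<^bsub>free_algebra R G\<^esub> z \<otimes>\<^bsub>free_algebra R G\<^esub> y"
    unfolding free_algebra_simps using c by (auto simp: r_distr finsum_addf)
qed

definition free_gen :: "('a, 'm) ring_scheme \<Rightarrow> 'g \<Rightarrow> 'g list \<Rightarrow> 'a" where
  "free_gen R x = (\<lambda>w. if w = [x] then \<one>\<^bsub>R\<^esub> else \<zero>\<^bsub>R\<^esub>)"

text \<open>Substitution of the single scalar \<open>q\<close> for every generator.\<close>

definition free_eval :: "('a, 'm) ring_scheme \<Rightarrow> 'a \<Rightarrow> ('g list \<Rightarrow> 'a) \<Rightarrow> 'a" where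
  "free_eval R q f =
    (\<Oplus>\<^bsub>R\<^esub>w\<in>{w. f w \<noteq> \<zero>\<^bsub>R\<^esub>}. f w \<otimes>\<^bsub>R\<^esub> (q [^]\<^bsub>R\<^esub> length w))"

section \<open>Iwahori-Hecke algebras of type B\<close>

datatype hb_gen = GenU | GenT nat

definition hb_gens :: "nat \<Rightarrow> hb_gen set" where
  "hb_gens n = (if n = 0 then {} else insert GenU (GenT ` {1..<n}))"

abbreviation hb_free :: "('a, 'm) ring_scheme \<Rightarrow> nat \<Rightarrow> ('a, hb_gen list \<Rightarrow> 'a) module" where
  "hb_free R n \<equiv> free_algebra R (hb_gens n)"

text \<open>Each defining relation \<open>x = y\<close> contributes the relator \<open>x - y\<close>.\<close>

definition hb_relators :: "('a, 'm) ring_scheme \<Rightarrow> 'a \<Rightarrow> nat \<Rightarrow> (hb_gen list \<Rightarrow> 'a) set" where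
  "hb_relators R q n =
    (let F = hb_free R n;
         U = free_gen R GenU;
         T = (\<lambda>i. free_gen R (GenT i));
         quad = (\<lambda>x. (x \<oplus>\<^bsub>F\<^esub> \<one>\<^bsub>F\<^esub>) \<otimes>\<^bsub>F\<^esub> (x \<ominus>\<^bsub>F\<^esub> q \<odot>\<^bsub>F\<^esub> \<one>\<^bsub>F\<^esub>))
     in (if 1 < n then {U \<otimes>\<^bsub>F\<^esub> T 1 \<otimes>\<^bsub>F\<^esub> U \<otimes>\<^bsub>F\<^esub> T 1 \<ominus>\<^bsub>F\<^esub> T 1 \<otimes>\<^bsub>F\<^esub> U \<otimes>\<^bsub>F\<^esub> T 1 \<otimes>\<^bsub>F\<^esub> U} else {})
      \<union> {U \<otimes>\<^bsub>F\<^esub> T i \<ominus>\<^bsub>F\<^esub> T i \<otimes>\<^bsub>F\<^esub> U | i. 1 < i \<and> i < n}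
      \<union> {T i \<otimes>\<^bsub>F\<^esub> T (i + 1) \<otimes>\<^bsub>F\<^esub> T i \<ominus>\<^bsub>F\<^esub> T (i + 1) \<otimes>\<^bsub>F\<^esub> T i \<otimes>\<^bsub>F\<^esub> T (i + 1) | i.
           1 \<le> i \<and> i + 1 < n}
      \<union> {T i \<otimes>\<^bsub>F\<^esub> T j \<ominus>\<^bsub>F\<^esub> T j \<otimes>\<^bsub>F\<^esub> T i | i j.
           i \<in> {1..<n} \<and> j \<in> {1..<n} \<and> \<bar>int i - int j\<bar> > 1}
      \<union> (if 1 \<le> n then {quad U} else {})
      \<union> {quad (T i) | i. i \<in> {1..<n}})"

definition hb_ideal :: "('a, 'm) ring_scheme \<Rightarrow> 'a \<Rightarrow> nat \<Rightarrow> (hb_gen list \<Rightarrow> 'a) set" where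
  "hb_ideal R q n = Idl\<^bsub>hb_free R n\<^esub> (hb_relators R q n)"

definition HB :: "('a, 'm) ring_scheme \<Rightarrow> 'a \<Rightarrow> nat \<Rightarrow> (hb_gen list \<Rightarrow> 'a) set ring" where
  "HB R q n = hb_free R n Quot hb_ideal R q n"

definition hb_class ::
    "('a, 'm) ring_scheme \<Rightarrow> 'a \<Rightarrow> nat \<Rightarrow> (hb_gen list \<Rightarrow> 'a) \<Rightarrow> (hb_gen list \<Rightarrow> 'a) set" where
  "hb_class R q n f = hb_ideal R q n +>\<^bsub>hb_free R n\<^esub> f"

definition hb_scalar :: "('a, 'm) ring_scheme \<Rightarrow> 'a \<Rightarrow> nat \<Rightarrow> 'a \<Rightarrow> (hb_gen list \<Rightarrow> 'a) set" where
  "hb_scalar R q n c = hb_class R q n (c \<odot>\<^bsub>hb_free R n\<^esub> \<one>\<^bsub>hb_free R n\<^esub>)"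

definition hb_T :: "('a, 'm) ring_scheme \<Rightarrow> 'a \<Rightarrow> nat \<Rightarrow> nat \<Rightarrow> (hb_gen list \<Rightarrow> 'a) set" where
  "hb_T R q n i = hb_class R q n (free_gen R (GenT i))"

text \<open>
  For \<open>m \<le> n\<close>, \<open>hb_sub R q n m\<close> is the copy of \<open>HB R q m\<close> inside \<open>HB R q n\<close>: the
  \<open>R\<close>-subalgebra generated by \<open>U, T\<^sub>1, \<dots>, T\<^bsub>m-1\<^esub>\<close>. It consists of the scalars if \<open>m = 0\<close>.
\<close>

definition hb_sub :: "('a, 'm) ring_scheme \<Rightarrow> 'a \<Rightarrow> nat \<Rightarrow> nat \<Rightarrow> (hb_gen list \<Rightarrow> 'a) set set" where
  "hb_sub R q n m = generate_ring (HB R q n)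
    (hb_scalar R q n ` carrier R \<union> (hb_class R q n \<circ> free_gen R) ` hb_gens m)"

text \<open>
  The trivial module: \<open>R\<close>, on which every generator acts as multiplication by \<open>q\<close>. The class of a
  noncommutative polynomial therefore acts as multiplication by its value at \<open>q, \<dots>, q\<close>, which does
  not depend on the representative. As a module over \<open>hb_sub R q n m\<close> this is the
  trivial module of \<open>HB R q m\<close>.
\<close>

definition hb_triv ::
    "('a, 'm) ring_scheme \<Rightarrow> 'a \<Rightarrow> nat \<Rightarrow> ((hb_gen list \<Rightarrow> 'a) set, 'a) module" where
  "hb_triv R q n =
    \<lparr>carrier = carrier R, monoid.mult = monoid.mult R, one = \<one>\<^bsub>R\<^esub>, ring.zero = \<zero>\<^bsub>R\<^esub>, add = add R,
     smult = (\<lambda>x v. the_elem (free_eval R q ` x) \<otimes>\<^bsub>R\<^esub> v)\<rparr>"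

text \<open>
  \<open>hb_Tprod R q n a b\<close> is the descending product \<open>T\<^bsub>a-1\<^esub> T\<^bsub>a-2\<^esub> \<cdots> T\<^sub>b\<close>, which is the unit for
  \<open>a = b\<close>.
\<close>

fun hb_Tprod :: "('a, 'm) ring_scheme \<Rightarrow> 'a \<Rightarrow> nat \<Rightarrow> nat \<Rightarrow> nat \<Rightarrow> (hb_gen list \<Rightarrow> 'a) set" where
  "hb_Tprod R q n 0 b = \<one>\<^bsub>HB R q n\<^esub>"
| "hb_Tprod R q n (Suc a) b =
    (if Suc a \<le> b then \<one>\<^bsub>HB R q n\<^esub> else hb_T R q n a \<otimes>\<^bsub>HB R q n\<^esub> hb_Tprod R q n a b)"

section \<open>Tensor products over a noncommutative ring\<close>

text \<open>
  For a ring \<open>A\<close>, a subring \<open>B\<close> and a left \<open>B\<close>-module \<open>N\<close>, the tensor product of \<open>A\<close> and \<open>N\<close>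
  over \<open>B\<close> is the free abelian group on pairs modulo biadditivity and \<open>B\<close>-balancedness. It is
  a left \<open>A\<close>-module. The multiplicative fields of the record play no role.
\<close>

definition tensor_relators ::
    "('a, 'm) ring_scheme \<Rightarrow> 'a set \<Rightarrow> ('a, 'v, 'k) module_scheme \<Rightarrow> ('a \<times> 'v \<Rightarrow>\<^sub>0 int) set" where
  "tensor_relators A B N =
      {frag_of (x \<oplus>\<^bsub>A\<^esub> y, v) - frag_of (x, v) - frag_of (y, v) | x y v.
         x \<in> carrier A \<and> y \<in> carrier A \<and> v \<in> carrier N}
    \<union> {frag_of (x, v \<oplus>\<^bsub>N\<^esub> w) - frag_of (x, v) - frag_of (x, w) | x v w.
         x \<in> carrier A \<and> v \<in> carrier N \<and> w \<in> carrier N}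
    \<union> {frag_of (x \<otimes>\<^bsub>A\<^esub> b, v) - frag_of (x, b \<odot>\<^bsub>N\<^esub> v) | x b v.
         x \<in> carrier A \<and> b \<in> B \<and> v \<in> carrier N}"

definition tensor_null ::
    "('a, 'm) ring_scheme \<Rightarrow> 'a set \<Rightarrow> ('a, 'v, 'k) module_scheme \<Rightarrow> ('a \<times> 'v \<Rightarrow>\<^sub>0 int) set" where
  "tensor_null A B N =
    generate (free_Abelian_group (carrier A \<times> carrier N)) (tensor_relators A B N)"

definition tensor_class ::
    "('a, 'm) ring_scheme \<Rightarrow> 'a set \<Rightarrow> ('a, 'v, 'k) module_scheme \<Rightarrow> ('a \<times> 'v \<Rightarrow>\<^sub>0 int)
      \<Rightarrow> ('a \<times> 'v \<Rightarrow>\<^sub>0 int) set" where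
  "tensor_class A B N z =
    tensor_null A B N #>\<^bsub>free_Abelian_group (carrier A \<times> carrier N)\<^esub> z"

definition pure_tensor ::
    "('a, 'm) ring_scheme \<Rightarrow> 'a set \<Rightarrow> ('a, 'v, 'k) module_scheme \<Rightarrow> 'a \<Rightarrow> 'v
      \<Rightarrow> ('a \<times> 'v \<Rightarrow>\<^sub>0 int) set" where
  "pure_tensor A B N x v = tensor_class A B N (frag_of (x, v))"

text \<open>
  \<open>tensor_map A B N f\<close> is the additive map into the tensor product over \<open>B\<close> that sends the pure
  tensor of \<open>x\<close> and \<open>v\<close> to the pure tensor of \<open>f x\<close> and \<open>v\<close>. Its argument is an element of a
  tensor product of \<open>A\<close> and \<open>N\<close>, possibly over another subring, that is, a coset.
\<close>

definition tensor_map ::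
    "('a, 'm) ring_scheme \<Rightarrow> 'a set \<Rightarrow> ('a, 'v, 'k) module_scheme \<Rightarrow> ('a \<Rightarrow> 'a)
      \<Rightarrow> ('a \<times> 'v \<Rightarrow>\<^sub>0 int) set \<Rightarrow> ('a \<times> 'v \<Rightarrow>\<^sub>0 int) set" where
  "tensor_map A B N f C =
    the_elem ((\<lambda>z. tensor_class A B N (frag_extend (\<lambda>(x, v). frag_of (f x, v)) z)) ` C)"

lemma tensor_map_pure:
  fixes A :: "('a,'m) ring_scheme" and N :: "('a,'v,'k) module_scheme"
  assumes A: "ring A" and fc: "\<And>x. x \<in> carrier A \<Longrightarrow> f x \<in> carrier A"
    and fa: "\<And>x y. x \<in> carrier A \<Longrightarrow> y \<in> carrier A \<Longrightarrow> f (x \<oplus>\<^bsub>A\<^esub> y) = f x \<oplus>\<^bsub>A\<^esub> f y"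
    and fb: "\<And>x b. x \<in> carrier A \<Longrightarrow> b \<in> B \<Longrightarrow> f (x \<otimes>\<^bsub>A\<^esub> b) = f x \<otimes>\<^bsub>A\<^esub> b"
    and BB: "B \<subseteq> B'" "B' \<subseteq> carrier A"
    and N: "\<And>v w. v \<in> carrier N \<Longrightarrow> w \<in> carrier N \<Longrightarrow> v \<oplus>\<^bsub>N\<^esub> w \<in> carrier N"
      "\<And>b v. b \<in> B' \<Longrightarrow> v \<in> carrier N \<Longrightarrow> b \<odot>\<^bsub>N\<^esub> v \<in> carrier N"
    and x: "x \<in> carrier A" "v \<in> carrier N"
  shows "tensor_map A B' N f (pure_tensor A B N x v) = pure_tensor A B' N (f x) v"
proof -
  let ?F = "free_Abelian_group (carrier A \<times> carrier N)"
  let ?g = "frag_extend (\<lambda>(x, v). frag_of (f x, v)) :: _ \<Rightarrow> 'a \<times> 'v \<Rightarrow>\<^sub>0 int"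
  interpret A: ring A by fact
  interpret F: group ?F by simp
  have D: "c - d \<in> carrier ?F" if "c \<in> carrier ?F" "d \<in> carrier ?F" for c d
    using that keys_diff[of c d] by (auto simp: carrier_free_Abelian_group_iff)
  have sub: "tensor_relators A B0 N \<subseteq> carrier ?F" if "B0 \<subseteq> B'" for B0
  proof
    fix z assume "z \<in> tensor_relators A B0 N"
    then show "z \<in> carrier ?F"
      unfolding tensor_relators_def using that BB N
      by (elim UnE) (clarsimp simp del: carrier_free_Abelian_group_iff; intro D; auto)+
  qed
  have sg: "subgroup (tensor_null A B' N) ?F"
    unfolding tensor_null_def using F.generate_is_subgroup[OF sub] by simp
  have rel: "?g h \<in> tensor_relators A B' N" if h: "h \<in> tensor_relators A B N" for h
  proof -
    consider x y v where "h = frag_of (x \<oplus>\<^bsub>A\<^esub> y, v) - frag_of (x, v) - frag_of (y, v)" "x \<in> carrier A" "y \<in> carrier A" "v \<in> carrier N"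
     | x v w where "h = frag_of (x, v \<oplus>\<^bsub>N\<^esub> w) - frag_of (x, v) - frag_of (x, w)" "x \<in> carrier A" "v \<in> carrier N" "w \<in> carrier N"
     | x b v where "h = frag_of (x \<otimes>\<^bsub>A\<^esub> b, v) - frag_of (x, b \<odot>\<^bsub>N\<^esub> v)" "x \<in> carrier A" "b \<in> B" "v \<in> carrier N"
      using h unfolding tensor_relators_def by blast
    then show ?thesis
    proof cases
      case 1
      then have "?g h = frag_of (f x \<oplus>\<^bsub>A\<^esub> f y, v) - frag_of (f x, v) - frag_of (f y, v)"
        by (simp add: frag_extend_diff fa)
      then show ?thesis unfolding tensor_relators_def using 1 fc by blast
    next
      case 2
      then have "?g h = frag_of (f x, v \<oplus>\<^bsub>N\<^esub> w) - frag_of (f x, v) - frag_of (f x, w)"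
        by (simp add: frag_extend_diff)
      then show ?thesis unfolding tensor_relators_def using 2 fc by blast
    next
      case 3
      then have "?g h = frag_of (f x \<otimes>\<^bsub>A\<^esub> b, v) - frag_of (f x, b \<odot>\<^bsub>N\<^esub> v)"
        by (simp add: frag_extend_diff fb)
      then show ?thesis unfolding tensor_relators_def using 3 fc BB by blast
    qed
  qed
  have gr: "?g z \<in> tensor_null A B' N" if "z \<in> tensor_null A B N" for z
    using that unfolding tensor_null_def
  proof (induction rule: generate.induct)
    case one show ?case by (simp add: generate.one[of ?F, simplified])
  next
    case (incl h)
    then have "?g h \<in> tensor_relators A B' N" by (rule rel)
    then show ?case by (rule generate.incl)
  next
    case (inv h)
    then have h: "h \<in> carrier ?F" using sub[OF BB(1)] by blast
    from inv have "?g h \<in> tensor_relators A B' N" by (rule rel)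
    then have "inv\<^bsub>?F\<^esub> (?g h) \<in> generate ?F (tensor_relators A B' N)" and "?g h \<in> carrier ?F"
      using sub[OF order_refl] by (blast intro: generate.inv)+
    then show ?case using h by (simp add: frag_extend_minus)
  next
    case (eng h1 h2)
    then show ?case using generate.eng[of "?g h1" ?F] by (simp add: frag_extend_add)
  qed
  have p: "frag_of (f x, v) \<in> carrier ?F" using x fc by simp
  have "(\<lambda>z. tensor_class A B' N (?g z)) ` pure_tensor A B N x v = {pure_tensor A B' N (f x) v}"
  proof -
    have "tensor_class A B' N (?g z) = pure_tensor A B' N (f x) v" if zz: "z \<in> pure_tensor A B N x v" for z
    proof -
      obtain k where k: "k \<in> tensor_null A B N" "z = k + frag_of (x, v)"
        using zz by (auto simp: pure_tensor_def tensor_class_def r_coset_def)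
      have "?g z = ?g k + frag_of (f x, v)" using k by (simp add: frag_extend_add)
      then have "?g z \<in> tensor_null A B' N #>\<^bsub>?F\<^esub> frag_of (f x, v)"
        using gr[OF k(1)] by (auto simp: r_coset_def)
      then show ?thesis unfolding tensor_class_def pure_tensor_def
        using F.repr_independence[OF _ p sg] by metis
    qed
    moreover have "frag_of (x,v) \<in> pure_tensor A B N x v"
      unfolding pure_tensor_def tensor_class_def tensor_null_def r_coset_def
      using generate.one[of ?F] by (auto intro!: bexI[of _ 0])
    ultimately show ?thesis by auto
  qed
  then show ?thesis unfolding tensor_map_def by simp
qed

definition tensor_product ::
    "('a, 'm) ring_scheme \<Rightarrow> 'a set \<Rightarrow> ('a, 'v, 'k) module_scheme
      \<Rightarrow> ('a, ('a \<times> 'v \<Rightarrow>\<^sub>0 int) set) module" where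
  "tensor_product A B N =
    (let Q = free_Abelian_group (carrier A \<times> carrier N) Mod tensor_null A B N
     in \<lparr>carrier = carrier Q, monoid.mult = undefined, one = undefined,
         ring.zero = \<one>\<^bsub>Q\<^esub>, add = monoid.mult Q,
         smult = (\<lambda>a. tensor_map A B N (\<lambda>x. a \<otimes>\<^bsub>A\<^esub> x))\<rparr>)"

definition zero_module :: "('a, 'b set) module" where
  "zero_module =
    \<lparr>carrier = {{}}, monoid.mult = undefined, one = undefined,
     ring.zero = {}, add = (\<lambda>_ _. {}), smult = (\<lambda>_ _. {})\<rparr>"

section \<open>Homology of integer-graded complexes\<close>

text \<open>The differential \<open>bd d\<close> goes from \<open>C d\<close> to \<open>C (d - 1)\<close>.\<close>

definition homology ::
    "(int \<Rightarrow> ('b, 'm) ring_scheme) \<Rightarrow> (int \<Rightarrow> 'b \<Rightarrow> 'b) \<Rightarrow> int \<Rightarrow> 'b set monoid" where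
  "homology C bd d =
    (C d)\<lparr>carrier := a_kernel (C d) (C (d - 1)) (bd d)\<rparr> A_Mod (bd (d + 1) ` carrier (C (d + 1)))"

section \<open>The complex\<close>

type_synonym 'a hb_chain = "((hb_gen list \<Rightarrow> 'a) set \<times> 'a \<Rightarrow>\<^sub>0 int) set"

definition D_chains ::
    "('a, 'm) ring_scheme \<Rightarrow> 'a \<Rightarrow> nat \<Rightarrow> int \<Rightarrow> ((hb_gen list \<Rightarrow> 'a) set, 'a hb_chain) module" where
  "D_chains R q n r =
    (if -1 \<le> r \<and> r \<le> int n - 1
     then tensor_product (HB R q n) (hb_sub R q n (nat (int n - r - 1))) (hb_triv R q n)
     else zero_module)"

definition D_face :: "('a, 'm) ring_scheme \<Rightarrow> 'a \<Rightarrow> nat \<Rightarrow> nat \<Rightarrow> nat \<Rightarrow> 'a hb_chain \<Rightarrow> 'a hb_chain" where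
  "D_face R q n r j =
    tensor_map (HB R q n) (hb_sub R q n (n - r)) (hb_triv R q n)
      (\<lambda>x. x \<otimes>\<^bsub>HB R q n\<^esub> hb_Tprod R q n (n - r + j) (n - r))"

text \<open>
  The target of \<open>D_bd R q n r\<close> is the module in degree \<open>r - 1\<close>, which is a tensor product
  over the subalgebra with index \<open>n - (r - 1) - 1 = n - r\<close>. The scalar \<open>(-1)\<^sup>j q\<^sup>-\<^sup>j\<close> acts through
  the left module structure.
\<close>

definition D_bd :: "('a, 'm) ring_scheme \<Rightarrow> 'a \<Rightarrow> nat \<Rightarrow> int \<Rightarrow> 'a hb_chain \<Rightarrow> 'a hb_chain" where
  "D_bd R q n r z =
    (if 0 \<le> r \<and> r \<le> int n - 1
     then (\<Oplus>\<^bsub>D_chains R q n (r - 1)\<^esub>j\<in>{..nat r}.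
            hb_scalar R q n ((\<ominus>\<^bsub>R\<^esub> \<one>\<^bsub>R\<^esub>) [^]\<^bsub>R\<^esub> j \<otimes>\<^bsub>R\<^esub> (inv\<^bsub>R\<^esub> q) [^]\<^bsub>R\<^esub> j)
              \<odot>\<^bsub>D_chains R q n (r - 1)\<^esub> D_face R q n (nat r) j z)
     else \<zero>\<^bsub>D_chains R q n (r - 1)\<^esub>)"

end

theory Submission
  imports Defs "HOL-Library.Function_Algebras"
begin

text \<open>
  Let \<open>J\<^sub>m\<close> be the left ideal of \<open>HB\<^sub>n\<close> generated by \<open>U - q\<close> and \<open>T\<^sub>i - q\<close> for \<open>i < m\<close>. Then
  \<open>HB\<^sub>n \<otimes> 1\<close> over \<open>HB\<^sub>m\<close> is \<open>HB\<^sub>n / J\<^sub>m\<close>, and the differential is right multiplication by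
  \<open>\<delta>\<^sub>m = 1 - q\<^sup>-\<^sup>1 T\<^sub>m + q\<^sup>-\<^sup>2 T\<^bsub>m+1\<^esub> T\<^sub>m - \<dots>\<close>, where \<open>\<delta>\<^sub>m = 1 - q\<^sup>-\<^sup>1 \<delta>\<^bsub>m+1\<^esub> T\<^sub>m\<close>. So one has to show
  that \<open>x \<delta>\<^bsub>m+1\<^esub> \<in> J\<^bsub>m+1\<^esub>\<close> implies \<open>x \<in> HB\<^sub>n \<delta>\<^sub>m + J\<^sub>m\<close>.

  Over \<open>HB\<^bsub>n-1\<^esub>\<close> the left module \<open>HB\<^sub>n\<close> is free on the \<open>2n\<close> elements \<open>a\<^sub>i = T\<^bsub>n-1\<^esub> \<cdots> T\<^sub>i\<close> and
  \<open>b\<^sub>i = T\<^bsub>n-1\<^esub> \<cdots> T\<^sub>1 U T\<^sub>1 \<cdots> T\<^bsub>i-1\<^esub>\<close>. Right multiplication by the generators therefore turns \<open>V\<^sup>2\<^sup>n\<close>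
  into a right \<open>HB\<^sub>n\<close>-module for every right \<open>HB\<^bsub>n-1\<^esub>\<close>-module \<open>V\<close>, and \<open>HB\<^sub>n\<close> arises from \<open>R\<close> by
  iterating this. If the exactness statement, with all truncations of the sums \<open>\<delta>\<^sub>m\<close> included,
  holds for \<open>V\<close>, then it holds for \<open>V\<^sup>2\<^sup>n\<close>: up to boundaries the coefficients of the \<open>b\<^sub>i\<close> and
  then of the \<open>a\<^sub>i\<close> with \<open>i > m\<close> can be removed in the order of increasing \<open>i\<close> by the hypothesis
  on \<open>V\<close>. Only one \<open>a\<^sub>s\<close> is spared; it makes the remaining complex a cone, which is contracted
  explicitly. This is the deformation of the argument for signed injective words that sorts
  words by the number of letters after \<open>\<plusminus>n\<close>.
\<close>

text \<open>The freeness of HB_n over HB_{n-1} is only a source of formulas. It prescribes how a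
  generator acts on the coefficients of the a_i and b_i, and the defining relations are then
  verified directly on the induced module, slot by slot. The iterated module is not identified with
  HB_n either: a module map onto HB_n with a section is enough, because a cycle can be lifted by the
  section and the chain that it bounds can be projected back.

  The truncations are forced by the induction. The terms of \<open>bdry k m\<close> are products
  T_{m+j-1} ... T_m, and the coefficient of a_i reacts to them in two ways. For j < i - m all
  factors act on this coefficient itself; every longer product contains T_{i-1}, which replaces it
  by the coefficient of a_{i-1}. Once the latter has been removed, coefficient i sees a sum of at
  most i - m terms, so the hypothesis on V is needed with a number of terms that varies with i.

  All removals take place modulo \<open>Aug m\<close>. This is harmless because U and the T_j with j
  < m commute with every T_i with i > m, so that the operators in later boundaries preserve
  \<open>Aug m\<close>.\<close>

section \<open>Right modules over the Hecke algebra of type B\<close>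

definition additive_map :: "('a::ab_group_add \<Rightarrow> 'b::ab_group_add) \<Rightarrow> bool" where
  "additive_map f \<longleftrightarrow> (\<forall>x y. f (x + y) = f x + f y)"

lemma additive_map_add: "additive_map f \<Longrightarrow> f (x + y) = f x + f y"
  by (simp add: additive_map_def)

lemma additive_map_zero: "additive_map f \<Longrightarrow> f 0 = 0"
  using additive_map_add[of f 0 0] by simp

lemma additive_map_minus: "additive_map f \<Longrightarrow> f (- x) = - f x"
  using additive_map_add[of f x "- x"] additive_map_zero[of f] by (simp add: eq_neg_iff_add_eq_0 add.commute)

lemma additive_map_diff: "additive_map f \<Longrightarrow> f (x - y) = f x - f y"
  using additive_map_add[of f x "- y"] additive_map_minus[of f y] by simp

lemmas additive_map_simps = additive_map_add additive_map_zero additive_map_minus additive_map_diff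

text \<open>
  Right modules over \<open>HB\<^sub>n\<close>, with \<open>t j x\<close> for \<open>x T\<^sub>j\<close> and with \<open>q\<close> acting by the automorphism \<open>Q\<close>. The
  module that is meant is the quotient by the submodule \<open>Z\<close>: since \<open>R\<close> is a carrier set and not a
  type, its elements are represented by formal sums, and \<open>Z\<close> consists of the representatives of
  zero.
\<close>

locale hb_module =
  fixes n :: nat and Q Qi u :: "'v::ab_group_add \<Rightarrow> 'v" and t :: "nat \<Rightarrow> 'v \<Rightarrow> 'v" and Z :: "'v set"
  assumes Q_additive: "additive_map Q" and Qi_additive: "additive_map Qi"
    and u_additive: "additive_map u" and t_additive: "\<And>j. additive_map (t j)"
    and Q_Qi [simp]: "\<And>x. Q (Qi x) = x" and Qi_Q [simp]: "\<And>x. Qi (Q x) = x"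
    and u_Q: "\<And>x. u (Q x) = Q (u x)" and t_Q: "\<And>j x. t j (Q x) = Q (t j x)"
    and zero_Z: "0 \<in> Z" and diff_Z: "\<And>x y. x \<in> Z \<Longrightarrow> y \<in> Z \<Longrightarrow> x - y \<in> Z"
    and Q_Z: "\<And>x. x \<in> Z \<Longrightarrow> Q x \<in> Z" and Qi_Z: "\<And>x. x \<in> Z \<Longrightarrow> Qi x \<in> Z"
    and u_Z: "\<And>x. 1 \<le> n \<Longrightarrow> x \<in> Z \<Longrightarrow> u x \<in> Z"
    and t_Z: "\<And>j x. 1 \<le> j \<Longrightarrow> j < n \<Longrightarrow> x \<in> Z \<Longrightarrow> t j x \<in> Z"
    and u_quad: "\<And>x. 1 \<le> n \<Longrightarrow> u (u x) = Q (u x) - u x + Q x"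
    and t_quad: "\<And>j x. 1 \<le> j \<Longrightarrow> j < n \<Longrightarrow> t j (t j x) = Q (t j x) - t j x + Q x"
    and u_t_braid: "\<And>x. 1 < n \<Longrightarrow> t 1 (u (t 1 (u x))) = u (t 1 (u (t 1 x)))"
    and u_t_comm: "\<And>j x. 1 < j \<Longrightarrow> j < n \<Longrightarrow> t j (u x) = u (t j x)"
    and t_braid: "\<And>j x. 1 \<le> j \<Longrightarrow> j + 1 < n \<Longrightarrow> t j (t (j + 1) (t j x)) = t (j + 1) (t j (t (j + 1) x))"
    and t_comm: "\<And>i j x. 1 \<le> i \<Longrightarrow> i + 1 < j \<Longrightarrow> j < n \<Longrightarrow> t j (t i x) = t i (t j x)"
begin

lemmas Q_simps = additive_map_simps[OF Q_additive]
lemmas Qi_simps = additive_map_simps[OF Qi_additive]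
lemmas u_simps = additive_map_simps[OF u_additive] u_Q
lemmas t_simps = additive_map_simps[OF t_additive] t_Q

lemma u_Qi: "u (Qi x) = Qi (u x)"
  by (metis Q_Qi Qi_Q u_Q)

lemma t_Qi: "t j (Qi x) = Qi (t j x)"
  by (metis Q_Qi Qi_Q t_Q)

lemmas op_simps = Q_simps Qi_simps u_simps t_simps u_Qi t_Qi

end

section \<open>The induced module on 2n slots\<close>

text \<open>
  Functions on integer sequences form a type closed under \<open>V \<mapsto> V\<^sup>2\<^sup>n\<close>: the head of the sequence
  selects the coefficient. Slot \<open>k > 0\<close> is the coefficient of \<open>a\<^sub>k\<close> and slot \<open>-k\<close> that of \<open>b\<^sub>k\<close>. The
  other slots are junk: they lie in \<open>Z\<close>, and every generator acts on them as \<open>q\<close>.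
\<close>

definition slot :: "int \<Rightarrow> ((nat \<Rightarrow> int) \<Rightarrow> 'g) \<Rightarrow> (nat \<Rightarrow> int) \<Rightarrow> 'g" where
  "slot k f = (\<lambda>s. f (case_nat k s))"

definition unslot :: "(int \<Rightarrow> (nat \<Rightarrow> int) \<Rightarrow> 'g) \<Rightarrow> (nat \<Rightarrow> int) \<Rightarrow> 'g" where
  "unslot g = (\<lambda>s. g (s 0) (\<lambda>i. s (Suc i)))"

lemma slot_unslot [simp]: "slot k (unslot g) = g k"
  by (simp add: slot_def unslot_def)

lemma slot_ext: "(\<And>k. slot k f = slot k g) \<Longrightarrow> f = g"
proof
  fix s :: "nat \<Rightarrow> int"
  assume "\<And>k. slot k f = slot k g"
  then have "slot (s 0) f (\<lambda>i. s (Suc i)) = slot (s 0) g (\<lambda>i. s (Suc i))" by simp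
  moreover have "case_nat (s 0) (\<lambda>i. s (Suc i)) = s" by (auto split: nat.split)
  ultimately show "f s = g s" by (simp add: slot_def)
qed

lemma slot_simps [simp]:
  fixes f g :: "(nat \<Rightarrow> int) \<Rightarrow> 'g::ab_group_add"
  shows "slot k (f + g) = slot k f + slot k g" "slot k (f - g) = slot k f - slot k g"
    "slot k (- f) = - slot k f" "slot k 0 = (0 :: (nat \<Rightarrow> int) \<Rightarrow> 'g)"
  by (auto simp: slot_def)

type_synonym 'g op = "((nat \<Rightarrow> int) \<Rightarrow> 'g) \<Rightarrow> (nat \<Rightarrow> int) \<Rightarrow> 'g"

definition valid_slot :: "nat \<Rightarrow> int \<Rightarrow> bool" where
  "valid_slot n k \<longleftrightarrow> k \<noteq> 0 \<and> \<bar>k\<bar> \<le> int n"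

text \<open>Read off from a_1 U = b_1 and b_1 U = (q - 1) b_1 + q a_1, collecting the coefficients
  of a_1 and of b_1. All other a_k and b_k commute with U, which therefore acts on their
  coefficients.\<close>

definition ind_u :: "nat \<Rightarrow> 'g::ab_group_add op \<Rightarrow> 'g op \<Rightarrow> 'g op" where
  "ind_u n Q u f = unslot (\<lambda>k.
     if \<not> valid_slot n k then Q (slot k f)
     else if k = 1 then Q (slot (-1) f)
     else if k = -1 then Q (slot (-1) f) - slot (-1) f + slot 1 f
     else u (slot k f))"

text \<open>Read off from a_{j+1} T_j = a_j and b_j T_j = b_{j+1}; the quadratic relation gives the
  products of a_j and b_{j+1} with T_j. For k < j the braid relation turns T_j into T_{j-1} when it
  passes a_k or b_k, whence the lowered index; for k > j + 1 it passes unchanged.\<close>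

definition ind_t :: "nat \<Rightarrow> 'g::ab_group_add op \<Rightarrow> (nat \<Rightarrow> 'g op) \<Rightarrow> nat \<Rightarrow> 'g op" where
  "ind_t n Q t j f = unslot (\<lambda>k.
     if \<not> valid_slot n k then Q (slot k f)
     else if k = int j \<or> k = - 1 - int j then Q (slot k f) - slot k f + slot (k + 1) f
     else if k = int j + 1 \<or> k = - int j then Q (slot (k - 1) f)
     else if \<bar>k\<bar> < int j then t (j - 1) (slot k f)
     else t j (slot k f))"

definition ind_Z :: "nat \<Rightarrow> ((nat \<Rightarrow> int) \<Rightarrow> 'g) set \<Rightarrow> ((nat \<Rightarrow> int) \<Rightarrow> 'g) set" where
  "ind_Z n Z = {f. \<forall>k. valid_slot n k \<longrightarrow> slot k f \<in> Z}"

locale hb_slots = hb_module N Q Qi u t Z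
  for N :: nat and Q Qi u :: "'g::ab_group_add op" and t :: "nat \<Rightarrow> 'g op" and Z +
  assumes slot_Q: "\<And>k f. slot k (Q f) = Q (slot k f)" and slot_Qi: "\<And>k f. slot k (Qi f) = Qi (slot k f)"
begin

abbreviation "U \<equiv> ind_u (Suc N) Q u"
abbreviation "T \<equiv> ind_t (Suc N) Q t"

lemma slot_U:
  "slot k (U f) = (if \<not> valid_slot (Suc N) k then Q (slot k f)
     else if k = 1 then Q (slot (-1) f)
     else if k = -1 then Q (slot (-1) f) - slot (-1) f + slot 1 f
     else u (slot k f))"
  by (simp add: ind_u_def)

lemma slot_T:
  "slot k (T j f) = (if \<not> valid_slot (Suc N) k then Q (slot k f)
     else if k = int j \<or> k = - 1 - int j then Q (slot k f) - slot k f + slot (k + 1) f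
     else if k = int j + 1 \<or> k = - int j then Q (slot (k - 1) f)
     else if \<bar>k\<bar> < int j then t (j - 1) (slot k f)
     else t j (slot k f))"
  by (simp add: ind_t_def)

lemma slot_T_diag:
  "valid_slot (Suc N) k \<Longrightarrow> \<bar>k\<bar> < int j \<Longrightarrow> slot k (T j f) = t (j - 1) (slot k f)"
  "valid_slot (Suc N) k \<Longrightarrow> int j + 1 < \<bar>k\<bar> \<Longrightarrow> slot k (T j f) = t j (slot k f)"
  by (subst slot_T; force)+

lemma slot_T_invalid [simp]: "\<not> valid_slot (Suc N) k \<Longrightarrow> slot k (T j f) = Q (slot k f)"
  by (simp add: slot_T)

lemma slot_U_diag:
  "valid_slot (Suc N) k \<Longrightarrow> 1 < \<bar>k\<bar> \<Longrightarrow> slot k (U f) = u (slot k f)"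
  "\<not> valid_slot (Suc N) k \<Longrightarrow> slot k (U f) = Q (slot k f)"
  by (subst slot_U; force)+

lemma minus_int_diff_one: "- int j - 1 = - 1 - int j"
  by simp

lemmas slot_norm = slot_T slot_U valid_slot_def op_simps t_quad u_quad
lemmas sum_norm = algebra_simps minus_int_diff_one

text \<open>Slots below \<open>j\<close> see the braid relation of V at \<open>j - 1\<close>, slots
  above \<open>j + 2\<close> see it at \<open>j\<close>. On the slots that are exchanged,
  \<open>T (j + 1)\<close> acts on slot \<open>j\<close> and \<open>T j\<close> on slot
  \<open>j + 2\<close> through the same operator \<open>t j\<close>, so the quadratic relation of V
  is what closes the computation.\<close>

lemma T_braid:
  assumes "1 \<le> j" "j + 1 < Suc N"
  shows "T j (T (j + 1) (T j f)) = T (j + 1) (T j (T (j + 1) f))"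
proof (rule slot_ext)
  fix k
  consider "\<not> valid_slot (Suc N) k" | "valid_slot (Suc N) k" "k = int j" | "valid_slot (Suc N) k" "k = int j + 1"
    | "valid_slot (Suc N) k" "k = int j + 2" | "valid_slot (Suc N) k" "k = - int j" | "valid_slot (Suc N) k" "k = - 1 - int j"
    | "valid_slot (Suc N) k" "k = - 2 - int j" | "valid_slot (Suc N) k" "\<bar>k\<bar> < int j" | "valid_slot (Suc N) k" "\<bar>k\<bar> > int j + 2"
    by linarith
  then show "slot k (T j (T (j + 1) (T j f))) = slot k (T (j + 1) (T j (T (j + 1) f)))"
  proof cases
    case 1
    then show ?thesis by (simp add: slot_U_diag slot_Q)
  next
    case 8
    obtain i where i: "j = Suc i" using assms by (cases j) auto
    have "1 \<le> \<bar>k\<bar>" using 8 unfolding valid_slot_def by linarith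
    then have "1 \<le> i" "i + 1 < N" using 8(2) i assms by linarith+
    then show ?thesis using 8 i t_braid[of i "slot k f"] by (simp add: slot_T_diag)
  next
    case 9
    then have "j + 1 < N" using assms by (auto simp: valid_slot_def)
    then show ?thesis using 9 t_braid[of j "slot k f"] assms by (simp add: slot_T_diag)
  next
    case 2
    then show ?thesis using assms by (simp add: slot_norm, (simp (no_asm) add: sum_norm)?)
  next
    case 3
    then show ?thesis using assms by (simp add: slot_norm, (simp (no_asm) add: sum_norm)?)
  next
    case 4
    then show ?thesis using assms by (simp add: slot_norm, (simp (no_asm) add: sum_norm)?)
  next
    case 5
    then show ?thesis using assms by (simp add: slot_norm, (simp (no_asm) add: sum_norm)?)
  next
    case 6
    then show ?thesis using assms by (simp add: slot_norm, (simp (no_asm) add: sum_norm)?)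
  next
    case 7
    then show ?thesis using assms by (simp add: slot_norm, (simp (no_asm) add: sum_norm)?)
  qed
qed

lemma T_quad:
  assumes "1 \<le> j" "j < Suc N"
  shows "T j (T j f) = Q (T j f) - T j f + Q f"
proof (rule slot_ext)
  fix k
  consider "\<not> valid_slot (Suc N) k" | "k = int j" | "k = int j + 1" | "k = - int j" | "k = - 1 - int j"
    | "valid_slot (Suc N) k" "\<bar>k\<bar> < int j" | "valid_slot (Suc N) k" "\<bar>k\<bar> > int j + 1"
    by linarith
  then show "slot k (T j (T j f)) = slot k (Q (T j f) - T j f + Q f)"
  proof cases
    case 1
    then show ?thesis by (simp add: slot_U_diag slot_Q)
  next
    case 6
    then have "1 \<le> j - 1" "j - 1 < N" using assms by (auto simp: valid_slot_def)
    then show ?thesis using 6 t_quad by (simp add: slot_T_diag slot_Q)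
  next
    case 7
    then have "j < N" by (auto simp: valid_slot_def)
    then show ?thesis using 7 assms t_quad by (simp add: slot_T_diag slot_Q)
  next
    case 2
    then show ?thesis using assms by (simp add: slot_T slot_Q valid_slot_def op_simps, (simp (no_asm) add: algebra_simps minus_int_diff_one)?)
  next
    case 3
    then show ?thesis using assms by (simp add: slot_T slot_Q valid_slot_def op_simps, (simp (no_asm) add: algebra_simps minus_int_diff_one)?)
  next
    case 4
    then show ?thesis using assms by (simp add: slot_T slot_Q valid_slot_def op_simps, (simp (no_asm) add: algebra_simps minus_int_diff_one)?)
  next
    case 5
    then show ?thesis using assms by (simp add: slot_T slot_Q valid_slot_def op_simps, (simp (no_asm) add: algebra_simps minus_int_diff_one)?)
  qed
qed

lemma T_comm:
  assumes "1 \<le> i" "i + 1 < j" "j < Suc N"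
  shows "T j (T i f) = T i (T j f)"
proof (rule slot_ext)
  fix k
  have c: "\<bar>k\<bar> < int i \<Longrightarrow> k \<noteq> 0 \<Longrightarrow> t (j - 1) (t (i - 1) x) = t (i - 1) (t (j - 1) x)"
    "int i + 1 < \<bar>k\<bar> \<Longrightarrow> \<bar>k\<bar> < int j \<Longrightarrow> t (j - 1) (t i x) = t i (t (j - 1) x)"
    "int j + 1 < \<bar>k\<bar> \<Longrightarrow> \<bar>k\<bar> \<le> int N + 1 \<Longrightarrow> t j (t i x) = t i (t j x)" for x
    using assms by (auto intro!: t_comm)
  have v: "valid_slot (Suc N) k \<longleftrightarrow> k \<noteq> 0 \<and> \<bar>k\<bar> \<le> int N + 1" by (auto simp: valid_slot_def)
  consider "\<not> valid_slot (Suc N) k" | "k = int i" | "k = int i + 1" | "k = - int i" | "k = - 1 - int i"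
    | "k = int j" | "k = int j + 1" | "k = - int j" | "k = - 1 - int j"
    | "valid_slot (Suc N) k" "\<bar>k\<bar> < int i" "\<bar>k\<bar> < int j"
    | "valid_slot (Suc N) k" "int i + 1 < \<bar>k\<bar>" "\<bar>k\<bar> < int j"
    | "valid_slot (Suc N) k" "int i + 1 < \<bar>k\<bar>" "int j + 1 < \<bar>k\<bar>"
  proof -
    have "\<bar>k\<bar> = int m \<Longrightarrow> k = int m \<or> k = - int m" "\<bar>k\<bar> = int m + 1 \<Longrightarrow> k = int m + 1 \<or> k = - 1 - int m" for m
      by linarith+
    moreover have "\<bar>k\<bar> < int i \<and> \<bar>k\<bar> < int j \<or> \<bar>k\<bar> = int i \<or> \<bar>k\<bar> = int i + 1 \<or> int i + 1 < \<bar>k\<bar> \<and> \<bar>k\<bar> < int j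
      \<or> \<bar>k\<bar> = int j \<or> \<bar>k\<bar> = int j + 1 \<or> int i + 1 < \<bar>k\<bar> \<and> int j + 1 < \<bar>k\<bar>"
      using assms by linarith
    ultimately show thesis using that by metis
  qed
  then show "slot k (T j (T i f)) = slot k (T i (T j f))"
  proof cases
    case 1
    then show ?thesis by (simp add: slot_U_diag slot_Q)
  next
    case 10
    then show ?thesis using c v by (simp add: slot_T_diag)
  next
    case 11
    then show ?thesis using c v by (simp add: slot_T_diag)
  next
    case 12
    then show ?thesis using c v by (simp add: slot_T_diag)
  next
    case 2
    then show ?thesis using assms by (simp add: slot_T valid_slot_def op_simps)
  next
    case 3
    then show ?thesis using assms by (simp add: slot_T valid_slot_def op_simps)
  next
    case 4
    then show ?thesis using assms by (simp add: slot_T valid_slot_def op_simps)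
  next
    case 5
    then show ?thesis using assms by (simp add: slot_T valid_slot_def op_simps)
  next
    case 6
    then show ?thesis using assms by (simp add: slot_T valid_slot_def op_simps)
  next
    case 7
    then show ?thesis using assms by (simp add: slot_T valid_slot_def op_simps)
  next
    case 8
    then show ?thesis using assms by (simp add: slot_T valid_slot_def op_simps)
  next
    case 9
    then show ?thesis using assms by (simp add: slot_T valid_slot_def op_simps)
  qed
qed

lemma U_quad: "U (U f) = Q (U f) - U f + Q f"
proof (rule slot_ext)
  fix k
  show "slot k (U (U f)) = slot k (Q (U f) - U f + Q f)"
    using u_quad
    by (auto simp add: slot_U slot_Q valid_slot_def op_simps algebra_simps)
qed

lemma U_T_comm:
  assumes "1 < j" "j < Suc N"
  shows "T j (U f) = U (T j f)"
proof (rule slot_ext)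
  fix k
  have c: "\<bar>k\<bar> < int j \<Longrightarrow> 1 < \<bar>k\<bar> \<Longrightarrow> t (j - 1) (u x) = u (t (j - 1) x)"
    "int j + 1 < \<bar>k\<bar> \<Longrightarrow> \<bar>k\<bar> \<le> int N + 1 \<Longrightarrow> t j (u x) = u (t j x)" for x
    using assms by (auto intro!: u_t_comm)
  have v: "valid_slot (Suc N) k \<longleftrightarrow> k \<noteq> 0 \<and> \<bar>k\<bar> \<le> int N + 1" by (auto simp: valid_slot_def)
  consider "\<not> valid_slot (Suc N) k" | "k = 1" | "k = -1"
    | "k = int j" | "k = int j + 1" | "k = - int j" | "k = - 1 - int j"
    | "valid_slot (Suc N) k" "1 < \<bar>k\<bar>" "\<bar>k\<bar> < int j"
    | "valid_slot (Suc N) k" "1 < \<bar>k\<bar>" "int j + 1 < \<bar>k\<bar>"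
    using assms unfolding valid_slot_def by linarith
  then show "slot k (T j (U f)) = slot k (U (T j f))"
  proof cases
    case 1
    then show ?thesis by (simp add: slot_U_diag slot_Q)
  next
    case 8
    then show ?thesis using c v by (simp add: slot_T_diag slot_U_diag)
  next
    case 9
    then show ?thesis using c v by (simp add: slot_T_diag slot_U_diag)
  next
    case 2
    then show ?thesis using assms by (simp add: slot_T slot_U valid_slot_def op_simps)
  next
    case 3
    then show ?thesis using assms by (simp add: slot_T slot_U valid_slot_def op_simps)
  next
    case 4
    then show ?thesis using assms by (simp add: slot_T slot_U valid_slot_def op_simps)
  next
    case 5
    then show ?thesis using assms by (simp add: slot_T slot_U valid_slot_def op_simps)
  next
    case 6
    then show ?thesis using assms by (simp add: slot_T slot_U valid_slot_def op_simps)
  next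
    case 7
    then show ?thesis using assms by (simp add: slot_T slot_U valid_slot_def op_simps)
  qed
qed

lemma U_T_braid:
  assumes "1 < Suc N"
  shows "T 1 (U (T 1 (U f))) = U (T 1 (U (T 1 f)))"
proof (rule slot_ext)
  fix k
  have c: "2 < \<bar>k\<bar> \<Longrightarrow> \<bar>k\<bar> \<le> int N + 1 \<Longrightarrow> t 1 (u (t 1 (u x))) = u (t 1 (u (t 1 x)))" for x
    by (rule u_t_braid) linarith
  consider "\<not> valid_slot (Suc N) k" | "k = 1" | "k = 2" | "k = -1" | "k = -2" | "valid_slot (Suc N) k" "2 < \<bar>k\<bar>"
    unfolding valid_slot_def by linarith
  then show "slot k (T 1 (U (T 1 (U f)))) = slot k (U (T 1 (U (T 1 f))))"
  proof cases
    case 1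
    then show ?thesis by (simp add: slot_U_diag slot_Q)
  next
    case 6
    then show ?thesis using c[of "slot k f"] by (simp add: slot_T_diag slot_U_diag valid_slot_def)
  next
    case 2
    then show ?thesis using assms by (simp add: slot_norm, (simp (no_asm) add: sum_norm)?)
  next
    case 3
    then show ?thesis using assms by (simp add: slot_norm, (simp (no_asm) add: sum_norm)?)
  next
    case 4
    then show ?thesis using assms by (simp add: slot_norm, (simp (no_asm) add: sum_norm)?)
  next
    case 5
    then show ?thesis using assms by (simp add: slot_norm, (simp (no_asm) add: sum_norm)?)
  qed
qed

sublocale W: hb_module "Suc N" Q Qi U T "ind_Z (Suc N) Z"
proof
  show "additive_map U" unfolding additive_map_def
  proof (intro allI, rule slot_ext)
    fix f g k
    consider "\<not> valid_slot (Suc N) k" | "k = 1" | "k = -1" | "valid_slot (Suc N) k" "k \<noteq> 1" "k \<noteq> -1" by blast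
    then show "slot k (U (f + g)) = slot k (U f + U g)"
      by cases (simp_all add: slot_U op_simps)
  qed
  show "U (Q f) = Q (U f)" for f
    by (rule slot_ext) (simp add: slot_U slot_Q op_simps)
  have cases: P if "\<not> valid_slot (Suc N) k \<Longrightarrow> P"
    "valid_slot (Suc N) k \<Longrightarrow> k = int j \<or> k = - 1 - int j \<Longrightarrow> P"
    "valid_slot (Suc N) k \<Longrightarrow> \<not> (k = int j \<or> k = - 1 - int j) \<Longrightarrow> k = int j + 1 \<or> k = - int j \<Longrightarrow> P"
    "valid_slot (Suc N) k \<Longrightarrow> \<not> (k = int j \<or> k = - 1 - int j) \<Longrightarrow> \<not> (k = int j + 1 \<or> k = - int j)
      \<Longrightarrow> \<bar>k\<bar> < int j \<Longrightarrow> P"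
    "valid_slot (Suc N) k \<Longrightarrow> \<not> (k = int j \<or> k = - 1 - int j) \<Longrightarrow> \<not> (k = int j + 1 \<or> k = - int j)
      \<Longrightarrow> \<not> \<bar>k\<bar> < int j \<Longrightarrow> P" for P and k :: int and j :: nat
    using that by blast
  show "additive_map (T j)" for j unfolding additive_map_def
  proof (intro allI, rule slot_ext)
    fix f g k
    show "slot k (T j (f + g)) = slot k (T j f + T j g)"
      by (rule cases[where k = k and j = j]; (simp only: slot_T slot_simps not_False_eq_True not_True_eq_False if_True if_False op_simps; simp (no_asm)))
  qed
  show "T j (Q f) = Q (T j f)" for j f
  proof (rule slot_ext)
    fix k
    show "slot k (T j (Q f)) = slot k (Q (T j f))"
      by (rule cases[where k = k and j = j]; (simp only: slot_T slot_Q slot_simps not_False_eq_True not_True_eq_False if_True if_False op_simps))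
  qed
  have add_Z: "x + y \<in> Z" if "x \<in> Z" "y \<in> Z" for x y
    using diff_Z[OF that(1) diff_Z[OF zero_Z that(2)]] by simp
  show "U f \<in> ind_Z (Suc N) Z" if "f \<in> ind_Z (Suc N) Z" for f
    using that unfolding ind_Z_def by (auto simp: slot_U valid_slot_def intro!: Q_Z u_Z add_Z diff_Z)
  show "T j f \<in> ind_Z (Suc N) Z" if "1 \<le> j" "j < Suc N" "f \<in> ind_Z (Suc N) Z" for j f
    using that unfolding ind_Z_def by (auto simp: slot_T valid_slot_def intro!: Q_Z t_Z add_Z diff_Z)
qed (use T_braid T_quad T_comm U_quad U_T_comm U_T_braid in
  \<open>auto simp: Q_additive Qi_additive ind_Z_def slot_Q slot_Qi zero_Z diff_Z Q_Z Qi_Z\<close>)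

end

section \<open>Augmentation submodules and truncated boundaries\<close>

context hb_module
begin

text \<open>The kernel of the map from V to its tensor product with the trivial module over HB_m;
  for V = HB_n it is the left ideal J_m.\<close>

inductive_set Aug :: "nat \<Rightarrow> 'v set" for m where
  Aug_Z: "x \<in> Z \<Longrightarrow> x \<in> Aug m"
| Aug_u: "1 \<le> m \<Longrightarrow> u x - Q x \<in> Aug m"
| Aug_t: "1 \<le> j \<Longrightarrow> j < m \<Longrightarrow> t j x - Q x \<in> Aug m"
| Aug_diff: "x \<in> Aug m \<Longrightarrow> y \<in> Aug m \<Longrightarrow> x - y \<in> Aug m"

text \<open>\<open>bdry k m x\<close> is \<open>x \<delta>\<^sub>m\<close> with the sum truncated to its first \<open>k\<close> terms.\<close>

primrec bdry :: "nat \<Rightarrow> nat \<Rightarrow> 'v \<Rightarrow> 'v" where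
  "bdry 0 m x = 0"
| "bdry (Suc k) m x = x - Qi (t m (bdry k (Suc m) x))"

text \<open>For \<open>k = n - m\<close> this is exactness of the complex in degree n - 1 - m. A
  smaller \<open>k\<close> involves only the T_i with i < m + k and is the corresponding statement
  for the restriction of V to HB_{m+k}.\<close>

definition exact :: bool where
  "exact \<longleftrightarrow> (\<forall>k m x. 1 \<le> m \<longrightarrow> m + k \<le> n \<longrightarrow> bdry k (Suc m) x \<in> Aug (Suc m) \<longrightarrow> (\<exists>y. x - bdry (Suc k) m y \<in> Aug m))"

lemma Aug_zero: "0 \<in> Aug m"
  using Aug_Z zero_Z by blast

lemma Aug_minus: "x \<in> Aug m \<Longrightarrow> - x \<in> Aug m"
  using Aug_diff[OF Aug_zero] by force

lemma Aug_add: "x \<in> Aug m \<Longrightarrow> y \<in> Aug m \<Longrightarrow> x + y \<in> Aug m"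
  using Aug_diff[OF _ Aug_minus] by force

lemma Aug_sum: "(\<And>i. i \<in> I \<Longrightarrow> f i \<in> Aug m) \<Longrightarrow> sum f I \<in> Aug m"
  by (induction I rule: infinite_finite_induct) (auto intro: Aug_zero Aug_add)

lemma Aug_mono: "x \<in> Aug m \<Longrightarrow> m \<le> m' \<Longrightarrow> x \<in> Aug m'"
  by (induction rule: Aug.induct) (auto intro: Aug.intros)

lemma Aug_Q: "x \<in> Aug m \<Longrightarrow> Q x \<in> Aug m"
proof (induction rule: Aug.induct)
  case (Aug_u x) then show ?case using Aug.Aug_u[of m "Q x"] by (simp add: op_simps)
next
  case (Aug_t j x) then show ?case using Aug.Aug_t[of j m "Q x"] by (simp add: op_simps)
qed (auto simp: op_simps intro: Aug.intros Q_Z)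

lemma Aug_Qi: "x \<in> Aug m \<Longrightarrow> Qi x \<in> Aug m"
proof (induction rule: Aug.induct)
  case (Aug_u x) then show ?case using Aug.Aug_u[of m "Qi x"] by (simp add: op_simps)
next
  case (Aug_t j x) then show ?case using Aug.Aug_t[of j m "Qi x"] by (simp add: op_simps)
qed (auto simp: op_simps intro: Aug.intros Qi_Z)

text \<open>T_i with i > m commutes with U and with each T_j, j < m, so it maps the generators of
  \<open>Aug m\<close> to generators.\<close>

lemma Aug_stable:
  assumes "x \<in> Aug m" "m < i" "i < n"
  shows "t i x \<in> Aug m"
  using assms
proof (induction rule: Aug.induct)
  case (Aug_Z x)
  then show ?case using t_Z[of i x] by (auto intro: Aug.Aug_Z)
next
  case (Aug_u x)
  then have "t i (u x - Q x) = u (t i x) - Q (t i x)" using u_t_comm[of i x] by (simp add: op_simps)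
  then show ?case using Aug.Aug_u[of m] Aug_u by simp
next
  case (Aug_t j x)
  then have "t i (t j x - Q x) = t j (t i x) - Q (t i x)" using t_comm[of j i x] by (simp add: op_simps)
  then show ?case using Aug.Aug_t[of j m] Aug_t by simp
qed (auto simp: op_simps intro: Aug.intros t_Z)

lemma bdry_add: "bdry k m (x + y) = bdry k m x + bdry k m y"
  by (induction k arbitrary: m) (simp_all add: op_simps)

lemma bdry_additive: "additive_map (bdry k m)"
  by (simp add: additive_map_def bdry_add)

lemmas bdry_simps = additive_map_simps[OF bdry_additive]

lemma bdry_Q: "bdry k m (Q x) = Q (bdry k m x)"
  by (induction k arbitrary: m) (simp_all add: op_simps)

text \<open>\<open>K\<close> is an arbitrary subgroup so that the same argument covers
  \<open>Aug m\<close> and the zero subgroup. The longest of the \<open>k\<close> products is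
  T_{m+k-2} ... T_m, which explains the bound \<open>m + k \<le> Suc p\<close>.\<close>

lemma bdry_stable:
  assumes "0 \<in> K" "\<And>x y. x \<in> K \<Longrightarrow> y \<in> K \<Longrightarrow> x - y \<in> K" "\<And>x. x \<in> K \<Longrightarrow> Qi x \<in> K"
    and "\<And>j x. m \<le> j \<Longrightarrow> j < p \<Longrightarrow> x \<in> K \<Longrightarrow> t j x \<in> K" and "x \<in> K" "m + k \<le> Suc p"
  shows "bdry k m x \<in> K"
  using assms(4,6)
proof (induction k arbitrary: m)
  case (Suc k)
  have "t m (bdry k (Suc m) x) \<in> K"
  proof (cases k)
    case 0
    then show ?thesis using assms(1) by (simp add: op_simps)
  next
    case (Suc k')
    then have "bdry k (Suc m) x \<in> K" using Suc.prems by (intro Suc.IH) auto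
    then show ?thesis using Suc.prems Suc by auto
  qed
  then show ?case using assms by simp
qed (use assms in simp)

lemma bdry_J: "x \<in> Aug m \<Longrightarrow> m < i \<Longrightarrow> i + k \<le> Suc n \<Longrightarrow> bdry k i x \<in> Aug m"
  by (rule bdry_stable[where p = n]) (auto intro: Aug_zero Aug_diff Aug_Qi Aug_stable)

lemma bdry_t_comm: "1 \<le> m \<Longrightarrow> Suc m < i \<Longrightarrow> i + k \<le> Suc n \<Longrightarrow> bdry k i (t m x) = t m (bdry k i x)"
proof (induction k arbitrary: i)
  case (Suc k)
  show ?case
  proof (cases k)
    case 0
    then show ?thesis by (simp add: op_simps)
  next
    case (Suc k')
    then have "t i (t m y) = t m (t i y)" for y using Suc.prems by (intro t_comm) auto
    then show ?thesis using Suc.prems Suc.IH[of "Suc i"] by (simp add: op_simps)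
  qed
qed (simp add: op_simps)

text \<open>This is the vanishing of the composed differential. Membership in
  \<open>Aug (Suc m)\<close> would be too weak for the induction, which needs the precise right
  factor T_m - q: the braid relation gives (T_{m+1} - q) T_m T_{m+1} = T_m T_{m+1} (T_m - q) and so
  passes the factor from m + 1 to m.\<close>

lemma bdry_bdry: "1 \<le> m \<Longrightarrow> m + k \<le> n \<Longrightarrow> \<exists>z. bdry k (Suc m) (bdry (Suc k) m g) = t m z - Q z"
proof (induction k arbitrary: m g)
  case 0
  then show ?case by (auto intro!: exI[of _ 0] simp: op_simps)
next
  case (Suc k)
  let ?D = "bdry (Suc k) (Suc m)" and ?D' = "bdry k (Suc (Suc m))"
  obtain z where z: "?D' (?D g) = t (Suc m) z - Q z" and z0: "k = 0 \<Longrightarrow> z = 0"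
  proof (cases k)
    case 0
    then show thesis using that[of 0] by (simp add: op_simps)
  next
    case Suc
    then show thesis using Suc.IH[of "Suc m" g] Suc.prems that by auto
  qed
  have comm: "?D' (t m x) = t m (?D' x)" for x using Suc.prems by (intro bdry_t_comm) auto
  have Qi_bdry: "bdry j i (Qi x) = Qi (bdry j i x)" for j i x by (metis Q_Qi Qi_Q bdry_Q)
  have zz: "t (Suc m) (t m (t (Suc m) z - Q z)) = t m (t (Suc m) (t m z)) - Q (t (Suc m) (t m z))"
  proof (cases k)
    case 0
    then show ?thesis using z0 by (simp add: op_simps)
  next
    case (Suc k')
    then show ?thesis using Suc.prems t_braid[of m z] by (simp add: op_simps)
  qed
  have "?D (bdry (Suc (Suc k)) m g) = ?D g - Qi (?D (t m (?D g)))"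
    by (simp add: bdry_simps Qi_bdry op_simps)
  also have "?D (t m (?D g)) = t m (?D g) - Qi (t (Suc m) (t m (?D' (?D g))))"
    by (simp add: comm)
  finally have *: "?D (bdry (Suc (Suc k)) m g) = ?D g - Qi (t m (?D g)) + Qi (Qi (t (Suc m) (t m (t (Suc m) z - Q z))))"
    using z by (simp add: op_simps)
  show ?case unfolding * zz
    by (rule exI[of _ "- Qi (?D g) + Qi (Qi (t (Suc m) (t m z)))"]) (simp add: op_simps)
qed

end

section \<open>Elements concentrated in one slot\<close>

definition slot_in :: "int \<Rightarrow> ((nat \<Rightarrow> int) \<Rightarrow> 'g::zero) \<Rightarrow> (nat \<Rightarrow> int) \<Rightarrow> 'g" where
  "slot_in k y = unslot (\<lambda>l. if l = k then y else 0)"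

lemma slot_slot_in: "slot l (slot_in k y) = (if l = k then y else 0)"
  by (simp add: slot_in_def)

lemma slot_in_additive: "additive_map (slot_in k :: 'g::ab_group_add op)"
  unfolding additive_map_def by (intro allI, rule slot_ext) (simp add: slot_slot_in)

declare minus_apply [simp del] uminus_apply [simp del] plus_fun_apply [simp del] zero_fun_apply [simp del]

lemma slot_sum:
  fixes g :: "'i \<Rightarrow> (nat \<Rightarrow> int) \<Rightarrow> 'g::ab_group_add"
  shows "slot l (sum g A) = (\<Sum>i\<in>A. slot l (g i))"
  by (induction A rule: infinite_finite_induct) auto

context hb_slots
begin

abbreviation "E \<equiv> slot_in"

lemmas slot_E = slot_slot_in

lemmas E_simps = additive_map_simps[OF slot_in_additive]

lemma Q_E: "Q (E k y) = E k (Q y)" and Qi_E: "Qi (E k y) = E k (Qi y)"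
  by (rule slot_ext, simp add: slot_E slot_Q slot_Qi op_simps)+

lemma E_Z: "y \<in> Z \<Longrightarrow> E k y \<in> ind_Z (Suc N) Z"
  by (simp add: ind_Z_def slot_E zero_Z)

lemma T_E_lt: "valid_slot (Suc N) k \<Longrightarrow> \<bar>k\<bar> < int j \<Longrightarrow> T j (E k y) = E k (t (j - 1) y)"
  by (rule slot_ext) (auto simp: slot_T slot_E op_simps)

lemma T_E_gt: "valid_slot (Suc N) k \<Longrightarrow> int j + 1 < \<bar>k\<bar> \<Longrightarrow> T j (E k y) = E k (t j y)"
  by (rule slot_ext) (auto simp: slot_T slot_E op_simps)

lemma T_E_pos: "1 \<le> j \<Longrightarrow> j \<le> N \<Longrightarrow> T j (E (int j + 1) y) = E (int j) y"
  by (rule slot_ext) (auto simp: slot_T slot_E op_simps valid_slot_def)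

lemma T_E_neg: "1 \<le> j \<Longrightarrow> j \<le> N \<Longrightarrow> T j (E (- int j) y) = E (- int j - 1) y"
  by (rule slot_ext) (auto simp: slot_T slot_E op_simps valid_slot_def)

lemma U_E_one: "U (E 1 y) = E (-1) y"
  by (rule slot_ext) (auto simp: slot_U slot_E op_simps valid_slot_def)

lemma U_E: "valid_slot (Suc N) k \<Longrightarrow> 1 < \<bar>k\<bar> \<Longrightarrow> U (E k y) = E k (u y)"
  by (rule slot_ext) (auto simp: slot_U slot_E op_simps)

text \<open>U and the T_j with j < m pass every slot beyond \<open>m\<close> unchanged, so each
  generator of \<open>Aug m\<close> becomes one of \<open>W.Aug m\<close>.\<close>

lemma E_J:
  assumes "y \<in> Aug m" "valid_slot (Suc N) k" "int m < \<bar>k\<bar>"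
  shows "E k y \<in> W.Aug m"
  using assms(1)
proof (induction rule: Aug.induct)
  case (Aug_Z x)
  then show ?case by (intro W.Aug_Z E_Z)
next
  case (Aug_u x)
  then show ?case using W.Aug_u[of m "E k x"] U_E[of k x] assms(2,3) by (simp only: E_simps Q_E)
next
  case (Aug_t j x)
  then have "T j (E k x) = E k (t j x)" using assms by (intro T_E_gt) auto
  then show ?case using W.Aug_t[of j m "E k x"] Aug_t by (simp only: E_simps Q_E)
qed (auto simp: E_simps intro: W.Aug_diff)

end

section \<open>Removing coefficients by exactness of V\<close>

text \<open>
  The rules for the coefficient of \<open>a\<^sub>i\<close>. Together they imply that the \<open>i\<close>-th coefficient of \<open>x \<delta>\<close>
  depends only on the coefficients \<open>i - 1\<close> and \<open>i\<close> of \<open>x\<close>.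
\<close>

locale hb_coordinate = hb_slots N Q Qi u t Z
  for N :: nat and Q Qi u :: "'g::ab_group_add op" and t :: "nat \<Rightarrow> 'g op" and Z +
  fixes \<zeta> :: "nat \<Rightarrow> 'g op" and \<kappa> :: "'g op"
  assumes \<zeta>_additive: "additive_map (\<zeta> i)" and \<zeta>_Q: "\<zeta> i (Q f) = Q (\<zeta> i f)"
    and \<zeta>_T_lt: "1 \<le> j \<Longrightarrow> j + 1 < i \<Longrightarrow> i \<le> Suc N \<Longrightarrow> \<zeta> i (T j f) = t j (\<zeta> i f)"
    and \<zeta>_T_gt: "1 \<le> i \<Longrightarrow> i < j \<Longrightarrow> j \<le> N \<Longrightarrow> \<zeta> i (T j f) = t (j - 1) (\<zeta> i f)"
    and \<zeta>_T_Suc: "1 \<le> i \<Longrightarrow> i \<le> N \<Longrightarrow> \<zeta> (Suc i) (T i f) = \<kappa> (\<zeta> i f)"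
    and \<zeta>_U: "2 \<le> i \<Longrightarrow> i \<le> Suc N \<Longrightarrow> \<zeta> i (U f) = u (\<zeta> i f)"
    and \<zeta>_Z: "1 \<le> i \<Longrightarrow> i \<le> Suc N \<Longrightarrow> f \<in> ind_Z (Suc N) Z \<Longrightarrow> \<zeta> i f \<in> Z"
    and \<kappa>_cases: "\<kappa> = Q \<or> \<kappa> = id"
begin

lemmas \<zeta>_simps = additive_map_simps[OF \<zeta>_additive] \<zeta>_Q

lemma \<zeta>_Qi: "\<zeta> i (Qi f) = Qi (\<zeta> i f)"
  by (metis Q_Qi Qi_Q \<zeta>_Q)

lemma \<zeta>_J:
  assumes "f \<in> W.Aug m" "1 \<le> m" "m < i" "i \<le> Suc N"
  shows "\<zeta> i f \<in> Aug m"
  using assms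
proof (induction rule: W.Aug.induct)
  case (Aug_Z x)
  then have "\<zeta> i x \<in> Z" by (intro \<zeta>_Z) auto
  then show ?case by (rule Aug.Aug_Z)
next
  case (Aug_u x)
  then show ?case using Aug.Aug_u[of m "\<zeta> i x"] \<zeta>_U[of i x] by (simp add: \<zeta>_simps)
next
  case (Aug_t j x)
  then show ?case using Aug.Aug_t[of j m "\<zeta> i x"] \<zeta>_T_lt[of j i x] by (simp add: \<zeta>_simps)
qed (auto simp: \<zeta>_simps intro: Aug_diff)

text \<open>Generators above \<open>i\<close> act on coefficient \<open>i\<close> with index lowered
  by one, which moves the start of the sum from \<open>Suc i\<close> to \<open>i\<close>.\<close>

lemma \<zeta>_bdry_gt: "1 \<le> i \<Longrightarrow> i + k \<le> Suc N \<Longrightarrow> \<zeta> i (W.bdry k (Suc i) f) = bdry k i (\<zeta> i f)" 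
proof -
  have "1 \<le> i \<Longrightarrow> i < M \<Longrightarrow> M + k \<le> Suc (Suc N) \<Longrightarrow> \<zeta> i (W.bdry k M f) = bdry k (M - 1) (\<zeta> i f)" for M
  proof (induction k arbitrary: M)
    case (Suc k)
    then have IH: "\<zeta> i (W.bdry k (Suc M) f) = bdry k M (\<zeta> i f)" using Suc.IH[of "Suc M"] by simp
    show ?case
    proof (cases "k = 0")
      case True
      then show ?thesis by (simp add: op_simps W.op_simps)
    next
      case False
      then show ?thesis using Suc.prems IH \<zeta>_T_gt[of i M] by (simp add: \<zeta>_simps \<zeta>_Qi)
    qed
  qed (simp add: \<zeta>_simps)
  then show "1 \<le> i \<Longrightarrow> i + k \<le> Suc N \<Longrightarrow> ?thesis" by simp
qed

text \<open>The first \<open>i - M\<close> products avoid T_{i-1} and act on coefficient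
  \<open>i\<close> alone. The others contain T_{i-1}, and what they contribute comes from
  coefficient \<open>i - 1\<close>, hence lies in \<open>K\<close>; if \<open>M + k \<le> i\<close>
  there are no such products.\<close>

lemma \<zeta>_bdry:
  assumes K: "0 \<in> K" "\<And>x y. x \<in> K \<Longrightarrow> y \<in> K \<Longrightarrow> x - y \<in> K" "\<And>x. x \<in> K \<Longrightarrow> Q x \<in> K" "\<And>x. x \<in> K \<Longrightarrow> Qi x \<in> K"
    and "\<And>j x. M \<le> j \<Longrightarrow> j < N \<Longrightarrow> x \<in> K \<Longrightarrow> t j x \<in> K"
    and "1 \<le> M" "M < i" "i \<le> Suc N" "M + k \<le> Suc (Suc N)" "\<zeta> (i - 1) f \<in> K \<or> M + k \<le> i"
  shows "\<zeta> i (W.bdry k M f) - bdry (min k (i - M)) M (\<zeta> i f) \<in> K"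
  using assms(5-)
proof (induction k arbitrary: M)
  case 0
  then show ?case using K by (simp add: \<zeta>_simps)
next
  case (Suc k)
  show ?case
  proof (cases "Suc M = i")
    case True
    have d: "\<zeta> M (W.bdry k (Suc M) f) = bdry k M (\<zeta> M f)"
      using Suc.prems by (intro \<zeta>_bdry_gt) auto
    have "bdry k M (\<zeta> M f) \<in> K"
    proof (cases "k = 0")
      case False
      then have "\<zeta> M f \<in> K" using Suc.prems(6) True by auto
      then show ?thesis using K Suc.prems by (intro bdry_stable[where p = N]) auto
    qed (use K in simp)
    then have "- Qi (\<kappa> (bdry k M (\<zeta> M f))) \<in> K"
      using \<kappa>_cases K(1) K(2)[OF K(1)] K(3,4) by fastforce
    moreover have "min (Suc k) (i - M) = Suc 0" using True by auto
    moreover have "\<zeta> i (T M (W.bdry k (Suc M) f)) = \<kappa> (\<zeta> M (W.bdry k (Suc M) f))"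
      using \<zeta>_T_Suc[of M] Suc.prems True by auto
    ultimately show ?thesis by (simp add: \<zeta>_simps \<zeta>_Qi d op_simps)
  next
    case False
    then have i: "Suc M < i" using Suc.prems by auto
    let ?k = "min k (i - Suc M)"
    have IH: "\<zeta> i (W.bdry k (Suc M) f) - bdry ?k (Suc M) (\<zeta> i f) \<in> K" (is "?d \<in> K")
      using Suc.prems i by (intro Suc.IH) auto
    have m: "min (Suc k) (i - M) = Suc ?k" using i by auto
    have "\<zeta> i (W.bdry (Suc k) M f) = \<zeta> i f - Qi (t M (\<zeta> i (W.bdry k (Suc M) f)))"
      using Suc.prems i \<zeta>_T_lt[of M i] by (simp add: \<zeta>_simps \<zeta>_Qi)
    then have "\<zeta> i (W.bdry (Suc k) M f) - bdry (min (Suc k) (i - M)) M (\<zeta> i f) = 0 - Qi (t M ?d)"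
      unfolding m by (simp add: op_simps)
    moreover have "0 - Qi (t M ?d) \<in> K"
      using IH i Suc.prems by (intro K(2)[OF K(1)] K(4) Suc.prems(1)) auto
    ultimately show ?thesis by simp
  qed
qed

text \<open>The coefficient of a cycle is, modulo \<open>Aug\<close>, a cycle in V for a truncated
  sum, and exactness of V supplies \<open>y\<close>. At \<open>i = Suc m\<close> the sum in the
  conclusion has the single term 1, so nothing is to be shown; for \<open>i > m + k\<close> the sum
  does not reach T_{i-1}. Only between these two does coefficient \<open>i - 1\<close> have to be
  removed beforehand.\<close>

lemma \<zeta>_step:
  assumes "exact" "1 \<le> m" "m + k \<le> Suc N" "m < i" "i \<le> Suc N" "W.bdry k (Suc m) f \<in> W.Aug (Suc m)"
    and "\<zeta> (i - 1) f \<in> Aug m \<or> i = Suc m \<or> m + k < i"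
  shows "\<exists>y. \<zeta> i f - bdry (min (Suc k) (i - m)) m y \<in> Aug m"
proof (cases "i = Suc m")
  case True
  then have "min (Suc k) (i - m) = Suc 0" by simp
  then show ?thesis by (auto intro!: exI[of _ "\<zeta> i f"] simp: Aug_zero op_simps)
next
  case False
  then have i: "Suc m < i" using assms by simp
  let ?k = "min k (i - Suc m)"
  have "\<zeta> i (W.bdry k (Suc m) f) - bdry ?k (Suc m) (\<zeta> i f) \<in> Aug m"
    using assms i by (intro \<zeta>_bdry) (auto intro: Aug_zero Aug_diff Aug_Q Aug_Qi Aug_stable)
  then have "\<zeta> i (W.bdry k (Suc m) f) - bdry ?k (Suc m) (\<zeta> i f) \<in> Aug (Suc m)"
    by (rule Aug_mono) simp
  moreover have "\<zeta> i (W.bdry k (Suc m) f) \<in> Aug (Suc m)"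
    using assms i by (intro \<zeta>_J) auto
  ultimately have "bdry ?k (Suc m) (\<zeta> i f) \<in> Aug (Suc m)"
    using Aug_diff by (metis (no_types, lifting) diff_diff_eq2 add_diff_cancel_left')
  moreover have "m + ?k \<le> N" using assms i by auto
  ultimately obtain y where "\<zeta> i f - bdry (Suc ?k) m y \<in> Aug m"
    using assms(1,2) unfolding exact_def by blast
  moreover have "Suc ?k = min (Suc k) (i - m)" using i by auto
  ultimately show ?thesis by auto
qed

text \<open>A correction concentrated in coefficient \<open>i\<close> changes the boundary only in
  the coefficients \<open>i\<close> and \<open>i + 1\<close>, so working upwards never undoes
  earlier removals. Leaving out \<open>e = m + k\<close> does not break the chain, since the step at
  \<open>m + k + 1\<close> does not look at its predecessor. \<open>S\<close> restricts the
  corrections, so that coefficients of another family removed before can be protected.\<close>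

lemma \<zeta>_reduce:
  assumes ex: "exact" and m: "1 \<le> m" "m + k \<le> Suc N" and f: "W.bdry k (Suc m) f \<in> W.Aug (Suc m)"
    and sect: "\<And>i y. 1 \<le> i \<Longrightarrow> i \<le> Suc N \<Longrightarrow> \<exists>g\<in>S. \<zeta> i g = y \<and> (\<forall>l. 1 \<le> l \<longrightarrow> l \<le> Suc N \<longrightarrow> l \<noteq> i \<longrightarrow> \<zeta> l g = 0)"
    and S: "0 \<in> S" "\<And>g h. g \<in> S \<Longrightarrow> h \<in> S \<Longrightarrow> g + h \<in> S"
    and e: "e = 0 \<or> e = m + k"
    and i: "i \<le> Suc N"
  shows "\<exists>g\<in>S. \<forall>l. m < l \<longrightarrow> l \<le> i \<longrightarrow> l \<noteq> e \<longrightarrow> \<zeta> l (f - W.bdry (Suc k) m g) \<in> Aug m"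
  using i
proof (induction i)
  case 0
  then show ?case using S by auto
next
  case (Suc i)
  then obtain g where g: "g \<in> S" "\<And>l. m < l \<Longrightarrow> l \<le> i \<Longrightarrow> l \<noteq> e \<Longrightarrow> \<zeta> l (f - W.bdry (Suc k) m g) \<in> Aug m"
    by auto
  show ?case
  proof (cases "m < Suc i \<and> Suc i \<noteq> e")
    case False
    then show ?thesis using g by (metis le_SucE le_antisym not_less_eq not_less_eq_eq)
  next
    case True
    let ?f = "f - W.bdry (Suc k) m g"
    have "W.bdry k (Suc m) (W.bdry (Suc k) m g) \<in> W.Aug (Suc m)"
      using W.bdry_bdry[of m k g] m W.Aug_t[of m "Suc m"] by auto
    then have "W.bdry k (Suc m) ?f \<in> W.Aug (Suc m)"
      unfolding W.bdry_simps using f by (rule W.Aug_diff[rotated])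
    moreover have "\<zeta> (Suc i - 1) ?f \<in> Aug m \<or> Suc i = Suc m \<or> m + k < Suc i"
    proof (cases "i = m \<or> i = e")
      case False
      then have "\<zeta> i ?f \<in> Aug m" using g(2)[of i] True by auto
      then show ?thesis by simp
    qed (use True e in auto)
    ultimately obtain y where y: "\<zeta> (Suc i) ?f - bdry (min (Suc k) (Suc i - m)) m y \<in> Aug m"
      using \<zeta>_step[of m k "Suc i" ?f] ex m Suc.prems True by blast
    obtain h where h: "h \<in> S" "\<zeta> (Suc i) h = y" "\<And>l. 1 \<le> l \<Longrightarrow> l \<le> Suc N \<Longrightarrow> l \<noteq> Suc i \<Longrightarrow> \<zeta> l h = 0"
      using sect[of "Suc i" y] Suc.prems by auto
    have d: "\<zeta> l (W.bdry (Suc k) m h) = bdry (min (Suc k) (l - m)) m (\<zeta> l h)" if "m < l" "l \<le> Suc i" for l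
    proof -
      \<comment> \<open>With the zero subgroup as \<open>K\<close> the congruence becomes an
        equality: up to \<open>l = Suc i\<close> the coefficient of \<open>h\<close> preceding
        \<open>l\<close> is zero.\<close>
      have "\<zeta> l (W.bdry (Suc k) m h) - bdry (min (Suc k) (l - m)) m (\<zeta> l h) \<in> {0}"
        using that m Suc.prems h(3)[of "l - 1"] by (intro \<zeta>_bdry) (auto simp: op_simps)
      then show ?thesis by simp
    qed
    have "\<zeta> l (f - W.bdry (Suc k) m (g + h)) \<in> Aug m" if l: "m < l" "l \<le> Suc i" "l \<noteq> e" for l
    proof -
      have "\<zeta> l (f - W.bdry (Suc k) m (g + h)) = \<zeta> l ?f - \<zeta> l (W.bdry (Suc k) m h)"
        by (simp only: W.bdry_simps \<zeta>_simps diff_diff_add)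
      then show ?thesis using y g(2)[of l] h(2) h(3)[of l] d[of l] l Suc.prems
        by (cases "l = Suc i") (auto simp: bdry_simps)
    qed
    then show ?thesis using S(2)[OF g(1) h(1)] by blast
  qed
qed

end

section \<open>Adapted combinations of the b-coefficients\<close>

context hb_module
begin

primrec tprod :: "nat \<Rightarrow> nat \<Rightarrow> 'v \<Rightarrow> 'v" where
  "tprod 0 i x = x"
| "tprod (Suc k) i x = tprod k (Suc i) (t i x)"

lemma tprod_additive: "additive_map (tprod k i)"
proof -
  have "tprod k i (x + y) = tprod k i x + tprod k i y" for x y
    by (induction k arbitrary: i x y) (simp_all add: op_simps)
  then show ?thesis by (simp add: additive_map_def)
qed

lemmas tprod_simps = additive_map_simps[OF tprod_additive]

lemma tprod_Q: "tprod k i (Q x) = Q (tprod k i x)"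
  by (induction k arbitrary: i x) (simp_all add: op_simps)

lemma tprod_u: "1 < i \<Longrightarrow> i + k \<le> n \<Longrightarrow> tprod k i (u x) = u (tprod k i x)"
  by (induction k arbitrary: i x) (simp_all add: u_t_comm)

lemma tprod_Z: "1 \<le> i \<Longrightarrow> i + k \<le> n \<Longrightarrow> x \<in> Z \<Longrightarrow> tprod k i x \<in> Z"
  by (induction k arbitrary: i x) (simp_all add: t_Z)

lemma tprod_t_less: "1 \<le> j \<Longrightarrow> j + 1 < i \<Longrightarrow> i + k \<le> n \<Longrightarrow> tprod k i (t j x) = t j (tprod k i x)"
proof (induction k arbitrary: i x)
  case (Suc k)
  then have "t i (t j x) = t j (t i x)" by (intro t_comm) auto
  then show ?case using Suc by simp
qed simp

text \<open>The braid relation is used once, where T_j meets T_{j-1} T_j; it leaves T_{j-1}, which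
  commutes with the remaining factors, just as T_j commutes with the preceding ones.\<close>

lemma tprod_t: "1 \<le> i \<Longrightarrow> i < j \<Longrightarrow> j < i + k \<Longrightarrow> i + k \<le> n \<Longrightarrow> tprod k i (t j x) = t (j - 1) (tprod k i x)"
proof (induction k arbitrary: i x)
  case (Suc k)
  show ?case
  proof (cases "j = Suc i")
    case False
    then have "t i (t j x) = t j (t i x)" using Suc.prems t_comm[of i j] by simp
    then show ?thesis using Suc.IH[of "Suc i" "t i x"] Suc.prems False by simp
  next
    case True
    then obtain k' where k: "k = Suc k'" using Suc.prems by (cases k) auto
    have "t (Suc i) (t i (t (Suc i) x)) = t i (t (Suc i) (t i x))"
      using t_braid[of i x] Suc.prems True by simp
    moreover have "tprod k' (Suc (Suc i)) (t i y) = t i (tprod k' (Suc (Suc i)) y)" for y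
      using Suc.prems k by (intro tprod_t_less) auto
    ultimately show ?thesis using True k by simp
  qed
qed simp

end

context hb_slots
begin

sublocale pos: hb_coordinate N Q Qi u t Z "\<lambda>i. slot (int i)" Q
  by unfold_locales (auto simp: additive_map_def slot_Q slot_T_diag slot_U_diag slot_T valid_slot_def ind_Z_def)

text \<open>
  The coefficients of the \<open>b\<^sub>i\<close> violate the rules of \<^locale>\<open>hb_coordinate\<close>. The following combinations of
  them, which differ from them by a triangular substitution, satisfy these rules by the braid
  relations.
\<close>

definition eta :: "nat \<Rightarrow> 'g op" where
  "eta i f = slot (- int (Suc N)) (W.tprod (Suc N - i) i f)"

text \<open>T_i is the first factor of the product defining \<open>eta i\<close>. No power of q
  arises, so \<kappa> is the identity here, whereas the coefficient of a_{i+1} in x T_i is q times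
  that of a_i in x.\<close>

lemma eta_T_Suc: "1 \<le> i \<Longrightarrow> i \<le> N \<Longrightarrow> eta (Suc i) (T i f) = eta i f"
  by (simp add: eta_def Suc_diff_le)

sublocale neg: hb_coordinate N Q Qi u t Z eta id
proof
  show "additive_map (eta i)" for i
    by (simp add: additive_map_def eta_def W.tprod_simps)
  show "eta i (Q f) = Q (eta i f)" for i f
    by (simp add: eta_def W.tprod_Q slot_Q)
  show "eta i (T j f) = t j (eta i f)" if "1 \<le> j" "j + 1 < i" "i \<le> Suc N" for i j f
    using that by (simp add: eta_def W.tprod_t_less slot_T_diag valid_slot_def)
  show "eta i (T j f) = t (j - 1) (eta i f)" if "1 \<le> i" "i < j" "j \<le> N" for i j f
  proof -
    have "0 < j" using that by simp
    then obtain j' where "j = Suc j'" using gr0_conv_Suc by blast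
    then show ?thesis using that by (simp add: eta_def W.tprod_t slot_T_diag valid_slot_def)
  qed
  show "eta (Suc i) (T i f) = id (eta i f)" if "1 \<le> i" "i \<le> N" for i f
    using eta_T_Suc that by simp
  show "eta i (U f) = u (eta i f)" if "2 \<le> i" "i \<le> Suc N" for i f
    using that by (simp add: eta_def W.tprod_u slot_U_diag valid_slot_def)
  show "eta i f \<in> Z" if "1 \<le> i" "i \<le> Suc N" "f \<in> ind_Z (Suc N) Z" for i f
    using W.tprod_Z[of i "Suc N - i" f] that by (auto simp: eta_def ind_Z_def valid_slot_def)
qed simp

text \<open>Since b_i T_i ... T_N = b_{N+1}, the coefficient of b_i enters \<open>eta i\<close>
  unchanged. Besides it only coefficients of b_l with l > i enter, through operators that preserve
  \<open>K\<close>. This is the triangularity of the substitution.\<close>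

lemma eta_slot:
  assumes K: "0 \<in> K" "\<And>x y. x \<in> K \<Longrightarrow> y \<in> K \<Longrightarrow> x - y \<in> K" "\<And>x. x \<in> K \<Longrightarrow> Q x \<in> K"
    and "\<And>j x. i \<le> j \<Longrightarrow> j < N \<Longrightarrow> x \<in> K \<Longrightarrow> t j x \<in> K"
    and "1 \<le> i" "i \<le> Suc N" "\<And>l. i < l \<Longrightarrow> l \<le> Suc N \<Longrightarrow> slot (- int l) f \<in> K"
  shows "eta i f - slot (- int i) f \<in> K"
  using assms(4-)
proof (induction "Suc N - i" arbitrary: i f)
  case 0
  then have i: "i = Suc N" by simp
  show ?case unfolding i by (simp add: eta_def K)
next
  case (Suc d)
  then have i: "i \<le> N" by simp
  let ?s = "slot (- int (Suc i)) f"
  have s: "?s \<in> K" using Suc.prems(4)[of "Suc i"] i by simp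
  have 1: "slot (- int (Suc i)) (T i f) = Q ?s - ?s + slot (- int i) f"
    using Suc.prems i by (simp add: slot_T valid_slot_def)
  have 2: "slot (- int l) (T i f) \<in> K" if "Suc i < l" "l \<le> Suc N" for l
    using that Suc.prems by (auto simp: slot_T_diag valid_slot_def)
  have "eta (Suc i) (T i f) - slot (- int (Suc i)) (T i f) \<in> K"
    using Suc.hyps(2) Suc.prems(1) i 2 by (intro Suc.hyps(1)) auto
  then have "eta i f - (Q ?s - ?s + slot (- int i) f) \<in> K"
    using eta_T_Suc[of i f] Suc.prems(2) i 1 by simp
  moreover have "(s - (Q ?s - ?s + r)) - ((?s - Q ?s) - 0) = s - r" for s r :: "(nat \<Rightarrow> int) \<Rightarrow> 'g"
    by simp
  moreover have "?s - Q ?s - 0 \<in> K" using s K by auto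
  ultimately show ?case using K(2) by metis
qed

text \<open>The unitriangular system is solved from l = N + 1 downwards; changing the coefficient of
  b_i affects no \<open>eta l\<close> with l > i.\<close>

lemma eta_section: "\<exists>g. \<forall>l. 1 \<le> l \<longrightarrow> l \<le> Suc N \<longrightarrow> eta l g = v l"
proof -
  have "\<exists>g. \<forall>l. 1 \<le> l \<longrightarrow> Suc N - d < l \<longrightarrow> l \<le> Suc N \<longrightarrow> eta l g = v l" for d
  proof (induction d)
    case (Suc d)
    then obtain g where g: "\<And>l. 1 \<le> l \<Longrightarrow> Suc N - d < l \<Longrightarrow> l \<le> Suc N \<Longrightarrow> eta l g = v l" by blast
    let ?i = "Suc N - d"
    show ?case
    proof (cases "d < Suc N")
      case True
      let ?h = "g + E (- int ?i) (v ?i - eta ?i g)"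
      have "eta l (E (- int ?i) y) - slot (- int l) (E (- int ?i) y) \<in> {0}" if "?i \<le> l" "l \<le> Suc N" for l y
        using that True by (intro eta_slot) (auto simp: slot_E op_simps)
      then have e: "eta l (E (- int ?i) y) = (if l = ?i then y else 0)" if "?i \<le> l" "l \<le> Suc N" for l y
        using that by (auto simp: slot_E)
      have "eta l ?h = v l" if "1 \<le> l" "Suc N - Suc d < l" "l \<le> Suc N" for l
        using that g[of l] e[of l] True by (cases "l = ?i") (auto simp: neg.\<zeta>_simps)
      then show ?thesis by blast
    next
      case False
      then have "\<forall>l. 1 \<le> l \<longrightarrow> Suc N - Suc d < l \<longrightarrow> l \<le> Suc N \<longrightarrow> eta l g = v l" using g by auto
      then show ?thesis by blast
    qed
  qed auto
  from this[of "Suc N"] show ?thesis by auto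
qed


lemma eta_neg_zero:
  assumes "\<And>l. slot (- int l) f = 0" "1 \<le> i" "i \<le> Suc N"
  shows "eta i f = 0"
proof -
  have "eta i f - slot (- int i) f \<in> {0}"
    using assms by (intro eta_slot) (auto simp: op_simps)
  then show ?thesis using assms by simp
qed

text \<open>Inverts the triangular substitution modulo \<open>Aug m\<close>, again from the highest
  index downwards.\<close>

lemma slot_neg_J:
  assumes "\<And>l. m < l \<Longrightarrow> l \<le> Suc N \<Longrightarrow> eta l f \<in> Aug m" "m < i" "i \<le> Suc N"
  shows "slot (- int i) f \<in> Aug m"
  using assms(2,3)
proof (induction "Suc N - i" arbitrary: i rule: less_induct)
  case less
  have "eta i f - slot (- int i) f \<in> Aug m"
    using less.prems less.hyps by (intro eta_slot) (auto intro: Aug_zero Aug_diff Aug_Q Aug_stable)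
  then show ?case using Aug_diff[OF assms(1)[of i]] less.prems by fastforce
qed

section \<open>Collapsing the lower slots to a single coefficient\<close>

text \<open>The exponent counts the generators needed to reach the basis element from a_M: M - k for
  a_k = a_M T_{M-1} ... T_k, and M + k - 1 for b_k, whose word runs down to T_1, through U, and up
  to T_{k-1}. Each of them acts as q modulo \<open>W.Aug M\<close>.\<close>

definition weight :: "nat \<Rightarrow> int \<Rightarrow> 'g op" where
  "weight M k = Q ^^ (if 0 < k then M - nat k else M + nat (- k) - 1)"

lemma weight_additive: "additive_map (weight M k)"
proof -
  have "additive_map (Q ^^ d)" for d
    by (induction d) (auto simp: additive_map_def op_simps)
  then show ?thesis by (simp add: weight_def)
qed

lemmas weight_simps = additive_map_simps[OF weight_additive]

lemma weight_J: "x \<in> Aug m \<Longrightarrow> weight M k x \<in> Aug m"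
proof -
  have "x \<in> Aug m \<Longrightarrow> (Q ^^ d) x \<in> Aug m" for d
    by (induction d) (auto intro: Aug_Q)
  then show "x \<in> Aug m \<Longrightarrow> weight M k x \<in> Aug m" by (simp add: weight_def)
qed

lemma weight_Q: "weight M k (Q x) = Q (weight M k x)"
  by (simp add: weight_def flip: funpow_swap1)

lemma weight_pos: "1 \<le> j \<Longrightarrow> j < M \<Longrightarrow> weight M (int j) x = Q (weight M (int j + 1) x)"
proof -
  assume "1 \<le> j" "j < M"
  then have "M - j = Suc (M - Suc j)" "nat (int j + 1) = Suc j" by auto
  then show ?thesis using \<open>1 \<le> j\<close> by (simp add: weight_def)
qed

lemma weight_neg: "1 \<le> j \<Longrightarrow> weight M (- int j - 1) x = Q (weight M (- int j) x)"
proof -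
  assume "1 \<le> j"
  then have "M + nat (- (- int j - 1)) - 1 = Suc (M + nat (- (- int j)) - 1)"
    "\<not> 0 < - int j - 1" "\<not> 0 < - int j" by auto
  then show ?thesis by (simp only: weight_def if_False funpow.simps comp_apply)
qed

lemma weight_one: "1 \<le> M \<Longrightarrow> weight M (-1) x = Q (weight M 1 x)"
proof -
  assume "1 \<le> M"
  then have "M = Suc (M - 1)" by auto
  then show ?thesis by (simp add: weight_def) (metis comp_apply funpow.simps(2))
qed

text \<open>Reads off the coefficient of the coset representative \<open>a\<^bsub>M\<^esub>\<close> modulo \<open>W.Aug M\<close>, in which
  \<open>a\<^sub>i\<close> and \<open>b\<^sub>i\<close> with \<open>i \<le> M\<close> become multiples of \<open>a\<^bsub>M\<^esub>\<close>.\<close>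

definition theta :: "nat \<Rightarrow> 'g op" where
  "theta M f = (\<Sum>k | valid_slot M k. weight M k (slot k f))"

lemma finite_valid_slot: "finite {k. valid_slot M k}"
  by (rule finite_subset[of _ "{- int M..int M}"]) (auto simp: valid_slot_def)

lemma theta_additive: "additive_map (theta M)"
  by (simp add: additive_map_def theta_def weight_simps sum.distrib)

lemmas theta_simps = additive_map_simps[OF theta_additive]

lemma theta_split:
  assumes "A \<subseteq> {k. valid_slot M k}"
    and "(\<Sum>k\<in>A. weight M k (slot k f)) = 0"
    and "\<And>k. valid_slot M k \<Longrightarrow> k \<notin> A \<Longrightarrow> slot k f \<in> Aug m"
  shows "theta M f \<in> Aug m"
proof -
  have "theta M f = (\<Sum>k\<in>{k. valid_slot M k} - A. weight M k (slot k f)) + (\<Sum>k\<in>A. weight M k (slot k f))"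
    unfolding theta_def using assms(1) finite_valid_slot by (rule sum.subset_diff)
  then show ?thesis using assms(2,3) by (auto intro!: Aug_sum weight_J)
qed

text \<open>In the slots that a generator exchanges the contributions cancel, because neighbouring
  weights differ by the factor q. On the other slots up to m + 1 it acts on the coefficient as U or
  as some T_i with i < m, which explains why the value lies in \<open>Aug m\<close> and not merely
  in \<open>Aug (Suc m)\<close>.\<close>

lemma theta_J:
  assumes "f \<in> W.Aug (Suc m)" "1 \<le> m" "m \<le> N"
  shows "theta (Suc m) f \<in> Aug m"
  using assms(1)
proof (induction rule: W.Aug.induct)
  case (Aug_Z f)
  have "valid_slot (Suc N) k" if "valid_slot (Suc m) k" for k
    using that assms by (auto simp: valid_slot_def)
  then show ?case using Aug_Z by (intro theta_split[of "{}"]) (auto simp: ind_Z_def intro: Aug.Aug_Z)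
next
  case (Aug_u f)
  show ?case
  proof (rule theta_split[of "{1, -1}"])
    show "{1, -1} \<subseteq> {k. valid_slot (Suc m) k}" by (auto simp: valid_slot_def)
    show "(\<Sum>k\<in>{1, -1}. weight (Suc m) k (slot k (U f - Q f))) = 0"
      by (simp add: slot_U slot_Q valid_slot_def weight_simps weight_one weight_Q op_simps)
    show "slot k (U f - Q f) \<in> Aug m" if "valid_slot (Suc m) k" "k \<notin> {1, -1}" for k
      using that assms Aug.Aug_u[of m "slot k f"] by (auto simp: slot_U slot_Q valid_slot_def)
  qed
next
  case (Aug_t j f)
  let ?A = "{int j, int j + 1, - int j, - int j - 1}"
  show ?case
  proof (rule theta_split[of ?A])
    show "?A \<subseteq> {k. valid_slot (Suc m) k}" using Aug_t by (auto simp: valid_slot_def)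
    have "slot (int j) (T j f - Q f) = slot (int j + 1) f - slot (int j) f"
      "slot (int j + 1) (T j f - Q f) = Q (slot (int j) f) - Q (slot (int j + 1) f)"
      "slot (- int j) (T j f - Q f) = Q (slot (- int j - 1) f) - Q (slot (- int j) f)"
      "slot (- int j - 1) (T j f - Q f) = slot (- int j) f - slot (- int j - 1) f"
      using Aug_t assms by (simp_all add: slot_T slot_Q valid_slot_def)
    then show "(\<Sum>k\<in>?A. weight (Suc m) k (slot k (T j f - Q f))) = 0"
      using Aug_t by (simp add: weight_pos weight_neg weight_simps weight_Q op_simps del: slot_simps)
    show "slot k (T j f - Q f) \<in> Aug m" if k: "valid_slot (Suc m) k" "k \<notin> ?A" for k
    proof -
      have v: "valid_slot (Suc N) k" using k assms by (auto simp: valid_slot_def)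
      consider "\<bar>k\<bar> < int j" "1 \<le> \<bar>k\<bar>" | "int j + 1 < \<bar>k\<bar>" "\<bar>k\<bar> \<le> int m + 1"
        using k unfolding valid_slot_def by force
      then show ?thesis
      proof cases
        case 1
        then show ?thesis using v Aug_t Aug.Aug_t[of "j - 1" m "slot k f"] by (simp add: slot_T_diag slot_Q)
      next
        case 2
        then show ?thesis using v Aug_t Aug.Aug_t[of j m "slot k f"] by (simp add: slot_T_diag slot_Q)
      qed
    qed
  qed
qed (auto simp: theta_simps intro: Aug_diff)


text \<open>The chain a_m, a_{m-1}, ..., a_1, b_1, ..., b_m is run through by multiplying with
  T_{m-1}, ..., T_1, U, T_1, ..., T_{m-1}, all of which act as q modulo
  \<open>W.Aug m\<close>.\<close>

lemma E_span:
  assumes "1 \<le> m" "m \<le> Suc N" "valid_slot m k"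
  shows "\<exists>c. E k y - E (int m) c \<in> W.Aug m"
proof -
  define S where "S = {k. \<forall>y. \<exists>c. E k y - E (int m) c \<in> W.Aug m}"
  have S_step: "k' \<in> S" if "k \<in> S" "\<And>y. E k' y - Q (E k y) \<in> W.Aug m" for k k'
  proof -
    have "\<exists>c. E k' y - E (int m) c \<in> W.Aug m" for y
    proof -
      obtain c where c: "E k (Q y) - E (int m) c \<in> W.Aug m" using \<open>k \<in> S\<close> by (auto simp: S_def)
      have "E k' y - E (int m) c \<in> W.Aug m"
        using W.Aug_add[OF that(2)[of y] c] by (simp add: Q_E)
      then show ?thesis by blast
    qed
    then show ?thesis by (simp add: S_def)
  qed
  have pos: "int i \<in> S" if "1 \<le> i" "i \<le> m" for i
    using that(2,1)
  proof (induction rule: inc_induct)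
    case base
    have "\<exists>c. E (int m) y - E (int m) c \<in> W.Aug m" for y
      by (rule exI[of _ y]) (simp add: W.Aug_zero)
    then show ?case by (simp add: S_def)
  next
    case (step i)
    have i1: "int (Suc i) = int i + 1" by linarith
    have i2: "1 \<le> i" using step by blast
    have i3: "i < m" using step by blast
    have i4: "i \<le> N" using i3 assms(2) by linarith
    note i = i1 i2 i3 i4
    have "E (int i) y - Q (E (int (Suc i)) y) \<in> W.Aug m" for y
      using W.Aug_t[OF i(2,3), of "E (int (Suc i)) y"] unfolding i(1) T_E_pos[OF i(2,4)] .
    moreover have "int (Suc i) \<in> S" by (rule step.IH) (rule le_SucI[OF i2])
    ultimately show ?case by (rule S_step[rotated])
  qed
  have neg: "- int (Suc i) \<in> S" if "Suc i \<le> m" for i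
    using that
  proof (induction i)
    case 0
    have "E (-1) y - Q (E 1 y) \<in> W.Aug m" for y
      using W.Aug_u[of m "E 1 y"] U_E_one assms by simp
    moreover have "1 \<in> S" using pos[of 1] assms(1) by (metis of_nat_1 order_refl)
    ultimately have "-1 \<in> S" by (rule S_step[rotated])
    then show ?case by (metis One_nat_def of_nat_1)
  next
    case (Suc i)
    have "E (- int (Suc (Suc i))) y - Q (E (- int (Suc i)) y) \<in> W.Aug m" for y
      using W.Aug_t[of "Suc i" m "E (- int (Suc i)) y"] T_E_neg[of "Suc i" y] Suc.prems assms by (simp add: add.commute)
    moreover have "- int (Suc i) \<in> S" by (rule Suc.IH) (rule Suc_leD[OF Suc.prems])
    ultimately show ?case by (rule S_step[rotated])
  qed
  have "k \<in> S"
  proof (cases "0 < k")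
    case True
    then show ?thesis using pos[of "nat k"] assms by (simp add: valid_slot_def)
  next
    case False
    then have "k = - int (Suc (nat (- k) - 1))" "Suc (nat (- k) - 1) \<le> m"
      using assms(3) unfolding valid_slot_def by linarith+
    then show ?thesis using neg by metis
  qed
  then show ?thesis by (auto simp: S_def)
qed

text \<open>Slots beyond \<open>m\<close> other than \<open>s\<close> contribute nothing by
  \<open>E_J\<close>, and slots up to \<open>m\<close> collapse into slot \<open>m\<close> by
  \<open>E_span\<close>. What differs from the sum of the valid slots is junk in
  \<open>ind_Z\<close>.\<close>

lemma decompose:
  assumes m: "1 \<le> m" "m < s" "s \<le> Suc N"
    and f: "\<And>k. valid_slot (Suc N) k \<Longrightarrow> int m < \<bar>k\<bar> \<Longrightarrow> k \<noteq> int s \<Longrightarrow> slot k f \<in> Aug m"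
  shows "\<exists>c. f - (E (int s) (slot (int s) f) + E (int m) c) \<in> W.Aug m"
proof -
  let ?V = "{k. valid_slot (Suc N) k}"
  define S where "S = {f. \<exists>c. f - E (int m) c \<in> W.Aug m}"
  have S_add: "f + g \<in> S" if fg: "f \<in> S" "g \<in> S" for f g
  proof -
    obtain c d where "f - E (int m) c \<in> W.Aug m" "g - E (int m) d \<in> W.Aug m"
      using fg by (auto simp: S_def)
    then have "(f - E (int m) c) + (g - E (int m) d) \<in> W.Aug m" by (rule W.Aug_add)
    then have "f + g - E (int m) (c + d) \<in> W.Aug m" by (simp add: E_simps algebra_simps)
    then show ?thesis by (auto simp: S_def)
  qed
  have S_J: "g \<in> S" if "g \<in> W.Aug m" for g
    using that by (auto simp: S_def E_simps intro!: exI[of _ 0])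
  have S_sum: "(\<And>i. i \<in> I \<Longrightarrow> g i \<in> S) \<Longrightarrow> sum g I \<in> S" for g and I :: "int set"
    by (induction I rule: infinite_finite_induct) (auto intro: S_add S_J W.Aug_zero)
  let ?r = "f - (\<Sum>k\<in>?V. E k (slot k f))"
  have "slot l ?r = 0" if "valid_slot (Suc N) l" for l
    using that finite_valid_slot by (simp add: slot_sum slot_E sum.delta)
  then have "?r \<in> ind_Z (Suc N) Z" by (simp add: ind_Z_def zero_Z)
  then have r: "?r \<in> S" by (intro S_J W.Aug_Z)
  have "(\<Sum>k\<in>?V - {int s}. E k (slot k f)) \<in> S"
  proof (rule S_sum)
    fix k assume k: "k \<in> ?V - {int s}"
    show "E k (slot k f) \<in> S"
    proof (cases "int m < \<bar>k\<bar>")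
      case True
      then show ?thesis using k f by (intro S_J E_J) auto
    next
      case False
      then show ?thesis using k m E_span[of m k] by (auto simp: S_def valid_slot_def)
    qed
  qed
  moreover have "(\<Sum>k\<in>?V. E k (slot k f)) = E (int s) (slot (int s) f) + (\<Sum>k\<in>?V - {int s}. E k (slot k f))"
    using m by (intro sum.remove finite_valid_slot) (auto simp: valid_slot_def)
  ultimately have "f - E (int s) (slot (int s) f) \<in> S"
    using S_add[OF r] by fastforce
  then show ?thesis by (auto simp: S_def diff_diff_eq)
qed

section \<open>The cone and the induction step\<close>

text \<open>Multiplication by (-1/q)^k, the coefficient of the last term of
  \<open>bdry (Suc k)\<close>. Its invertibility makes the cone contractible.\<close>

primrec signed_pow :: "nat \<Rightarrow> 'g op" where
  "signed_pow 0 x = x"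
| "signed_pow (Suc k) x = - Qi (signed_pow k x)"

lemma signed_pow_surj: "\<exists>y. signed_pow k y = c"
proof (induction k arbitrary: c)
  case (Suc k)
  from Suc[of "- Q c"] obtain y where "signed_pow k y = - Q c" by blast
  then show ?case by (auto intro!: exI[of _ y] simp: op_simps)
qed simp

lemma signed_pow_additive: "additive_map (signed_pow k)"
proof -
  have "signed_pow k (x + y) = signed_pow k x + signed_pow k y" for x y by (induction k) (simp_all add: op_simps)
  then show ?thesis by (simp add: additive_map_def)
qed

lemmas signed_pow_simps = additive_map_simps[OF signed_pow_additive]

lemma signed_pow_bdry: "signed_pow k (bdry l m x) = bdry l m (signed_pow k x)"
proof (induction k)
  case (Suc k)
  have "bdry l m (Qi y) = Qi (bdry l m y)" for y by (metis Q_Qi Qi_Q bdry_Q)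
  then show ?case using Suc by (simp add: bdry_simps)
qed simp

lemma signed_pow_J_iff: "signed_pow k x \<in> Aug m \<longleftrightarrow> x \<in> Aug m"
proof (induction k)
  case (Suc k)
  have "- Qi y \<in> Aug m \<longleftrightarrow> y \<in> Aug m" for y
    by (metis Aug_minus Aug_Qi Aug_Q Q_Qi minus_minus)
  then show ?case using Suc by simp
qed simp

lemma bdry_E_low: "1 \<le> m \<Longrightarrow> m + k \<le> Suc N \<Longrightarrow> W.bdry k (Suc m) (E (int m) c) = E (int m) (bdry k m c)"
proof -
  have "1 \<le> m \<Longrightarrow> m < M \<Longrightarrow> M + k \<le> Suc (Suc N) \<Longrightarrow> W.bdry k M (E (int m) c) = E (int m) (bdry k (M - 1) c)" for M
  proof (induction k arbitrary: M)
    case (Suc k)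
    then have "W.bdry k (Suc M) (E (int m) c) = E (int m) (bdry k M c)" using Suc.IH[of "Suc M"] by simp
    then show ?case using Suc.prems T_E_lt[of "int m" M] by (simp add: E_simps Qi_E valid_slot_def)
  qed (simp add: E_simps)
  then show "1 \<le> m \<Longrightarrow> m + k \<le> Suc N \<Longrightarrow> ?thesis" by simp
qed

text \<open>a_{M+k} commutes with T_M, ..., T_{M+k-2}, so all terms but the last stay in its slot.
  The last product T_{M+k-1} ... T_M carries a_{M+k} to a_M.\<close>

lemma bdry_E_top:
  "1 \<le> M \<Longrightarrow> M + k \<le> Suc N \<Longrightarrow>
    W.bdry (Suc k) M (E (int (M + k)) c) = E (int (M + k)) (bdry k M c) + E (int M) (signed_pow k c)"
proof (induction k arbitrary: M)
  case 0
  then show ?case by (simp add: E_simps W.op_simps)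
next
  case (Suc k)
  have IH: "W.bdry (Suc k) (Suc M) (E (int (M + Suc k)) c) = E (int (M + Suc k)) (bdry k (Suc M) c) + E (int (Suc M)) (signed_pow k c)"
    using Suc.IH[of "Suc M"] Suc.prems by (simp del: bdry.simps W.bdry.simps)
  have 1: "T M (E (int (M + Suc k)) (bdry k (Suc M) c)) = E (int (M + Suc k)) (t M (bdry k (Suc M) c))"
  proof (cases k)
    case 0
    then show ?thesis by (simp add: E_simps op_simps W.op_simps)
  next
    case (Suc k')
    then show ?thesis using Suc.prems by (intro T_E_gt) (auto simp: valid_slot_def)
  qed
  have 2: "T M (E (int (Suc M)) (signed_pow k c)) = E (int M) (signed_pow k c)"
    using T_E_pos[of M] Suc.prems by (simp add: add.commute)
  have "W.bdry (Suc (Suc k)) M (E (int (M + Suc k)) c)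
    = E (int (M + Suc k)) c - Qi (T M (W.bdry (Suc k) (Suc M) (E (int (M + Suc k)) c)))"
    by (rule W.bdry.simps(2))
  also have "\<dots> = E (int (M + Suc k)) (bdry (Suc k) M c) + E (int M) (signed_pow (Suc k) c)"
    unfolding IH W.op_simps 1 2 Qi_E by (simp add: E_simps W.op_simps Qi_E algebra_simps)
  finally show ?case .
qed

lemma theta_E: "theta M (E k y) = (if valid_slot M k then weight M k y else 0)"
proof -
  have "theta M (E k y) = (\<Sum>l\<in>{l. valid_slot M l}. if l = k then weight M k y else 0)"
    unfolding theta_def by (intro sum.cong) (auto simp: slot_E weight_simps)
  then show ?thesis using finite_valid_slot by simp
qed

text \<open>After the reductions a cycle is given, modulo \<open>W.Aug m\<close>, by coefficients b
  in slot s = m + k and c in slot m. The cycle condition, read off by \<open>theta\<close>, says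
  that (-1/q)^k b is \<open>bdry k m c\<close> modulo \<open>Aug m\<close>. Choosing y with (-1/q)^k
  y = c, it follows that b agrees with \<open>bdry k m y\<close>, and the pair is the boundary of y
  placed in slot s.\<close>

theorem exact_induced:
  assumes "exact"
  shows "W.exact"
  unfolding W.exact_def
proof (intro allI impI)
  fix k m f
  assume m: "1 \<le> m" and mk: "m + k \<le> Suc N" and f: "W.bdry k (Suc m) f \<in> W.Aug (Suc m)"
  show "\<exists>y. f - W.bdry (Suc k) m y \<in> W.Aug m"
  proof (cases k)
    case 0
    then show ?thesis by (auto intro!: exI[of _ f] simp: W.Aug_zero W.op_simps)
  next
    case (Suc k')
    let ?s = "m + k"
    have cycle: "W.bdry k (Suc m) (f - W.bdry (Suc k) m g) \<in> W.Aug (Suc m)" if "W.bdry k (Suc m) f \<in> W.Aug (Suc m)" for f g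
    proof -
      have "W.bdry k (Suc m) (W.bdry (Suc k) m g) \<in> W.Aug (Suc m)"
        using W.bdry_bdry[of m k g] m mk W.Aug_t[of m "Suc m"] by auto
      then show ?thesis using that unfolding W.bdry_simps by (rule W.Aug_diff[rotated])
    qed
    have "\<exists>g\<in>UNIV. \<forall>l. m < l \<longrightarrow> l \<le> Suc N \<longrightarrow> l \<noteq> 0 \<longrightarrow> eta l (f - W.bdry (Suc k) m g) \<in> Aug m"
    proof (rule neg.\<zeta>_reduce[OF assms m mk f])
      show "\<exists>g\<in>UNIV. eta i g = y \<and> (\<forall>l. 1 \<le> l \<longrightarrow> l \<le> Suc N \<longrightarrow> l \<noteq> i \<longrightarrow> eta l g = 0)"
        if "1 \<le> i" "i \<le> Suc N" for i y
      proof -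
        obtain g where g: "\<And>l. 1 \<le> l \<Longrightarrow> l \<le> Suc N \<Longrightarrow> eta l g = (if l = i then y else 0)"
          using eta_section[of "\<lambda>l. if l = i then y else 0"] by blast
        have "eta i g = y" using g[OF that] by (simp only: if_True simp_thms)
        moreover have "eta l g = 0" if "1 \<le> l" "l \<le> Suc N" "l \<noteq> i" for l
          using g[OF that(1,2)] that(3) by (simp only: if_False simp_thms)
        ultimately have "eta i g = y \<and> (\<forall>l. 1 \<le> l \<longrightarrow> l \<le> Suc N \<longrightarrow> l \<noteq> i \<longrightarrow> eta l g = 0)"
          by blast
        then show ?thesis by blast
      qed
    qed auto
    then obtain g1 where g1: "\<And>l. m < l \<Longrightarrow> l \<le> Suc N \<Longrightarrow> eta l (f - W.bdry (Suc k) m g1) \<in> Aug m"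
      by auto
    define f1 where "f1 = f - W.bdry (Suc k) m g1"
    have f1: "W.bdry k (Suc m) f1 \<in> W.Aug (Suc m)" unfolding f1_def by (rule cycle[OF f])
    \<comment> \<open>Corrections without b-coefficients have vanishing \<open>eta\<close>, and so
      have their boundaries; the first reduction thus survives the second.\<close>
    let ?S = "{g. \<forall>l. slot (- int l) g = 0}"
    have "\<exists>g\<in>?S. \<forall>l. m < l \<longrightarrow> l \<le> Suc N \<longrightarrow> l \<noteq> ?s \<longrightarrow> slot (int l) (f1 - W.bdry (Suc k) m g) \<in> Aug m"
    proof (rule pos.\<zeta>_reduce[OF assms m mk f1])
      show "\<exists>g\<in>?S. slot (int i) g = y \<and> (\<forall>l. 1 \<le> l \<longrightarrow> l \<le> Suc N \<longrightarrow> l \<noteq> i \<longrightarrow> slot (int l) g = 0)"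
        if "1 \<le> i" "i \<le> Suc N" for i and y :: "(nat \<Rightarrow> int) \<Rightarrow> 'g"
        using that by (intro bexI[of _ "E (int i) y"]) (auto simp: slot_E)
    qed auto
    then obtain g2 where g2S: "\<And>l. slot (- int l) g2 = 0"
      and g2: "\<And>l. m < l \<Longrightarrow> l \<le> Suc N \<Longrightarrow> l \<noteq> ?s \<Longrightarrow> slot (int l) (f1 - W.bdry (Suc k) m g2) \<in> Aug m"
      by auto
    define f2 where "f2 = f1 - W.bdry (Suc k) m g2"
    have f2: "W.bdry k (Suc m) f2 \<in> W.Aug (Suc m)" unfolding f2_def by (rule cycle[OF f1])
    have eta2: "eta l f2 \<in> Aug m" if l: "m < l" "l \<le> Suc N" for l
    proof -
      have "eta l (W.bdry (Suc k) m g2) - bdry (min (Suc k) (l - m)) m (eta l g2) \<in> {0}"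
        using l m mk eta_neg_zero[OF g2S] by (intro neg.\<zeta>_bdry) (auto simp: op_simps)
      then have "eta l (W.bdry (Suc k) m g2) = 0"
        using eta_neg_zero[OF g2S, of l] l m by (simp add: bdry_simps)
      then show ?thesis using g1[OF l] by (simp add: f2_def f1_def neg.\<zeta>_simps)
    qed
    have "slot j f2 \<in> Aug m" if j: "valid_slot (Suc N) j" "int m < \<bar>j\<bar>" "j \<noteq> int ?s" for j
    proof (cases "0 < j")
      case True
      then show ?thesis using g2[of "nat j"] j by (auto simp: f2_def valid_slot_def)
    next
      case False
      then show ?thesis using slot_neg_J[of m f2 "nat (- j)"] eta2 j by (auto simp: valid_slot_def)
    qed
    then obtain c where c: "f2 - (E (int ?s) (slot (int ?s) f2) + E (int m) c) \<in> W.Aug m"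
      using decompose[of m ?s f2] m mk Suc by auto
    define b where "b = slot (int ?s) f2"
    \<comment> \<open>The last term of the boundary of \<open>E (int ?s) y\<close> has to produce
      \<open>c\<close> in slot \<open>m\<close>.\<close>
    obtain y where y: "signed_pow k y = c" using signed_pow_surj by blast
    have "W.bdry k (Suc m) (f2 - (E (int ?s) b + E (int m) c)) \<in> W.Aug (Suc m)"
      using W.Aug_mono[OF W.bdry_J[OF c, of "Suc m" k], of "Suc m"] mk by (simp add: b_def del: W.bdry.simps)
    from W.Aug_diff[OF f2 this] have "W.bdry k (Suc m) (E (int ?s) b) + W.bdry k (Suc m) (E (int m) c) \<in> W.Aug (Suc m)"
      by (simp add: W.bdry_simps add.commute)
    then have "theta (Suc m) (W.bdry k (Suc m) (E (int ?s) b) + W.bdry k (Suc m) (E (int m) c)) \<in> Aug m"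
      using m mk Suc by (intro theta_J) auto
    \<comment> \<open>Slot \<open>m\<close> is one generator away from slot \<open>Suc m\<close>,
      whence a single factor q.\<close>
    moreover have "theta (Suc m) (W.bdry k (Suc m) (E (int m) c)) = Q (bdry k m c)"
      using m mk by (simp add: bdry_E_low theta_E valid_slot_def weight_def)
    moreover have "theta (Suc m) (W.bdry k (Suc m) (E (int ?s) b)) = signed_pow k' b"
    proof -
      have "W.bdry k (Suc m) (E (int ?s) b) = E (int ?s) (bdry k' (Suc m) b) + E (int (Suc m)) (signed_pow k' b)"
        using bdry_E_top[of "Suc m" k' b] m mk Suc by (simp del: bdry.simps W.bdry.simps)
      \<comment> \<open>Slot \<open>?s\<close> lies beyond \<open>Suc m\<close> and is not counted,
        unless \<open>k' = 0\<close>, when the sum in it is empty.\<close>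
      moreover have "theta (Suc m) (E (int ?s) (bdry k' (Suc m) b)) = 0"
        using Suc by (cases k') (auto simp: theta_E valid_slot_def weight_simps)
      ultimately show ?thesis by (simp add: theta_simps theta_E valid_slot_def weight_def)
    qed
    ultimately have "signed_pow k' b + Q (bdry k m c) \<in> Aug m" by (simp add: theta_simps)
    then have "- Qi (signed_pow k' b + Q (bdry k m c)) \<in> Aug m" by (intro Aug_minus Aug_Qi)
    moreover have "- Qi (signed_pow k' b + Q d) = signed_pow k b - d" for d using Suc by (simp add: op_simps)
    ultimately have "signed_pow k b - bdry k m c \<in> Aug m" by metis
    then have "signed_pow k (b - bdry k m y) \<in> Aug m" using y by (simp add: signed_pow_simps signed_pow_bdry)
    then have "b - bdry k m y \<in> Aug m" by (simp only: signed_pow_J_iff)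
    then have "E (int ?s) (b - bdry k m y) \<in> W.Aug m"
      using m mk Suc by (intro E_J) (auto simp: valid_slot_def)
    moreover have "W.bdry (Suc k) m (E (int ?s) y) = E (int ?s) (bdry k m y) + E (int m) c"
      using bdry_E_top[of m k y] m mk y by (simp del: bdry.simps W.bdry.simps)
    ultimately have "f2 - W.bdry (Suc k) m (E (int ?s) y) \<in> W.Aug m"
      using W.Aug_add[OF c, of "E (int ?s) (b - bdry k m y)"]
      by (simp add: b_def E_simps algebra_simps del: W.bdry.simps)
    moreover have "f2 - W.bdry (Suc k) m (E (int ?s) y) = f - W.bdry (Suc k) m (g1 + g2 + E (int ?s) y)"
      unfolding f2_def f1_def W.bdry_add by (simp only: diff_diff_eq add.assoc)
    ultimately show ?thesis by metis
  qed
qed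

end

section \<open>The iterated module over R\<close>

locale hb_ring = cring R for R :: "('a, 'm) ring_scheme" (structure) +
  fixes q :: 'a and n :: nat and ev :: "('a \<Rightarrow>\<^sub>0 int) \<Rightarrow> 'a"
  assumes q_unit: "q \<in> Units R"
    and ev_closed [simp]: "\<And>z. ev z \<in> carrier R"
    and ev_add: "\<And>y z. ev (y + z) = ev y \<oplus> ev z"
    and ev_frag_of: "\<And>r. ev (frag_of r) = (if r \<in> carrier R then r else \<zero>)"
begin

lemma q_closed [simp]: "q \<in> carrier R" "inv q \<in> carrier R"
  using q_unit by auto

lemma ev_zero [simp]: "ev 0 = \<zero>"
  using ev_add[of 0 0] by (simp add: add.l_cancel_one')

lemma ev_minus: "ev (- z) = \<ominus> ev z"
proof -
  have "ev (- z) \<oplus> ev z = \<zero>" using ev_add[of "- z" z] by simp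
  then show ?thesis by (simp add: minus_equality)
qed

lemma ev_diff: "ev (y - z) = ev y \<ominus> ev z"
  using ev_add[of y "- z"] by (simp add: ev_minus a_minus_def)

text \<open>Symbols outside the carrier stay fixed instead of going to zero. Thus scaling by q and
  by its inverse are mutually inverse as maps on formal sums, as \<open>hb_module\<close> demands,
  and not merely modulo \<open>Z\<close>.\<close>

definition scal :: "'a \<Rightarrow> ('a \<Rightarrow>\<^sub>0 int) \<Rightarrow> 'a \<Rightarrow>\<^sub>0 int" where
  "scal r = frag_extend (\<lambda>s. frag_of (if s \<in> carrier R then s \<otimes> r else s))"

lemma scal_simps: "scal r (y + z) = scal r y + scal r z" "scal r (y - z) = scal r y - scal r z"
  "scal r 0 = 0" "scal r (frag_of s) = frag_of (if s \<in> carrier R then s \<otimes> r else s)"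
  by (simp_all add: scal_def frag_extend_add frag_extend_diff)

lemma frag_induct [case_names zero frag_of diff]:
  assumes "P 0" "\<And>r. P (frag_of r)" "\<And>y z. P y \<Longrightarrow> P z \<Longrightarrow> P (y - z)"
  shows "P (z :: 'b \<Rightarrow>\<^sub>0 int)"
  using assms by (intro frag_induction[of z UNIV P]) auto

lemma ev_scal: "r \<in> carrier R \<Longrightarrow> ev (scal r z) = ev z \<otimes> r"
  by (induction z rule: frag_induct)
    (auto simp: scal_simps ev_frag_of ev_diff a_minus_def l_distr l_minus)

lemma scal_scal: "r \<in> carrier R \<Longrightarrow> s \<in> carrier R \<Longrightarrow> scal r (scal s z) = scal (r \<otimes> s) z"
  by (induction z rule: frag_induct) (auto simp: scal_simps m_ac)

lemma scal_one: "scal \<one> z = z"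
  by (induction z rule: frag_induct) (auto simp: scal_simps)

definition Sc :: "'a \<Rightarrow> ('a \<Rightarrow>\<^sub>0 int) op" where
  "Sc r f = (\<lambda>s. scal r (f s))"

lemma Sc_apply: "Sc r f s = scal r (f s)"
  by (simp add: Sc_def)

lemma Sc_Sc: "r \<in> carrier R \<Longrightarrow> s \<in> carrier R \<Longrightarrow> Sc r (Sc s f) = Sc (r \<otimes> s) f"
  by (simp add: Sc_def scal_scal)

lemma Sc_one: "Sc \<one> f = f"
  by (simp add: Sc_def scal_one)

lemma Sc_additive: "additive_map (Sc r)"
  by (simp add: additive_map_def Sc_def scal_simps plus_fun_def)

lemma slot_Sc: "slot k (Sc r f) = Sc r (slot k f)"
  by (simp add: slot_def Sc_def)

primrec rep_u :: "nat \<Rightarrow> ('a \<Rightarrow>\<^sub>0 int) op" where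
  "rep_u 0 = Sc q"
| "rep_u (Suc m) = ind_u (Suc m) (Sc q) (rep_u m)"

primrec rep_t :: "nat \<Rightarrow> nat \<Rightarrow> ('a \<Rightarrow>\<^sub>0 int) op" where
  "rep_t 0 = (\<lambda>j. Sc q)"
| "rep_t (Suc m) = ind_t (Suc m) (Sc q) (rep_t m)"

text \<open>At level 0 the module is R, represented by the value at the zero sequence alone. At
  level m the relevant positions are m valid slots followed by zeros.\<close>

primrec rep_Z :: "nat \<Rightarrow> ((nat \<Rightarrow> int) \<Rightarrow> 'a \<Rightarrow>\<^sub>0 int) set" where
  "rep_Z 0 = {f. ev (f (\<lambda>_. 0)) = \<zero>}"
| "rep_Z (Suc m) = ind_Z (Suc m) (rep_Z m)"

abbreviation "Qi \<equiv> Sc (inv q)"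

lemma rep_module: "hb_slots m (Sc q) Qi (rep_u m) (rep_t m) (rep_Z m)"
proof (induction m)
  case 0
  show ?case
  proof
    show "Sc q (Qi x) = x" "Qi (Sc q x) = x" for x
      using q_unit by (simp_all add: Sc_Sc Sc_one)
    show "x - y \<in> rep_Z 0" if "x \<in> rep_Z 0" "y \<in> rep_Z 0" for x y
      using that by (simp add: ev_diff minus_apply)
  qed (simp only: rep_u.simps rep_t.simps Sc_additive slot_Sc | simp add: Sc_apply ev_scal zero_fun_apply)+
next
  case (Suc m)
  then interpret hb_slots m "Sc q" Qi "rep_u m" "rep_t m" "rep_Z m" .
  show ?case
    using W.hb_module_axioms by (simp add: hb_slots_def hb_slots_axioms_def slot_Sc)
qed





text \<open>The start is vacuous: there is no \<open>m\<close> with \<open>1 \<le> m\<close> and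
  \<open>m + k \<le> 0\<close>.\<close>

lemma rep_exact: "hb_module.exact m (Sc q) Qi (rep_u m) (rep_t m) (rep_Z m)"
proof (induction m)
  case 0
  interpret hb_slots 0 "Sc q" Qi "rep_u 0" "rep_t 0" "rep_Z 0" by (rule rep_module)
  show ?case unfolding exact_def by auto
next
  case (Suc m)
  interpret hb_slots m "Sc q" Qi "rep_u m" "rep_t m" "rep_Z m" by (rule rep_module)
  show ?case using exact_induced[OF Suc] by simp
qed

section \<open>The Hecke algebra as a quotient of the free algebra\<close>

abbreviation "F \<equiv> hb_free R n"
abbreviation mult_F (infixl "\<bullet>" 70) where "f \<bullet> g \<equiv> f \<otimes>\<^bsub>F\<^esub> g"
abbreviation "I \<equiv> hb_ideal R q n"
abbreviation "H \<equiv> HB R q n"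
abbreviation mult_H (infixl "\<star>" 70) where "x \<star> y \<equiv> x \<otimes>\<^bsub>H\<^esub> y"
abbreviation "cl \<equiv> hb_class R q n"
abbreviation "sc \<equiv> hb_scalar R q n"
abbreviation "gen \<equiv> free_gen R"
abbreviation "hgen \<equiv> \<lambda>g. cl (gen g)"

sublocale F: ring F
  by (rule free_algebra_ring)

definition sF :: "'a \<Rightarrow> hb_gen list \<Rightarrow> 'a" where
  "sF c = c \<odot>\<^bsub>F\<^esub> \<one>\<^bsub>F\<^esub>"

lemma sF_eq: "c \<in> carrier R \<Longrightarrow> sF c = (\<lambda>w. if w = [] then c else \<zero>)"
  by (auto simp: sF_def free_algebra_def)

lemma sF_closed [simp]: "c \<in> carrier R \<Longrightarrow> sF c \<in> carrier F"
  by (simp add: free_algebra_carrier sF_eq)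

lemma gen_closed [simp]: "g \<in> hb_gens n \<Longrightarrow> gen g \<in> carrier F"
  by (auto simp: free_algebra_carrier free_gen_def)

lemma F_closed: "f \<in> carrier F \<Longrightarrow> f w \<in> carrier R"
  by (simp add: free_algebra_carrier)

lemma mult_sF:
  assumes "f \<in> carrier F" "c \<in> carrier R"
  shows "f \<bullet> sF c = (\<lambda>w. f w \<otimes> c)"
proof
  fix w
  have "(f \<bullet> sF c) w = (\<Oplus>i\<in>{..length w}. if i = length w then f (take i w) \<otimes> c else \<zero>)"
    unfolding free_algebra_simps using assms F_closed by (intro finsum_cong') (auto simp: sF_eq)
  also have "\<dots> = f w \<otimes> c"
    using assms F_closed by (subst add.finprod_singleton_swap) auto
  finally show "(f \<bullet> sF c) w = f w \<otimes> c" .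
qed

lemma sF_mult:
  assumes "f \<in> carrier F" "c \<in> carrier R"
  shows "sF c \<bullet> f = f \<bullet> sF c"
proof
  fix w
  have "(sF c \<bullet> f) w = (\<Oplus>i\<in>{..length w}. if i = 0 then c \<otimes> f (drop i w) else \<zero>)"
    unfolding free_algebra_simps using assms F_closed by (intro finsum_cong') (auto simp: sF_eq)
  also have "\<dots> = c \<otimes> f w"
    using assms F_closed by (subst add.finprod_singleton_swap) auto
  finally show "(sF c \<bullet> f) w = (f \<bullet> sF c) w" 
    using assms F_closed by (simp add: mult_sF m_comm)
qed

lemma mult_gen:
  assumes "f \<in> carrier F" "g \<in> hb_gens n"
  shows "(f \<bullet> gen g) w = (if w \<noteq> [] \<and> last w = g then f (butlast w) else \<zero>)"
proof -
  have d: "drop i w = [g] \<longleftrightarrow> w \<noteq> [] \<and> last w = g \<and> i = length w - 1" if "i \<le> length w" for i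
    using that by (cases w rule: rev_cases) (auto simp: drop_Cons' Cons_nth_drop_Suc dest: arg_cong[of _ _ length])
  have "(f \<bullet> gen g) w = (\<Oplus>i\<in>{..length w}. if i = length w - 1 then (if w \<noteq> [] \<and> last w = g then f (butlast w) else \<zero>) else \<zero>)"
    unfolding free_algebra_simps using assms F_closed d
    by (intro finsum_cong') (auto simp: free_gen_def butlast_conv_take)
  also have "\<dots> = (if w \<noteq> [] \<and> last w = g then f (butlast w) else \<zero>)"
    using assms F_closed by (subst add.finprod_singleton_swap) auto
  finally show ?thesis .
qed

text \<open>Monomials grow by a letter on the right, as suits right modules: a statement about
  products need only be followed through right multiplication by one generator.\<close>

lemma F_induct [consumes 1, case_names scalar gen add]:
  assumes f: "f \<in> carrier F"
    and scalar: "\<And>c. c \<in> carrier R \<Longrightarrow> P (sF c)"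
    and gen: "\<And>f g. f \<in> carrier F \<Longrightarrow> P f \<Longrightarrow> g \<in> hb_gens n \<Longrightarrow> P (f \<bullet> gen g)"
    and add: "\<And>f g. f \<in> carrier F \<Longrightarrow> P f \<Longrightarrow> g \<in> carrier F \<Longrightarrow> P g \<Longrightarrow> P (f \<oplus>\<^bsub>F\<^esub> g)"
  shows "P f"
proof -
  define mono where "mono c v = (\<lambda>w. if w = v then c else \<zero>)" for c and v :: "hb_gen list"
  have mono: "mono c v \<in> carrier F \<and> P (mono c v)" if "c \<in> carrier R" "v \<in> lists (hb_gens n)" for c v
    using that(2)
  proof (induction v rule: rev_induct)
    case Nil
    then show ?case using scalar[of c] sF_closed[of c] that(1) by (simp add: mono_def sF_eq)
  next
    case (snoc g v)
    have "mono c (v @ [g]) = mono c v \<bullet> gen g"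
    proof
      fix w show "mono c (v @ [g]) w = (mono c v \<bullet> gen g) w"
        using snoc by (cases w rule: rev_cases) (auto simp: mult_gen mono_def)
    qed
    then show ?case using snoc gen by auto
  qed
  have "finite S \<Longrightarrow> f \<in> carrier F \<Longrightarrow> {w. f w \<noteq> \<zero>} = S \<Longrightarrow> P f" for S f
  proof (induction S arbitrary: f rule: finite_induct)
    case empty
    then have "f = sF \<zero>" by (auto simp: sF_eq)
    then show ?case using scalar by simp
  next
    case (insert v S)
    have v: "v \<in> lists (hb_gens n)" "f v \<in> carrier R"
      using insert.prems unfolding free_algebra_carrier by blast+
    define f' where "f' = f(v := \<zero>)"
    have S: "{w. f' w \<noteq> \<zero>} = S" using insert unfolding f'_def by auto
    have f': "f' \<in> carrier F"
      using insert.prems(1) insert.hyps S unfolding free_algebra_carrier by (auto simp: f'_def)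
    have "f = f' \<oplus>\<^bsub>F\<^esub> mono (f v) v"
      using insert.prems(1) by (auto simp: free_algebra_simps f'_def mono_def F_closed)
    then show ?case using add[OF f' insert.IH[OF f' S]] mono[OF v(2,1)] by metis
  qed
  then show ?thesis using f by (auto simp: free_algebra_carrier)
qed

lemma gens_U: "1 \<le> n \<Longrightarrow> GenU \<in> hb_gens n"
  and gens_T: "1 \<le> i \<Longrightarrow> i < n \<Longrightarrow> GenT i \<in> hb_gens n"
  by (auto simp: hb_gens_def)

lemma sF_q: "q \<odot>\<^bsub>F\<^esub> \<one>\<^bsub>F\<^esub> = sF q"
  by (simp add: sF_def)

lemma relators_cases:
  assumes "x \<in> hb_relators R q n"
  obtains (u_braid) "1 < n" "x = gen GenU \<bullet> gen (GenT 1) \<bullet> gen GenU \<bullet> gen (GenT 1)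
      \<ominus>\<^bsub>F\<^esub> gen (GenT 1) \<bullet> gen GenU \<bullet> gen (GenT 1) \<bullet> gen GenU"
  | (u_comm) i where "1 < i" "i < n" "x = gen GenU \<bullet> gen (GenT i) \<ominus>\<^bsub>F\<^esub> gen (GenT i) \<bullet> gen GenU"
  | (t_braid) i where "1 \<le> i" "i + 1 < n" "x = gen (GenT i) \<bullet> gen (GenT (i + 1)) \<bullet> gen (GenT i)
      \<ominus>\<^bsub>F\<^esub> gen (GenT (i + 1)) \<bullet> gen (GenT i) \<bullet> gen (GenT (i + 1))"
  | (t_comm) i j where "1 \<le> i" "i < n" "1 \<le> j" "j < n" "i + 1 < j \<or> j + 1 < i"
      "x = gen (GenT i) \<bullet> gen (GenT j) \<ominus>\<^bsub>F\<^esub> gen (GenT j) \<bullet> gen (GenT i)"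
  | (quad) g where "g \<in> hb_gens n" "x = (gen g \<oplus>\<^bsub>F\<^esub> \<one>\<^bsub>F\<^esub>) \<bullet> (gen g \<ominus>\<^bsub>F\<^esub> sF q)"
proof -
  have ij: "\<bar>int i - int j\<bar> > 1 \<Longrightarrow> i + 1 < j \<or> j + 1 < i" for i j by linarith
  show thesis
    using assms unfolding hb_relators_def Let_def sF_q
  proof (elim UnE)
    assume "x \<in> {gen (GenT i) \<bullet> gen (GenT j) \<ominus>\<^bsub>F\<^esub> gen (GenT j) \<bullet> gen (GenT i) | i j.
           i \<in> {1..<n} \<and> j \<in> {1..<n} \<and> \<bar>int i - int j\<bar> > 1}"
    then obtain i j where "x = gen (GenT i) \<bullet> gen (GenT j) \<ominus>\<^bsub>F\<^esub> gen (GenT j) \<bullet> gen (GenT i)"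
      "i \<in> {1..<n}" "j \<in> {1..<n}" "\<bar>int i - int j\<bar> > 1" by blast
    then show thesis using t_comm[of i j] ij[of i j] by (simp only: atLeastLessThan_iff)
  next
    assume "x \<in> {(gen (GenT i) \<oplus>\<^bsub>F\<^esub> \<one>\<^bsub>F\<^esub>) \<bullet> (gen (GenT i) \<ominus>\<^bsub>F\<^esub> sF q) |i. i \<in> {1..<n}}"
    then show thesis using quad gens_T by (fastforce simp only: atLeastLessThan_iff)
  next
    assume "x \<in> (if 1 \<le> n then {(gen GenU \<oplus>\<^bsub>F\<^esub> \<one>\<^bsub>F\<^esub>) \<bullet> (gen GenU \<ominus>\<^bsub>F\<^esub> sF q)} else {})"
    then show thesis using quad gens_U by (metis empty_iff singletonD)
  next
    assume "x \<in> (if 1 < n then {gen GenU \<bullet> gen (GenT 1) \<bullet> gen GenU \<bullet> gen (GenT 1)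
      \<ominus>\<^bsub>F\<^esub> gen (GenT 1) \<bullet> gen GenU \<bullet> gen (GenT 1) \<bullet> gen GenU} else {})"
    then show thesis using u_braid by (metis empty_iff singletonD)
  qed (use u_comm t_braid in blast)+
qed

lemma gens_T1: "1 < n \<Longrightarrow> GenT 1 \<in> hb_gens n"
  by (rule gens_T) simp_all

lemma relators_closed: "hb_relators R q n \<subseteq> carrier F"
proof
  fix x assume "x \<in> hb_relators R q n"
  then show "x \<in> carrier F"
  proof (cases rule: relators_cases)
    case u_braid
    then have "gen GenU \<in> carrier F" "gen (GenT 1) \<in> carrier F" by (intro gen_closed gens_U gens_T1; simp)+
    then show ?thesis unfolding u_braid(2) by (intro F.minus_closed F.m_closed)
  next
    case (u_comm i)
    then have "gen GenU \<in> carrier F" "gen (GenT i) \<in> carrier F" by (intro gen_closed gens_U gens_T; simp)+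
    then show ?thesis unfolding u_comm(3) by (intro F.minus_closed F.m_closed)
  next
    case (t_braid i)
    then have "gen (GenT i) \<in> carrier F" "gen (GenT (i + 1)) \<in> carrier F" by (intro gen_closed gens_T; simp)+
    then show ?thesis unfolding t_braid(3) by (intro F.minus_closed F.m_closed)
  next
    case (t_comm i j)
    then have "gen (GenT i) \<in> carrier F" "gen (GenT j) \<in> carrier F" by (intro gen_closed gens_T; simp)+
    then show ?thesis unfolding t_comm(6) by (intro F.minus_closed F.m_closed)
  next
    case (quad g)
    then have "gen g \<in> carrier F" "sF q \<in> carrier F" by auto
    then show ?thesis unfolding quad(2) by (intro F.minus_closed F.m_closed F.a_closed F.one_closed)
  qed
qed

sublocale I: ideal I F
  unfolding hb_ideal_def by (rule F.genideal_ideal[OF relators_closed])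

sublocale H: ring H
  unfolding HB_def by (rule I.quotient_is_ring)

lemma cl_hom: "cl \<in> ring_hom F H"
  unfolding hb_class_def HB_def by (rule I.rcos_ring_hom)

lemma cl_closed [simp]: "f \<in> carrier F \<Longrightarrow> cl f \<in> carrier H"
  and cl_mult: "f \<in> carrier F \<Longrightarrow> g \<in> carrier F \<Longrightarrow> cl (f \<bullet> g) = cl f \<star> cl g"
  and cl_add: "f \<in> carrier F \<Longrightarrow> g \<in> carrier F \<Longrightarrow> cl (f \<oplus>\<^bsub>F\<^esub> g) = cl f \<oplus>\<^bsub>H\<^esub> cl g"
  and cl_one: "cl \<one>\<^bsub>F\<^esub> = \<one>\<^bsub>H\<^esub>"
  using cl_hom by (auto simp: ring_hom_def Pi_def)

sublocale cl: ring_hom_ring F H cl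
  by (rule ring_hom_ringI2[OF F.ring_axioms H.ring_axioms cl_hom])

lemma cl_surj: "x \<in> carrier H \<Longrightarrow> \<exists>f\<in>carrier F. x = cl f"
  unfolding HB_def hb_class_def FactRing_def A_RCOSETS_def' by auto

lemma cl_eq_zero:
  assumes "f \<in> carrier F"
  shows "cl f = \<zero>\<^bsub>H\<^esub> \<longleftrightarrow> f \<in> I"
proof -
  have z: "\<zero>\<^bsub>H\<^esub> = I" by (simp add: HB_def FactRing_def)
  show ?thesis unfolding hb_class_def z
    using I.a_rcos_const[of f] I.a_rcos_self[OF assms] by metis
qed

lemma cl_eq: "f \<in> carrier F \<Longrightarrow> g \<in> carrier F \<Longrightarrow> cl f = cl g \<longleftrightarrow> f \<ominus>\<^bsub>F\<^esub> g \<in> I"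
proof -
  assume fg: "f \<in> carrier F" "g \<in> carrier F"
  then have "cl (f \<ominus>\<^bsub>F\<^esub> g) = cl f \<ominus>\<^bsub>H\<^esub> cl g" by (simp add: a_minus_def cl_add)
  then show "cl f = cl g \<longleftrightarrow> f \<ominus>\<^bsub>F\<^esub> g \<in> I"
    using fg cl_eq_zero[of "f \<ominus>\<^bsub>F\<^esub> g"] H.r_right_minus_eq by simp
qed

lemma sc_cl: "sc c = cl (sF c)"
  by (simp add: hb_scalar_def sF_def)

end

context hb_ring
begin

lemma sc_closed [simp]: "c \<in> carrier R \<Longrightarrow> sc c \<in> carrier H"
  by (simp add: sc_cl)

lemma sF_mult_sF: "c \<in> carrier R \<Longrightarrow> d \<in> carrier R \<Longrightarrow> sF c \<bullet> sF d = sF (c \<otimes> d)"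
  by (subst mult_sF[OF sF_closed]) (auto simp: sF_eq)

lemma sc_mult: "c \<in> carrier R \<Longrightarrow> d \<in> carrier R \<Longrightarrow> sc (c \<otimes> d) = sc c \<star> sc d"
  by (simp add: sc_cl flip: sF_mult_sF)

lemma sF_add: "c \<in> carrier R \<Longrightarrow> d \<in> carrier R \<Longrightarrow> sF (c \<oplus> d) = sF c \<oplus>\<^bsub>F\<^esub> sF d"
  by (auto simp: sF_eq free_algebra_simps)

lemma sc_add: "c \<in> carrier R \<Longrightarrow> d \<in> carrier R \<Longrightarrow> sc (c \<oplus> d) = sc c \<oplus>\<^bsub>H\<^esub> sc d"
  by (simp add: sc_cl sF_add)

lemma sF_one: "sF \<one> = \<one>\<^bsub>F\<^esub>"
  by (auto simp: sF_eq free_algebra_simps)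

lemma sc_one: "sc \<one> = \<one>\<^bsub>H\<^esub>"
  by (simp add: sc_cl sF_one cl_one)

lemma sF_zero: "sF \<zero> = \<zero>\<^bsub>F\<^esub>"
  by (auto simp: sF_eq free_algebra_simps)

lemma sc_zero: "sc \<zero> = \<zero>\<^bsub>H\<^esub>"
  unfolding sc_cl sF_zero by (rule cl.hom_zero)

lemma sc_comm:
  assumes "c \<in> carrier R" "x \<in> carrier H"
  shows "sc c \<star> x = x \<star> sc c"
proof -
  obtain f where f: "f \<in> carrier F" "x = cl f" using cl_surj[OF assms(2)] by blast
  show ?thesis unfolding f(2) sc_cl cl_mult[OF sF_closed[OF assms(1)] f(1), symmetric]
      cl_mult[OF f(1) sF_closed[OF assms(1)], symmetric] sF_mult[OF f(1) assms(1)] ..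
qed

abbreviation "HT i \<equiv> hb_T R q n i"
abbreviation "HU \<equiv> hgen GenU"

lemma HT_hgen: "HT i = hgen (GenT i)"
  by (simp add: hb_T_def)

lemma HT_closed [simp]: "1 \<le> i \<Longrightarrow> i < n \<Longrightarrow> HT i \<in> carrier H"
  unfolding HT_hgen by (intro cl_closed gen_closed gens_T)

lemma HU_closed [simp]: "1 \<le> n \<Longrightarrow> HU \<in> carrier H"
  by (intro cl_closed gen_closed gens_U)

lemma relator_eq:
  assumes "f \<ominus>\<^bsub>F\<^esub> g \<in> hb_relators R q n" "f \<in> carrier F" "g \<in> carrier F"
  shows "cl f = cl g"
proof -
  have "f \<ominus>\<^bsub>F\<^esub> g \<in> I"
    unfolding hb_ideal_def using F.genideal_self[OF relators_closed] assms(1) by blast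
  then show ?thesis using cl_eq assms by simp
qed

lemma H_U_braid:
  assumes "1 < n"
  shows "HU \<star> HT 1 \<star> HU \<star> HT 1 = HT 1 \<star> HU \<star> HT 1 \<star> HU"
proof -
  let ?u = "gen GenU" and ?t = "gen (GenT 1)"
  have c: "?u \<in> carrier F" "?t \<in> carrier F"
    using assms by (intro gen_closed gens_U gens_T1; simp)+
  have "?u \<bullet> ?t \<bullet> ?u \<bullet> ?t \<ominus>\<^bsub>F\<^esub> ?t \<bullet> ?u \<bullet> ?t \<bullet> ?u \<in> hb_relators R q n"
    unfolding hb_relators_def Let_def using assms by (simp only: if_True Un_iff singleton_iff simp_thms)
  from relator_eq[OF this] show ?thesis using c by (simp add: HT_hgen cl_mult)
qed

lemma H_UT_comm:
  assumes "1 < i" "i < n"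
  shows "HU \<star> HT i = HT i \<star> HU"
proof -
  let ?u = "gen GenU" and ?t = "gen (GenT i)"
  have c: "?u \<in> carrier F" "?t \<in> carrier F"
    using assms by (intro gen_closed gens_U gens_T; simp)+
  have "?u \<bullet> ?t \<ominus>\<^bsub>F\<^esub> ?t \<bullet> ?u \<in> hb_relators R q n"
    unfolding hb_relators_def Let_def using assms by blast
  from relator_eq[OF this] show ?thesis using c by (simp add: HT_hgen cl_mult)
qed

lemma H_T_braid:
  assumes "1 \<le> i" "i + 1 < n"
  shows "HT i \<star> HT (i + 1) \<star> HT i = HT (i + 1) \<star> HT i \<star> HT (i + 1)"
proof -
  let ?u = "gen (GenT (i + 1))" and ?t = "gen (GenT i)"
  have c: "?u \<in> carrier F" "?t \<in> carrier F"
    using assms by (intro gen_closed gens_T; simp)+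
  have "?t \<bullet> ?u \<bullet> ?t \<ominus>\<^bsub>F\<^esub> ?u \<bullet> ?t \<bullet> ?u \<in> hb_relators R q n"
    unfolding hb_relators_def Let_def using assms by blast
  from relator_eq[OF this] show ?thesis using c by (simp add: HT_hgen cl_mult)
qed

lemma H_T_comm:
  assumes "1 \<le> i" "i + 1 < j" "j < n"
  shows "HT i \<star> HT j = HT j \<star> HT i"
proof -
  let ?u = "gen (GenT j)" and ?t = "gen (GenT i)"
  have c: "?u \<in> carrier F" "?t \<in> carrier F"
    using assms by (intro gen_closed gens_T; simp)+
  have "i \<in> {1..<n} \<and> j \<in> {1..<n} \<and> \<bar>int i - int j\<bar> > 1" using assms by auto
  then have "?t \<bullet> ?u \<ominus>\<^bsub>F\<^esub> ?u \<bullet> ?t \<in> hb_relators R q n"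
    unfolding hb_relators_def Let_def by blast
  from relator_eq[OF this] show ?thesis using c by (simp add: HT_hgen cl_mult)
qed

lemma H_quad:
  assumes "g \<in> hb_gens n"
  shows "hgen g \<star> hgen g = (sc q \<star> hgen g \<ominus>\<^bsub>H\<^esub> hgen g) \<oplus>\<^bsub>H\<^esub> sc q"
proof -
  let ?g = "gen g"
  have c: "?g \<in> carrier F" "sF q \<in> carrier F" using assms by auto
  let ?x = "(?g \<oplus>\<^bsub>F\<^esub> \<one>\<^bsub>F\<^esub>) \<bullet> (?g \<ominus>\<^bsub>F\<^esub> sF q)"
  consider "g = GenU" "1 \<le> n" | i where "g = GenT i" "i \<in> {1..<n}"
    using assms by (auto simp: hb_gens_def split: if_splits)
  then have "?x \<in> hb_relators R q n"
  proof cases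
    case 1
    then show ?thesis unfolding hb_relators_def Let_def sF_q
      by (simp only: if_True Un_iff singleton_iff simp_thms)
  next
    case 2
    then show ?thesis unfolding hb_relators_def Let_def sF_q by blast
  qed
  then have "?x \<in> I" unfolding hb_ideal_def using F.genideal_self[OF relators_closed] by blast
  moreover have "?x \<in> carrier F"
    using c by (intro F.minus_closed F.m_closed F.a_closed F.one_closed)
  ultimately have "cl ?x = \<zero>\<^bsub>H\<^esub>" by (simp only: cl_eq_zero)
  then have 0: "(hgen g \<oplus>\<^bsub>H\<^esub> \<one>\<^bsub>H\<^esub>) \<star> (hgen g \<ominus>\<^bsub>H\<^esub> sc q) = \<zero>\<^bsub>H\<^esub>"
    using c by (simp add: cl_mult cl_add cl_one sc_cl a_minus_def)
  let ?h = "hgen g"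
  have h: "?h \<in> carrier H" using c by simp
  have "(?h \<oplus>\<^bsub>H\<^esub> \<one>\<^bsub>H\<^esub>) \<star> (?h \<ominus>\<^bsub>H\<^esub> sc q) = ?h \<star> ?h \<ominus>\<^bsub>H\<^esub> ((sc q \<star> ?h \<ominus>\<^bsub>H\<^esub> ?h) \<oplus>\<^bsub>H\<^esub> sc q)"
    using h sc_comm[of q ?h] by (simp add: a_minus_def H.r_distr H.l_distr H.r_minus H.l_minus H.minus_add H.a_ac)
  then have "?h \<star> ?h \<ominus>\<^bsub>H\<^esub> ((sc q \<star> ?h \<ominus>\<^bsub>H\<^esub> ?h) \<oplus>\<^bsub>H\<^esub> sc q) = \<zero>\<^bsub>H\<^esub>" using 0 by metis
  then show ?thesis using h by (subst (asm) H.r_right_minus_eq) auto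
qed


lemma H_T_quad: "1 \<le> i \<Longrightarrow> i < n \<Longrightarrow> HT i \<star> HT i = (sc q \<star> HT i \<ominus>\<^bsub>H\<^esub> HT i) \<oplus>\<^bsub>H\<^esub> sc q"
  unfolding HT_hgen by (intro H_quad gens_T)

lemma H_U_quad: "1 \<le> n \<Longrightarrow> HU \<star> HU = (sc q \<star> HU \<ominus>\<^bsub>H\<^esub> HU) \<oplus>\<^bsub>H\<^esub> sc q"
  by (intro H_quad gens_U)

text \<open>Chains two exchange rules; on each passage the generator may change, for instance from
  T_j to T_{j-1}.\<close>

lemma mult_shift:
  assumes "y \<star> t = s \<star> y" "x \<star> s = r \<star> x"
    and "x \<in> carrier H" "y \<in> carrier H" "t \<in> carrier H" "s \<in> carrier H" "r \<in> carrier H"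
  shows "x \<star> y \<star> t = r \<star> (x \<star> y)"
proof -
  have "x \<star> y \<star> t = x \<star> (s \<star> y)" using assms by (simp add: H.m_assoc)
  also have "\<dots> = r \<star> x \<star> y" using assms by (simp flip: H.m_assoc)
  finally show ?thesis using assms by (simp add: H.m_assoc)
qed

section \<open>Coset representatives times generators\<close>

abbreviation "desc \<equiv> hb_Tprod R q n"

lemma desc_self [simp]: "desc a a = \<one>\<^bsub>H\<^esub>"
  by (cases a) simp_all

lemma desc_Suc: "b \<le> a \<Longrightarrow> desc (Suc a) b = HT a \<star> desc a b"
  by simp

declare hb_Tprod.simps(2) [simp del]

lemma desc_closed [simp]: "1 \<le> b \<Longrightarrow> b \<le> a \<Longrightarrow> a \<le> n \<Longrightarrow> desc a b \<in> carrier H"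
proof (induction a)
  case (Suc a)
  then show ?case by (cases "b = Suc a") (simp_all add: desc_Suc)
qed simp

lemma desc_T_end: "1 \<le> b \<Longrightarrow> Suc b \<le> a \<Longrightarrow> a \<le> n \<Longrightarrow> desc a (Suc b) \<star> HT b = desc a b"
proof (induction a)
  case (Suc a)
  show ?case
  proof (cases "Suc b = Suc a")
    case True
    then show ?thesis using Suc.prems by (simp add: desc_Suc)
  next
    case False
    then show ?thesis using Suc by (simp add: desc_Suc H.m_assoc)
  qed
qed simp

lemma desc_T_comm:
  assumes "1 \<le> b" "b \<le> a" "a \<le> n" "1 \<le> j" "j < n" "j + 1 < b \<or> a < j"
  shows "desc a b \<star> HT j = HT j \<star> desc a b"
  using assms
proof (induction a)
  case (Suc a)
  show ?case
  proof (cases "b = Suc a")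
    case True
    then show ?thesis using Suc.prems by simp
  next
    case False
    then have "HT a \<star> HT j = HT j \<star> HT a"
      using Suc.prems H_T_comm[of j a] H_T_comm[of a j] by auto
    moreover have "b \<le> a" using False Suc.prems by simp
    ultimately show ?thesis unfolding desc_Suc[OF \<open>b \<le> a\<close>]
      using Suc by (intro mult_shift) auto
  qed
qed simp

lemma desc_U_comm: "2 \<le> b \<Longrightarrow> b \<le> a \<Longrightarrow> a \<le> n \<Longrightarrow> desc a b \<star> HU = HU \<star> desc a b"
proof (induction a)
  case (Suc a)
  show ?case
  proof (cases "b = Suc a")
    case True
    then show ?thesis using Suc.prems by simp
  next
    case False
    then have "HT a \<star> HU = HU \<star> HT a"
      using Suc.prems H_UT_comm[of a] by auto
    moreover have "b \<le> a" using False Suc.prems by simp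
    ultimately show ?thesis unfolding desc_Suc[OF \<open>b \<le> a\<close>]
      using Suc by (intro mult_shift) auto
  qed
qed simp

text \<open>T_j commutes with the factors below T_{j-1}, the braid relation exchanges T_j T_{j-1}
  T_j for T_{j-1} T_j T_{j-1}, and T_{j-1} commutes with the factors above T_j.\<close>

lemma desc_T_shift:
  "1 \<le> b \<Longrightarrow> b < j \<Longrightarrow> j < a \<Longrightarrow> a \<le> n \<Longrightarrow> desc a b \<star> HT j = HT (j - 1) \<star> desc a b"
proof (induction a)
  case (Suc a)
  show ?case
  proof (cases "j = a")
    case False
    then have IH: "desc a b \<star> HT j = HT (j - 1) \<star> desc a b" using Suc by simp
    have "HT a \<star> HT (j - 1) = HT (j - 1) \<star> HT a"
      using Suc.prems False by (intro H_T_comm[symmetric]) auto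
    then show ?thesis unfolding desc_Suc[OF order_trans[OF less_imp_le[OF Suc.prems(2)] less_Suc_eq_le[THEN iffD1, OF Suc.prems(3)]]]
      using Suc.prems False by (intro mult_shift[OF IH]) auto
  next
    case True
    then obtain i where a: "a = Suc i" using Suc.prems by (cases a) auto
    have i: "1 \<le> i" "i + 1 < n" "b \<le> i" using Suc.prems True a by auto
    let ?z = "desc i b"
    have z: "?z \<in> carrier H" "HT i \<in> carrier H" "HT (Suc i) \<in> carrier H" using i Suc.prems by auto
    have "desc (Suc a) b \<star> HT j = HT (Suc i) \<star> (HT i \<star> (?z \<star> HT (Suc i)))"
      using z i a True by (simp add: desc_Suc H.m_assoc)
    also have "?z \<star> HT (Suc i) = HT (Suc i) \<star> ?z"
      using i Suc.prems by (intro desc_T_comm) auto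
    also have "HT (Suc i) \<star> (HT i \<star> (HT (Suc i) \<star> ?z)) = HT (Suc i) \<star> HT i \<star> HT (Suc i) \<star> ?z"
      using z by (simp add: H.m_assoc)
    also have "\<dots> = HT i \<star> HT (Suc i) \<star> HT i \<star> ?z"
      using H_T_braid[of i] i by simp
    also have "\<dots> = HT (j - 1) \<star> desc (Suc a) b"
      using z i a True by (simp add: desc_Suc H.m_assoc)
    finally show ?thesis .
  qed
qed simp

primrec asc :: "nat \<Rightarrow> (hb_gen list \<Rightarrow> 'a) set" where
  "asc 0 = \<one>\<^bsub>H\<^esub>"
| "asc (Suc i) = asc i \<star> HT (Suc i)"

lemma asc_closed [simp]: "i < n \<Longrightarrow> asc i \<in> carrier H"
  by (induction i) simp_all

lemma asc_T_comm: "i + 1 < j \<Longrightarrow> j < n \<Longrightarrow> asc i \<star> HT j = HT j \<star> asc i"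
proof (induction i)
  case (Suc i)
  then have "HT (Suc i) \<star> HT j = HT j \<star> HT (Suc i)" by (intro H_T_comm) auto
  moreover have "asc i \<star> HT j = HT j \<star> asc i" using Suc by simp
  ultimately show ?case unfolding asc.simps using Suc.prems by (intro mult_shift) auto
qed simp

lemma asc_T_shift: "1 \<le> j \<Longrightarrow> j < i \<Longrightarrow> i < n \<Longrightarrow> asc i \<star> HT j = HT (Suc j) \<star> asc i"
proof (induction i)
  case (Suc i)
  show ?case
  proof (cases "j = i")
    case False
    then have "HT (Suc i) \<star> HT j = HT j \<star> HT (Suc i)"
      using Suc.prems by (intro H_T_comm[symmetric]) auto
    moreover have "asc i \<star> HT j = HT (Suc j) \<star> asc i" using Suc False by simp
    ultimately show ?thesis unfolding asc.simps using Suc.prems False by (intro mult_shift) auto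
  next
    case True
    then obtain k where k: "i = Suc k" using Suc.prems by (cases i) auto
    have kn: "Suc k + 1 < n" using Suc.prems k by simp
    have c: "asc k \<in> carrier H" "HT (Suc k) \<in> carrier H" "HT (Suc (Suc k)) \<in> carrier H" using kn by auto
    have "asc (Suc i) \<star> HT j = asc k \<star> (HT (Suc k) \<star> HT (Suc (Suc k)) \<star> HT (Suc k))"
      using c k True by (simp add: H.m_assoc)
    also have "\<dots> = asc k \<star> HT (Suc (Suc k)) \<star> (HT (Suc k) \<star> HT (Suc (Suc k)))"
      using c kn H_T_braid[of "Suc k"] by (simp add: H.m_assoc)
    also have "asc k \<star> HT (Suc (Suc k)) = HT (Suc (Suc k)) \<star> asc k"
      using kn by (intro asc_T_comm) auto
    finally show ?thesis using c k True by (simp add: H.m_assoc)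
  qed
qed simp

text \<open>The relation between U and T_1, multiplied on the right by T_2 ... T_i, which commutes
  with U. It is what makes U commute with the representatives b_k for k > 1.\<close>

lemma T_U_asc_U:
  "1 \<le> i \<Longrightarrow> i < n \<Longrightarrow> HT 1 \<star> (HU \<star> (asc i \<star> HU)) = HU \<star> (HT 1 \<star> (HU \<star> asc i))"
proof (induction i)
  case (Suc i)
  have c: "HT 1 \<in> carrier H" "HU \<in> carrier H" "HT (Suc i) \<in> carrier H" "asc i \<in> carrier H"
    using Suc.prems by auto
  show ?case
  proof (cases i)
    case 0
    then show ?thesis using Suc.prems H_U_braid c by (simp add: H.m_assoc)
  next
    case (Suc k)
    have "asc (Suc i) \<star> HU = asc i \<star> (HU \<star> HT (Suc i))"
      using H_UT_comm[of "Suc i"] Suc.prems Suc c by (simp add: H.m_assoc)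
    then have "HT 1 \<star> (HU \<star> (asc (Suc i) \<star> HU)) = (HT 1 \<star> (HU \<star> (asc i \<star> HU))) \<star> HT (Suc i)"
      using c by (simp add: H.m_assoc del: asc.simps)
    also have "\<dots> = HU \<star> (HT 1 \<star> (HU \<star> asc i)) \<star> HT (Suc i)"
      using Suc.IH Suc.prems Suc by simp
    finally show ?thesis using c by (simp add: H.m_assoc)
  qed
qed simp


text \<open>The elements a_k and b_k at level \<open>m\<close>, indexed like the slots. As b_k ends
  in T_{k-1}, its ascending part is \<open>asc (k - 1)\<close>.\<close>

definition coset_rep :: "nat \<Rightarrow> int \<Rightarrow> (hb_gen list \<Rightarrow> 'a) set" where
  "coset_rep m k = (if 0 < k then desc m (nat k) else desc m 1 \<star> HU \<star> asc (nat (- k) - 1))"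

lemma coset_rep_pos: "1 \<le> i \<Longrightarrow> coset_rep m (int i) = desc m i"
  by (simp add: coset_rep_def)

lemma coset_rep_neg: "coset_rep m (- int (Suc i)) = desc m 1 \<star> HU \<star> asc i"
proof -
  have "nat (- (- int (Suc i))) - 1 = i" "\<not> 0 < - int (Suc i)" by simp_all
  then show ?thesis by (simp only: coset_rep_def if_False)
qed

lemma valid_slot_cases:
  assumes "valid_slot m k"
  obtains (pos) i where "1 \<le> i" "i \<le> m" "k = int i" | (neg) i where "i < m" "k = - int (Suc i)"
proof (cases "0 < k")
  case True
  then show thesis using assms pos[of "nat k"] by (simp add: valid_slot_def)
next
  case False
  then have "nat (- k) - 1 < m" "k = - int (Suc (nat (- k) - 1))"
    using assms unfolding valid_slot_def by linarith+
  then show thesis by (rule neg)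
qed

lemma coset_rep_closed [simp]:
  assumes "valid_slot m k" "m \<le> n"
  shows "coset_rep m k \<in> carrier H"
  using assms(1)
proof (cases rule: valid_slot_cases)
  case (pos i)
  then show ?thesis using assms by (simp add: coset_rep_pos)
next
  case (neg i)
  then show ?thesis unfolding neg(2) coset_rep_neg using assms by (intro H.m_closed desc_closed HU_closed asc_closed) auto
qed

lemma coset_rep_T_pos: "1 \<le> j \<Longrightarrow> j < m \<Longrightarrow> m \<le> n \<Longrightarrow> coset_rep m (int (Suc j)) \<star> HT j = coset_rep m (int j)"
  using desc_T_end[of j m] by (simp add: coset_rep_pos del: of_nat_Suc)

lemma coset_rep_T_neg: "1 \<le> j \<Longrightarrow> j < m \<Longrightarrow> m \<le> n \<Longrightarrow> coset_rep m (- int j) \<star> HT j = coset_rep m (- int (Suc j))"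
proof -
  assume j: "1 \<le> j" "j < m" "m \<le> n"
  then obtain i where i: "j = Suc i" by (cases j) auto
  then show ?thesis using j unfolding i coset_rep_neg by (simp add: H.m_assoc)
qed

lemma coset_rep_U_one: "1 \<le> m \<Longrightarrow> m \<le> n \<Longrightarrow> coset_rep m 1 \<star> HU = coset_rep m (- 1)"
  by (simp add: coset_rep_def)

lemma quad_tail:
  assumes "y \<star> t = x" "t \<star> t = (sc q \<star> t \<ominus>\<^bsub>H\<^esub> t) \<oplus>\<^bsub>H\<^esub> sc q" "y \<in> carrier H" "t \<in> carrier H"
  shows "x \<star> t = (sc q \<star> x \<ominus>\<^bsub>H\<^esub> x) \<oplus>\<^bsub>H\<^esub> sc q \<star> y"
proof -
  have "x \<star> t = y \<star> (t \<star> t)" unfolding assms(1)[symmetric] using assms(3,4) by (simp add: H.m_assoc)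
  also have "\<dots> = (y \<star> sc q \<star> t \<ominus>\<^bsub>H\<^esub> y \<star> t) \<oplus>\<^bsub>H\<^esub> y \<star> sc q"
    using assms(2-) by (simp add: a_minus_def H.r_distr H.r_minus H.m_assoc)
  also have "y \<star> sc q = sc q \<star> y" using assms by (simp add: sc_comm)
  finally show ?thesis using assms H.m_assoc[of "sc q" y t] by simp
qed

lemma coset_rep_T_less:
  assumes "valid_slot m k" "\<bar>k\<bar> < int j" "j < m" "m \<le> n"
  shows "coset_rep m k \<star> HT j = HT (j - 1) \<star> coset_rep m k"
  using assms(1)
proof (cases rule: valid_slot_cases)
  case (pos i)
  then show ?thesis using assms desc_T_shift[of i j m] by (simp add: coset_rep_pos)
next
  case (neg i)
  have j: "Suc i < j" using assms neg by simp
  show ?thesis unfolding neg(2) coset_rep_neg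
    using assms j H_UT_comm[of j]
    by (intro mult_shift[OF asc_T_comm mult_shift[OF _ desc_T_shift]]) auto
qed

text \<open>For b_k the ascending part raises the index of T_j to j + 1, U lets it pass, and the
  descending part lowers it back to j.\<close>

lemma coset_rep_T_greater:
  assumes "valid_slot m k" "int j + 1 < \<bar>k\<bar>" "1 \<le> j" "m \<le> n"
  shows "coset_rep m k \<star> HT j = HT j \<star> coset_rep m k"
  using assms(1)
proof (cases rule: valid_slot_cases)
  case (pos i)
  then show ?thesis using assms desc_T_comm[of i m j] by (simp add: coset_rep_pos)
next
  case (neg i)
  have j: "j < i" using assms neg by simp
  have 1: "HU \<star> HT (Suc j) = HT (Suc j) \<star> HU" using assms j neg H_UT_comm[of "Suc j"] by simp
  have 2: "desc m 1 \<star> HT (Suc j) = HT j \<star> desc m 1"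
    using assms j neg desc_T_shift[of 1 "Suc j" m] by simp
  have 3: "asc i \<star> HT j = HT (Suc j) \<star> asc i"
    using assms j neg by (intro asc_T_shift) auto
  show ?thesis unfolding neg(2) coset_rep_neg
    using assms j neg by (intro mult_shift[OF 3 mult_shift[OF 1 2]]) auto
qed

lemma coset_rep_U:
  assumes "valid_slot m k" "1 < \<bar>k\<bar>" "m \<le> n"
  shows "coset_rep m k \<star> HU = HU \<star> coset_rep m k"
  using assms(1)
proof (cases rule: valid_slot_cases)
  case (pos i)
  then show ?thesis using assms desc_U_comm[of i m] by (simp add: coset_rep_pos)
next
  case (neg i)
  have i: "1 \<le> i" "2 \<le> m" "2 \<le> n" using assms neg by auto
  have c: "desc m 2 \<in> carrier H" "HT 1 \<in> carrier H" "HU \<in> carrier H" "asc i \<in> carrier H" using assms neg i by auto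
  have t: "desc m 1 = desc m 2 \<star> HT 1" using desc_T_end[of 1 m] i assms by (simp add: numeral_2_eq_2)
  have "coset_rep m k \<star> HU = desc m 2 \<star> (HT 1 \<star> (HU \<star> (asc i \<star> HU)))"
    unfolding neg(2) coset_rep_neg t using c by (simp add: H.m_assoc)
  also have "\<dots> = desc m 2 \<star> HU \<star> (HT 1 \<star> (HU \<star> asc i))"
    using c T_U_asc_U[of i] i neg assms by (simp add: H.m_assoc)
  also have "desc m 2 \<star> HU = HU \<star> desc m 2" using i assms by (intro desc_U_comm) auto
  finally show ?thesis unfolding neg(2) coset_rep_neg t using c by (simp add: H.m_assoc)
qed

section \<open>The Hecke algebra as a retract of the iterated module\<close>

text \<open>
  The maps \<open>phi\<close> and \<open>Psi\<close> (below) exhibit \<open>HB\<^sub>n\<close> as a direct summand of the iterated module, which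
  is all that is needed to transport exactness.
\<close>

primrec phi :: "nat \<Rightarrow> ((nat \<Rightarrow> int) \<Rightarrow> 'a \<Rightarrow>\<^sub>0 int) \<Rightarrow> (hb_gen list \<Rightarrow> 'a) set" where
  "phi 0 f = sc (ev (f (\<lambda>_. 0)))"
| "phi (Suc m) f = (\<Oplus>\<^bsub>H\<^esub>k\<in>{k. valid_slot (Suc m) k}. phi m (slot k f) \<star> coset_rep (Suc m) k)"

lemma finite_slots [simp]: "finite {k. valid_slot m k}"
  by (rule finite_subset[of _ "{- int m..int m}"]) (auto simp: valid_slot_def)

lemma phi_closed [simp]: "m \<le> n \<Longrightarrow> phi m f \<in> carrier H"
  by (induction m arbitrary: f) (auto intro!: H.finsum_closed)

lemma phi_add: "m \<le> n \<Longrightarrow> phi m (f + g) = phi m f \<oplus>\<^bsub>H\<^esub> phi m g"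
proof (induction m arbitrary: f g)
  case (Suc m)
  let ?V = "{k. valid_slot (Suc m) k}"
  have "phi (Suc m) (f + g) = (\<Oplus>\<^bsub>H\<^esub>k\<in>?V. phi m (slot k f) \<star> coset_rep (Suc m) k \<oplus>\<^bsub>H\<^esub> phi m (slot k g) \<star> coset_rep (Suc m) k)"
    unfolding phi.simps using Suc by (intro H.finsum_cong') (auto simp: H.l_distr)
  then show ?case using Suc.prems by (subst (asm) H.finsum_addf) auto
qed (simp add: ev_add sc_add plus_fun_apply)

lemma phi_zero: "m \<le> n \<Longrightarrow> phi m 0 = \<zero>\<^bsub>H\<^esub>"
  using phi_add[of m 0 0] by (metis H.r_zero H.add.l_cancel H.zero_closed add_0_left phi_closed)

lemma phi_minus: "m \<le> n \<Longrightarrow> phi m (- f) = \<ominus>\<^bsub>H\<^esub> phi m f"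
  using phi_add[of m "- f" f] by (simp add: phi_zero H.minus_equality)

lemma phi_diff: "m \<le> n \<Longrightarrow> phi m (f - g) = phi m f \<ominus>\<^bsub>H\<^esub> phi m g"
  using phi_add[of m f "- g"] by (simp add: phi_minus a_minus_def)

lemma phi_Sc: "m \<le> n \<Longrightarrow> c \<in> carrier R \<Longrightarrow> phi m (Sc c f) = sc c \<star> phi m f"
proof (induction m arbitrary: f)
  case 0
  then show ?case by (simp add: Sc_apply ev_scal m_comm flip: sc_mult)
next
  case (Suc m)
  let ?V = "{k. valid_slot (Suc m) k}"
  have "phi (Suc m) (Sc c f) = (\<Oplus>\<^bsub>H\<^esub>k\<in>?V. sc c \<star> (phi m (slot k f) \<star> coset_rep (Suc m) k))"
    unfolding phi.simps using Suc by (intro H.finsum_cong') (auto simp: slot_Sc H.m_assoc)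
  then show ?case using Suc.prems by (subst (asm) H.finsum_rdistr[symmetric]) auto
qed

lemma phi_Z: "m \<le> n \<Longrightarrow> f \<in> rep_Z m \<Longrightarrow> phi m f = \<zero>\<^bsub>H\<^esub>"
proof (induction m arbitrary: f)
  case 0
  then show ?case by (simp add: sc_zero)
next
  case (Suc m)
  then have "phi m (slot k f) \<star> coset_rep (Suc m) k = \<zero>\<^bsub>H\<^esub>" if "valid_slot (Suc m) k" for k
    using that by (simp add: ind_Z_def)
  then show ?case by (auto intro!: H.add.finprod_one_eqI)
qed


lemma phi_slot_in:
  assumes "valid_slot (Suc m) k" "Suc m \<le> n"
  shows "phi (Suc m) (slot_in k y) = phi m y \<star> coset_rep (Suc m) k"
proof -
  have "phi (Suc m) (slot_in k y) = (\<Oplus>\<^bsub>H\<^esub>l\<in>{l. valid_slot (Suc m) l}. if k = l then phi m y \<star> coset_rep (Suc m) l else \<zero>\<^bsub>H\<^esub>)"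
    unfolding phi.simps using assms by (intro H.finsum_cong') (auto simp: slot_slot_in phi_zero)
  also have "\<dots> = phi m y \<star> coset_rep (Suc m) k"
    using assms by (intro H.add.finprod_singleton) auto
  finally show ?thesis .
qed

text \<open>Up to \<open>rep_Z\<close>, which both sides send to zero, every element is a sum of
  elements concentrated in one slot, so the identity need only be checked on these.\<close>

lemma phi_intertwines:
  assumes m: "Suc m \<le> n" and x: "x \<in> carrier H" and op: "additive_map op"
    and op_Z: "\<And>f. f \<in> rep_Z (Suc m) \<Longrightarrow> op f \<in> rep_Z (Suc m)"
    and E: "\<And>k y. valid_slot (Suc m) k \<Longrightarrow>
      phi (Suc m) (op (slot_in k y)) = phi m y \<star> (coset_rep (Suc m) k \<star> x)"
  shows "phi (Suc m) (op f) = phi (Suc m) f \<star> x"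
proof -
  interpret hb_slots m "Sc q" Qi "rep_u m" "rep_t m" "rep_Z m" by (rule rep_module)
  let ?V = "{k. valid_slot (Suc m) k}"
  define S where "S = {f. phi (Suc m) (op f) = phi (Suc m) f \<star> x}"
  have S_add: "f + g \<in> S" if "f \<in> S" "g \<in> S" for f g
    using that m x by (simp add: S_def additive_map_add[OF op] phi_add H.l_distr del: phi.simps)
  have S_Z: "f \<in> S" if "f \<in> rep_Z (Suc m)" for f
    using that m x op_Z[of f] by (simp add: S_def phi_Z del: phi.simps rep_Z.simps)
  have S_E: "slot_in k y \<in> S" if "valid_slot (Suc m) k" for k y
    using that m x by (simp add: S_def E phi_slot_in H.m_assoc del: phi.simps)
  have S_0: "0 \<in> S" by (rule S_Z) (use W.zero_Z in simp)
  have S_sum: "(\<And>i. i \<in> A \<Longrightarrow> g i \<in> S) \<Longrightarrow> sum g A \<in> S" for g and A :: "int set"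
    by (induction A rule: infinite_finite_induct) (auto intro: S_add S_0)
  let ?r = "f - (\<Sum>k\<in>?V. slot_in k (slot k f))"
  have "slot l ?r = 0" if "valid_slot (Suc m) l" for l
    using that by (simp add: slot_sum slot_slot_in sum.delta)
  then have "?r \<in> rep_Z (Suc m)" by (simp add: ind_Z_def zero_Z)
  then have "?r + (\<Sum>k\<in>?V. slot_in k (slot k f)) \<in> S"
    by (intro S_add S_Z S_sum S_E) auto
  then show ?thesis by (simp add: S_def)
qed

lemma distrib_quad:
  assumes "y \<in> carrier H" "a \<in> carrier H" "b \<in> carrier H"
  shows "y \<star> ((sc q \<star> a \<ominus>\<^bsub>H\<^esub> a) \<oplus>\<^bsub>H\<^esub> sc q \<star> b)
    = (sc q \<star> (y \<star> a) \<ominus>\<^bsub>H\<^esub> y \<star> a) \<oplus>\<^bsub>H\<^esub> sc q \<star> (y \<star> b)"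
proof -
  have "y \<star> (sc q \<star> z) = sc q \<star> (y \<star> z)" if "z \<in> carrier H" for z
    using that assms(1) sc_comm[of q y] by (simp flip: H.m_assoc)
  then show ?thesis using assms by (simp add: a_minus_def H.r_distr H.r_minus)
qed

text \<open>The induced operators imitate the products \<open>coset_rep m k\<close> times a
  generator, so each case pairs a slot formula with the corresponding exchange rule in H. The
  induction hypothesis is used where the generator passes to the coefficient.\<close>

lemma phi_ops:
  "m \<le> n \<Longrightarrow> (\<forall>j f. 1 \<le> j \<longrightarrow> j < m \<longrightarrow> phi m (rep_t m j f) = phi m f \<star> HT j)
    \<and> (\<forall>f. 1 \<le> m \<longrightarrow> phi m (rep_u m f) = phi m f \<star> HU)"
proof (induction m)
  case (Suc m)
  interpret hb_slots m "Sc q" Qi "rep_u m" "rep_t m" "rep_Z m" by (rule rep_module)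
  have mn: "Suc m \<le> n" and n: "m \<le> n" using Suc.prems by auto
  have IHt: "phi m (rep_t m j y) = phi m y \<star> HT j" if "1 \<le> j" "j < m" for j y using Suc.IH n that by blast
  have IHu: "phi m (rep_u m y) = phi m y \<star> HU" if "1 \<le> m" for y using Suc.IH n that by blast
  have quad: "phi (Suc m) (Sc q (slot_in k y) - slot_in k y + Sc q (slot_in l y)) = phi m y \<star> (coset_rep (Suc m) k \<star> x)"
    if k: "valid_slot (Suc m) k" "valid_slot (Suc m) l"
      and x: "x \<in> carrier H" "x \<star> x = (sc q \<star> x \<ominus>\<^bsub>H\<^esub> x) \<oplus>\<^bsub>H\<^esub> sc q" "coset_rep (Suc m) l \<star> x = coset_rep (Suc m) k" for k l x y
  proof -
    have "coset_rep (Suc m) k \<star> x = (sc q \<star> coset_rep (Suc m) k \<ominus>\<^bsub>H\<^esub> coset_rep (Suc m) k) \<oplus>\<^bsub>H\<^esub> sc q \<star> coset_rep (Suc m) l"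
      using quad_tail[OF x(3,2)] x(1) k mn by simp
    then show ?thesis using k mn n
      by (simp add: phi_add phi_diff phi_Sc phi_slot_in distrib_quad del: phi.simps)
  qed
  have "phi (Suc m) (rep_t (Suc m) j f) = phi (Suc m) f \<star> HT j" if j: "1 \<le> j" "j < Suc m" for j f
  proof (rule phi_intertwines[OF mn])
    show "HT j \<in> carrier H" using j mn by simp
    show "additive_map (rep_t (Suc m) j)" using W.t_additive by simp
    show "rep_t (Suc m) j f \<in> rep_Z (Suc m)" if "f \<in> rep_Z (Suc m)" for f
      using W.t_Z[of j f] j that by simp
    fix k y
    assume k: "valid_slot (Suc m) k"
    have v: "valid_slot (Suc m) (int j)" "valid_slot (Suc m) (int j + 1)" "valid_slot (Suc m) (- int j)" "valid_slot (Suc m) (- int j - 1)"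
      using j by (auto simp: valid_slot_def)
    have jn: "j < n" "j \<le> m" using j mn by auto
    have rpos: "coset_rep (Suc m) (int j + 1) \<star> HT j = coset_rep (Suc m) (int j)"
      using coset_rep_T_pos[of j "Suc m"] j mn by (simp add: add.commute)
    have rneg: "coset_rep (Suc m) (- int j) \<star> HT j = coset_rep (Suc m) (- int j - 1)"
      using coset_rep_T_neg[of j "Suc m"] j mn by (simp add: minus_int_diff_one)
    consider "k = int j + 1" | "k = int j" | "k = - int j" | "k = - int j - 1"
      | "\<bar>k\<bar> < int j" | "int j + 1 < \<bar>k\<bar>" by linarith
    then show "phi (Suc m) (rep_t (Suc m) j (slot_in k y)) = phi m y \<star> (coset_rep (Suc m) k \<star> HT j)"
    proof cases
      case 1
      then show ?thesis using T_E_pos[of j y] j jn v mn rpos by (simp add: phi_slot_in del: phi.simps)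
    next
      case 2
      \<comment> \<open>Slot \<open>j\<close> is the image of slot \<open>j + 1\<close> under
        \<open>T j\<close>, so the quadratic relation replaces a direct computation, in the module
        as in H.\<close>
      have "T j (E (int j) y) = T j (T j (E (int j + 1) y))" using T_E_pos[of j y] j jn by simp
      also have "\<dots> = Sc q (E (int j) y) - E (int j) y + Sc q (E (int j + 1) y)"
        using T_quad[of j "E (int j + 1) y"] T_E_pos[of j y] j jn by simp
      finally show ?thesis unfolding 2 rep_t.simps
        using quad[OF v(1,2) _ _ rpos] j jn H_T_quad[of j] by simp
    next
      case 3
      then show ?thesis using T_E_neg[of j y] j jn v mn rneg by (simp add: phi_slot_in del: phi.simps)
    next
      case 4
      have "T j (E (- int j - 1) y) = T j (T j (E (- int j) y))" using T_E_neg[of j y] j jn by simp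
      also have "\<dots> = Sc q (E (- int j - 1) y) - E (- int j - 1) y + Sc q (E (- int j) y)"
        using T_quad[of j "E (- int j) y"] T_E_neg[of j y] j jn by simp
      finally show ?thesis unfolding 4 rep_t.simps
        using quad[OF v(4,3) _ _ rneg] j jn H_T_quad[of j] by simp
    next
      case 5
      have b: "1 \<le> j - 1" "j - 1 < m" using 5 k j by (auto simp: valid_slot_def)
      have "phi (Suc m) (T j (E k y)) = phi m y \<star> HT (j - 1) \<star> coset_rep (Suc m) k"
        using T_E_lt[OF k 5] IHt[OF b] k mn by (simp add: phi_slot_in del: phi.simps)
      then show ?thesis using coset_rep_T_less[OF k 5 j(2) mn] b k mn by (simp add: H.m_assoc del: phi.simps)
    next
      case 6
      have b: "j < m" using 6 k by (auto simp: valid_slot_def)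
      have "phi (Suc m) (T j (E k y)) = phi m y \<star> HT j \<star> coset_rep (Suc m) k"
        using T_E_gt[OF k 6] IHt[OF j(1) b] k mn by (simp add: phi_slot_in del: phi.simps)
      then show ?thesis using coset_rep_T_greater[OF k 6 j(1) mn] j jn k mn by (simp add: H.m_assoc del: phi.simps)
    qed
  qed
  moreover have "phi (Suc m) (rep_u (Suc m) f) = phi (Suc m) f \<star> HU" for f
  proof (rule phi_intertwines[OF mn])
    show HU: "HU \<in> carrier H" using mn by simp
    show "additive_map (rep_u (Suc m))" using W.u_additive by simp
    show "rep_u (Suc m) f \<in> rep_Z (Suc m)" if "f \<in> rep_Z (Suc m)" for f
      using W.u_Z[of f] that by simp
    fix k y
    assume k: "valid_slot (Suc m) k"
    have v: "valid_slot (Suc m) 1" "valid_slot (Suc m) (-1)" by (auto simp: valid_slot_def)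
    have r1: "coset_rep (Suc m) 1 \<star> HU = coset_rep (Suc m) (-1)" using coset_rep_U_one mn by simp
    consider "k = 1" | "k = -1" | "1 < \<bar>k\<bar>" using k unfolding valid_slot_def by linarith
    then show "phi (Suc m) (rep_u (Suc m) (slot_in k y)) = phi m y \<star> (coset_rep (Suc m) k \<star> HU)"
    proof cases
      case 1
      then show ?thesis using U_E_one[of y] v mn r1 by (simp add: phi_slot_in del: phi.simps)
    next
      case 2
      have "U (E (- 1) y) = U (U (E 1 y))" using U_E_one[of y] by simp
      also have "\<dots> = Sc q (E (- 1) y) - E (- 1) y + Sc q (E 1 y)"
        using U_quad[of "E 1 y"] U_E_one[of y] by simp
      finally show ?thesis unfolding 2 rep_u.simps
        using quad[OF v(2,1) HU _ r1] mn H_U_quad by simp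
    next
      case 3
      have b: "1 \<le> m" using 3 k by (auto simp: valid_slot_def)
      have "phi (Suc m) (U (E k y)) = phi m y \<star> HU \<star> coset_rep (Suc m) k"
        using U_E[OF k 3] IHu[OF b] k mn by (simp add: phi_slot_in del: phi.simps)
      then show ?thesis using coset_rep_U[OF k 3 mn] HU k mn by (simp add: H.m_assoc del: phi.simps)
    qed
  qed
  ultimately show ?case by blast
qed simp

lemma phi_t: "1 \<le> j \<Longrightarrow> j < n \<Longrightarrow> phi n (rep_t n j f) = phi n f \<star> HT j"
  and phi_u: "1 \<le> n \<Longrightarrow> phi n (rep_u n f) = phi n f \<star> HU"
  using phi_ops[of n] by blast+

end

lemma additive_map_sum: "additive_map h \<Longrightarrow> h (sum f A) = (\<Sum>a\<in>A. h (f a))"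
  by (induction A rule: infinite_finite_induct) (simp_all add: additive_map_simps)

context hb_ring
begin

sublocale V: hb_slots n "Sc q" Qi "rep_u n" "rep_t n" "rep_Z n"
  by (rule rep_module)

primrec gen_op :: "hb_gen \<Rightarrow> ('a \<Rightarrow>\<^sub>0 int) op" where
  "gen_op GenU = rep_u n"
| "gen_op (GenT j) = rep_t n j"

lemma gens_cases:
  assumes "g \<in> hb_gens m"
  obtains "1 \<le> m" "g = GenU" | j where "1 \<le> j" "j < m" "g = GenT j"
  using assms by (auto simp: hb_gens_def split: if_splits)

lemma gens_mono: "m \<le> m' \<Longrightarrow> hb_gens m \<subseteq> hb_gens m'"
  by (auto simp: hb_gens_def)

lemma gen_op_additive: "additive_map (gen_op g)"
  using V.u_additive V.t_additive by (cases g) simp_all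

lemma gen_op_Z: "g \<in> hb_gens n \<Longrightarrow> f \<in> rep_Z n \<Longrightarrow> gen_op g f \<in> rep_Z n"
  by (erule gens_cases) (simp_all add: V.u_Z V.t_Z)

lemma phi_gen_op: "g \<in> hb_gens n \<Longrightarrow> phi n (gen_op g f) = phi n f \<star> hgen g"
  by (erule gens_cases) (simp_all add: phi_u phi_t HT_hgen)

lemma Sc_unslot: "Sc c (unslot g) = unslot (\<lambda>k. Sc c (g k))"
  by (simp add: Sc_def unslot_def)

lemma Sc_comm: "c \<in> carrier R \<Longrightarrow> d \<in> carrier R \<Longrightarrow> Sc c (Sc d f) = Sc d (Sc c f)"
  by (simp add: Sc_Sc m_comm)

lemmas Sc_simps = additive_map_simps[OF Sc_additive]

lemma rep_Sc:
  assumes "c \<in> carrier R"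
  shows "rep_u m (Sc c f) = Sc c (rep_u m f)" "rep_t m j (Sc c f) = Sc c (rep_t m j f)"
proof (induction m arbitrary: f j)
  case 0
  case 1 show ?case using assms by (simp add: Sc_comm)
  case 2 show ?case using assms by (simp add: Sc_comm)
next
  case (Suc m)
  case 1 show ?case
    unfolding rep_u.simps ind_u_def Sc_unslot slot_Sc if_distrib[of "Sc c"] Sc_simps Suc.IH Sc_comm[OF assms q_closed(1)] ..
  case 2 show ?case
    unfolding rep_t.simps ind_t_def Sc_unslot slot_Sc if_distrib[of "Sc c"] Sc_simps Suc.IH Sc_comm[OF assms q_closed(1)] ..
qed

lemma gen_op_Sc: "c \<in> carrier R \<Longrightarrow> gen_op g (Sc c f) = Sc c (gen_op g f)"
  by (cases g) (simp_all add: rep_Sc)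

text \<open>Represents r times the unit element: at level m the unit is the representative
  a_m.\<close>

primrec base :: "nat \<Rightarrow> 'a \<Rightarrow> (nat \<Rightarrow> int) \<Rightarrow> 'a \<Rightarrow>\<^sub>0 int" where
  "base 0 r = (\<lambda>_. frag_of r)"
| "base (Suc m) r = slot_in (int (Suc m)) (base m r)"

lemma phi_base: "r \<in> carrier R \<Longrightarrow> m \<le> n \<Longrightarrow> phi m (base m r) = sc r"
proof (induction m)
  case 0
  then show ?case by (simp add: ev_frag_of)
next
  case (Suc m)
  have "coset_rep (Suc m) (int (Suc m)) = \<one>\<^bsub>H\<^esub>" by (subst coset_rep_pos) simp_all
  moreover have "valid_slot (Suc m) (int (Suc m))" by (simp add: valid_slot_def)
  ultimately show ?case using Suc phi_slot_in[of m "int (Suc m)" "base m r"] by (simp del: phi.simps of_nat_Suc)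
qed

lemma base_Z: "r \<in> carrier R \<Longrightarrow> s \<in> carrier R \<Longrightarrow> base m (r \<oplus> s) - base m r - base m s \<in> rep_Z m"
proof (induction m)
  case 0
  then show ?case using r_neg[of "r \<oplus> s"]
    by (simp add: minus_apply ev_diff ev_frag_of a_minus_def minus_add a_assoc)
next
  case (Suc m)
  interpret hb_slots m "Sc q" Qi "rep_u m" "rep_t m" "rep_Z m" by (rule rep_module)
  show ?case using E_Z[OF Suc.IH[OF Suc.prems]] by (simp add: E_simps del: of_nat_Suc)
qed

lemma base_zero_Z: "base m \<zero> \<in> rep_Z m"
proof (induction m)
  case 0
  then show ?case by (simp add: ev_frag_of)
next
  case (Suc m)
  interpret hb_slots m "Sc q" Qi "rep_u m" "rep_t m" "rep_Z m" by (rule rep_module)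
  show ?case using E_Z[OF Suc.IH] by (simp del: of_nat_Suc)
qed

lemma Sc_base: "r \<in> carrier R \<Longrightarrow> Sc c (base m r) = base m (r \<otimes> c)"
proof (induction m)
  case 0
  then show ?case by (simp add: Sc_def scal_simps)
next
  case (Suc m)
  have "Sc c (slot_in k y) = slot_in k (Sc c y)" for k y
    by (rule slot_ext) (simp add: slot_Sc slot_slot_in Sc_simps)
  then show ?case using Suc by (simp del: of_nat_Suc)
qed

definition zeq :: "((nat \<Rightarrow> int) \<Rightarrow> 'a \<Rightarrow>\<^sub>0 int) \<Rightarrow> ((nat \<Rightarrow> int) \<Rightarrow> 'a \<Rightarrow>\<^sub>0 int) \<Rightarrow> bool" (infix "\<doteq>" 50) where
  "x \<doteq> y \<longleftrightarrow> x - y \<in> rep_Z n"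

lemma Z_minus: "x \<in> rep_Z n \<Longrightarrow> - x \<in> rep_Z n"
  using V.diff_Z[OF V.zero_Z] by force

lemma Z_add: "x \<in> rep_Z n \<Longrightarrow> y \<in> rep_Z n \<Longrightarrow> x + y \<in> rep_Z n"
  using V.diff_Z[OF _ Z_minus] by force

lemma Z_sum: "(\<And>i. i \<in> A \<Longrightarrow> f i \<in> rep_Z n) \<Longrightarrow> sum f A \<in> rep_Z n"
  by (induction A rule: infinite_finite_induct) (auto intro: V.zero_Z Z_add)

lemma zeq_refl [simp]: "x \<doteq> x"
  by (simp add: zeq_def V.zero_Z)

lemma zeq_sym: "x \<doteq> y \<Longrightarrow> y \<doteq> x"
  using Z_minus[of "x - y"] by (simp add: zeq_def)

lemma zeq_trans [trans]: "x \<doteq> y \<Longrightarrow> y \<doteq> z \<Longrightarrow> x \<doteq> z"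
  using Z_add[of "x - y" "y - z"] by (simp add: zeq_def)

lemma zeq_add: "x \<doteq> y \<Longrightarrow> x' \<doteq> y' \<Longrightarrow> x + x' \<doteq> y + y'"
  using Z_add[of "x - y" "x' - y'"] by (simp add: zeq_def algebra_simps)

lemma zeq_diff: "x \<doteq> y \<Longrightarrow> x' \<doteq> y' \<Longrightarrow> x - x' \<doteq> y - y'"
  using V.diff_Z[of "x - y" "x' - y'"] by (simp add: zeq_def algebra_simps)

lemma zeq_gen_op: "x \<doteq> y \<Longrightarrow> g \<in> hb_gens n \<Longrightarrow> gen_op g x \<doteq> gen_op g y"
  using gen_op_Z[of g "x - y"] by (simp add: zeq_def additive_map_diff[OF gen_op_additive])

lemma zeq_Q: "x \<doteq> y \<Longrightarrow> Sc q x \<doteq> Sc q y"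
  using V.Q_Z[of "x - y"] by (simp add: zeq_def V.op_simps)

lemma zeq_Qi: "x \<doteq> y \<Longrightarrow> Qi x \<doteq> Qi y"
  using V.Qi_Z[of "x - y"] by (simp add: zeq_def V.op_simps)

lemma zeq_Z: "x \<doteq> y \<Longrightarrow> y \<in> rep_Z n \<Longrightarrow> x \<in> rep_Z n"
  using Z_add[of "x - y" y] by (simp add: zeq_def)

lemma zeq_J: "x \<doteq> y \<Longrightarrow> y \<in> V.Aug m \<Longrightarrow> x \<in> V.Aug m"
  using V.Aug_add[OF V.Aug_Z, of "x - y" y] by (simp add: zeq_def)

definition act :: "hb_gen list \<Rightarrow> ('a \<Rightarrow>\<^sub>0 int) op" where
  "act w = fold gen_op w"

lemma act_snoc [simp]: "act (w @ [g]) f = gen_op g (act w f)"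
  by (simp add: act_def)

lemma act_Nil [simp]: "act [] f = f"
  by (simp add: act_def)

lemma act_additive: "additive_map (act w)"
  unfolding additive_map_def
  by (induction w rule: rev_induct) (simp_all add: additive_map_simps[OF gen_op_additive])

lemma act_Z: "w \<in> lists (hb_gens n) \<Longrightarrow> f \<in> rep_Z n \<Longrightarrow> act w f \<in> rep_Z n"
  by (induction w rule: rev_induct) (auto intro: gen_op_Z)

lemma act_Sc: "c \<in> carrier R \<Longrightarrow> act w (Sc c f) = Sc c (act w f)"
  by (induction w rule: rev_induct) (simp_all add: gen_op_Sc)

text \<open>The orbit map of the unit vector: each word acts through its letters from left to right,
  which is the right action.\<close>

definition Psi :: "(hb_gen list \<Rightarrow> 'a) \<Rightarrow> (nat \<Rightarrow> int) \<Rightarrow> 'a \<Rightarrow>\<^sub>0 int" where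
  "Psi f = (\<Sum>w | f w \<noteq> \<zero>. act w (base n (f w)))"

text \<open>Only a congruence, since \<open>base n \<zero>\<close> is a formal sum that represents
  zero without being zero.\<close>

lemma Psi_superset:
  assumes "finite S" "{w. f w \<noteq> \<zero>} \<subseteq> S" "S \<subseteq> lists (hb_gens n)"
  shows "Psi f \<doteq> (\<Sum>w\<in>S. act w (base n (f w)))"
proof -
  have "(\<Sum>w\<in>S. act w (base n (f w))) = (\<Sum>w\<in>S - {w. f w \<noteq> \<zero>}. act w (base n (f w))) + Psi f"
    unfolding Psi_def by (rule sum.subset_diff[OF assms(2,1)])
  moreover have "(\<Sum>w\<in>S - {w. f w \<noteq> \<zero>}. act w (base n (f w))) \<in> rep_Z n"
    using assms(3) by (intro Z_sum act_Z) (auto simp: base_zero_Z)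
  ultimately show ?thesis using Z_minus by (simp add: zeq_def)
qed

lemma support: "f \<in> carrier F \<Longrightarrow> finite {w. f w \<noteq> \<zero>}" "f \<in> carrier F \<Longrightarrow> {w. f w \<noteq> \<zero>} \<subseteq> lists (hb_gens n)"
  unfolding free_algebra_carrier by blast+

lemma Psi_add:
  assumes f: "f \<in> carrier F" and g: "g \<in> carrier F"
  shows "Psi (f \<oplus>\<^bsub>F\<^esub> g) \<doteq> Psi f + Psi g"
proof -
  let ?S = "{w. f w \<noteq> \<zero>} \<union> {w. g w \<noteq> \<zero>}"
  have S: "finite ?S" "?S \<subseteq> lists (hb_gens n)" using support[OF f] support[OF g] by auto
  have "Psi (f \<oplus>\<^bsub>F\<^esub> g) \<doteq> (\<Sum>w\<in>?S. act w (base n ((f \<oplus>\<^bsub>F\<^esub> g) w)))"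
    using S by (intro Psi_superset) (auto simp: free_algebra_simps)
  also have "\<dots> \<doteq> (\<Sum>w\<in>?S. act w (base n (f w)) + act w (base n (g w)))"
  proof -
    have "act w (base n ((f \<oplus>\<^bsub>F\<^esub> g) w) - base n (f w) - base n (g w)) \<in> rep_Z n" if "w \<in> ?S" for w
      using that S(2) f g F_closed by (intro act_Z) (auto simp: free_algebra_simps base_Z)
    then show ?thesis
      unfolding zeq_def sum_subtractf[symmetric]
      by (intro Z_sum) (simp add: additive_map_simps[OF act_additive] algebra_simps)
  qed
  also have "\<dots> \<doteq> Psi f + Psi g"
    unfolding sum.distrib using S by (intro zeq_add zeq_sym[OF Psi_superset]) auto
  finally show ?thesis .
qed

lemma Psi_gen:
  assumes f: "f \<in> carrier F" and g: "g \<in> hb_gens n"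
  shows "Psi (f \<bullet> gen g) = gen_op g (Psi f)"
proof -
  have "{w. (f \<bullet> gen g) w \<noteq> \<zero>} = (\<lambda>w. w @ [g]) ` {w. f w \<noteq> \<zero>}" (is "?L = ?R")
  proof
    show "?L \<subseteq> ?R"
    proof
      fix w assume "w \<in> ?L"
      then show "w \<in> ?R" using f g by (cases w rule: rev_cases) (auto simp: mult_gen split: if_splits)
    qed
    show "?R \<subseteq> ?L" using f g by (auto simp: mult_gen)
  qed
  then have "Psi (f \<bullet> gen g) = (\<Sum>w | f w \<noteq> \<zero>. act (w @ [g]) (base n ((f \<bullet> gen g) (w @ [g]))))"
    unfolding Psi_def by (simp add: sum.reindex inj_on_def del: act_snoc)
  also have "\<dots> = gen_op g (Psi f)"
    unfolding Psi_def using f g by (simp add: mult_gen additive_map_sum[OF gen_op_additive])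
  finally show ?thesis .
qed

lemma Psi_scalar:
  assumes f: "f \<in> carrier F" and c: "c \<in> carrier R"
  shows "Psi (f \<bullet> sF c) \<doteq> Sc c (Psi f)"
proof -
  have "Psi (f \<bullet> sF c) \<doteq> (\<Sum>w | f w \<noteq> \<zero>. act w (base n ((f \<bullet> sF c) w)))"
    using support[OF f] c by (intro Psi_superset) (auto simp: mult_sF[OF f c])
  also have "(\<Sum>w | f w \<noteq> \<zero>. act w (base n ((f \<bullet> sF c) w))) = Sc c (Psi f)"
    unfolding Psi_def using f c F_closed[OF f]
    by (simp add: mult_sF additive_map_sum[OF Sc_additive] flip: Sc_base act_Sc)
  finally show ?thesis .
qed

lemma Psi_sF: "c \<in> carrier R \<Longrightarrow> Psi (sF c) \<doteq> base n c"
proof -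
  assume c: "c \<in> carrier R"
  then have "Psi (sF c) \<doteq> (\<Sum>w\<in>{[]}. act w (base n (sF c w)))"
    by (intro Psi_superset) (auto simp: sF_eq split: if_splits)
  then show ?thesis using c by (simp add: sF_eq)
qed

lemma Psi_zero: "Psi \<zero>\<^bsub>F\<^esub> = 0"
  by (simp add: Psi_def free_algebra_simps)

lemma Psi_diff:
  assumes f: "f \<in> carrier F" and g: "g \<in> carrier F"
  shows "Psi (f \<ominus>\<^bsub>F\<^esub> g) \<doteq> Psi f - Psi g"
proof -
  have c: "f \<ominus>\<^bsub>F\<^esub> g \<in> carrier F" by (rule F.minus_closed[OF f g])
  have e: "(f \<ominus>\<^bsub>F\<^esub> g) \<oplus>\<^bsub>F\<^esub> g = f" using f g by (simp add: a_minus_def F.a_assoc F.l_neg)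
  have "Psi f \<doteq> Psi (f \<ominus>\<^bsub>F\<^esub> g) + Psi g" using Psi_add[OF c g] unfolding e .
  from zeq_sym[OF zeq_diff[OF this zeq_refl[of "Psi g"]]] show ?thesis
    by (simp only: add_diff_cancel_right')
qed

lemma Psi_Z_mult:
  assumes "a \<in> carrier F" "h \<in> carrier F" "Psi h \<in> rep_Z n"
  shows "Psi (h \<bullet> a) \<in> rep_Z n"
  using assms(1)
proof (induction rule: F_induct)
  case (scalar c)
  have "Sc c x \<in> rep_Z m" if "x \<in> rep_Z m" for x m
    using that scalar by (induction m arbitrary: x) (auto simp: Sc_apply ev_scal ind_Z_def slot_Sc)
  then show ?case using assms(3) by (intro zeq_Z[OF Psi_scalar[OF assms(2) scalar]])
next
  case (gen f g)
  then show ?case using assms(2) Psi_gen[of "h \<bullet> f" g] gen_op_Z by (simp add: F.m_assoc)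
next
  case (add f g)
  have "Psi (h \<bullet> f \<oplus>\<^bsub>F\<^esub> h \<bullet> g) \<in> rep_Z n"
    using add assms(2) by (intro zeq_Z[OF Psi_add] Z_add) auto
  then show ?case using add assms(2) by (simp add: F.r_distr)
qed

text \<open>\<open>Psi\<close> respects right multiplication only, so its kernel modulo
  \<open>rep_Z\<close> is not visibly an ideal. Demanding that all left multiples also go to zero
  makes closure on the left automatic, and \<open>Psi_Z_mult\<close> gives closure on the right. A
  relator lies in this set because the module satisfies the relation at every vector
  \<open>Psi g\<close>.\<close>

lemma Psi_ideal:
  assumes "f \<in> I"
  shows "Psi f \<in> rep_Z n"
proof -
  let ?N = "{f \<in> carrier F. \<forall>g\<in>carrier F. Psi (g \<bullet> f) \<in> rep_Z n}"
  have N: "ideal ?N F"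
  proof (rule idealI[OF F.ring_axioms])
    show "subgroup ?N (add_monoid F)"
    proof (rule F.add.subgroupI)
      show "?N \<noteq> {}" using V.zero_Z by (auto simp: Psi_zero intro!: exI[of _ "\<zero>\<^bsub>F\<^esub>"])
      fix a b assume a: "a \<in> ?N" and b: "b \<in> ?N"
      have "Psi (g \<bullet> a \<oplus>\<^bsub>F\<^esub> g \<bullet> b) \<in> rep_Z n" if "g \<in> carrier F" for g
        using a b that by (intro zeq_Z[OF Psi_add] Z_add) auto
      then show "a \<oplus>\<^bsub>F\<^esub> b \<in> ?N" using a b by (simp add: F.r_distr)
    next
      fix a assume a: "a \<in> ?N"
      have "Psi (\<zero>\<^bsub>F\<^esub> \<ominus>\<^bsub>F\<^esub> g \<bullet> a) \<in> rep_Z n" if "g \<in> carrier F" for g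
        using a that by (intro zeq_Z[OF Psi_diff] V.diff_Z) (auto simp: Psi_zero V.zero_Z)
      then show "\<ominus>\<^bsub>F\<^esub> a \<in> ?N" using a by (simp add: F.r_minus a_minus_def)
    qed auto
    fix a x assume a: "a \<in> ?N" and x: "x \<in> carrier F"
    show "x \<bullet> a \<in> ?N" using a x by (simp flip: F.m_assoc)
    show "a \<bullet> x \<in> ?N" using a x Psi_Z_mult by (simp flip: F.m_assoc)
  qed
  have rel: "a \<ominus>\<^bsub>F\<^esub> b \<in> ?N" if "a \<in> carrier F" "b \<in> carrier F" "\<And>g. g \<in> carrier F \<Longrightarrow> Psi (g \<bullet> a) = Psi (g \<bullet> b)" for a b
  proof -
    have "Psi (g \<bullet> a \<ominus>\<^bsub>F\<^esub> g \<bullet> b) \<in> rep_Z n" if "g \<in> carrier F" for g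
      using that \<open>a \<in> carrier F\<close> \<open>b \<in> carrier F\<close> \<open>\<And>g. _ \<Longrightarrow> Psi (g \<bullet> a) = _\<close>[OF that] V.zero_Z
      by (intro zeq_Z[OF Psi_diff]) auto
    then show ?thesis using that by (simp add: a_minus_def F.r_distr F.r_minus)
  qed
  have "hb_relators R q n \<subseteq> ?N"
  proof
    fix x assume "x \<in> hb_relators R q n"
    then show "x \<in> ?N"
    proof (cases rule: relators_cases)
      case u_braid
      have c: "gen GenU \<in> carrier F" "gen (GenT 1) \<in> carrier F" and g: "GenU \<in> hb_gens n" "GenT 1 \<in> hb_gens n"
        using u_braid by (intro gen_closed gens_U gens_T1; simp)+
      show ?thesis unfolding u_braid(2)
        using c g V.u_t_braid[OF u_braid(1)]
        by (intro rel F.m_closed) (simp_all add: Psi_gen flip: F.m_assoc)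
    next
      case (u_comm i)
      have c: "gen GenU \<in> carrier F" "gen (GenT i) \<in> carrier F" and g: "GenU \<in> hb_gens n" "GenT i \<in> hb_gens n"
        using u_comm by (intro gen_closed gens_U gens_T; simp)+
      show ?thesis unfolding u_comm(3)
        using c g V.u_t_comm[OF u_comm(1,2)]
        by (intro rel F.m_closed) (simp_all add: Psi_gen flip: F.m_assoc)
    next
      case (t_braid i)
      have c: "gen (GenT (i + 1)) \<in> carrier F" "gen (GenT i) \<in> carrier F" and g: "GenT (i + 1) \<in> hb_gens n" "GenT i \<in> hb_gens n"
        using t_braid by (intro gen_closed gens_T; simp)+
      show ?thesis unfolding t_braid(3)
        using c g V.t_braid[OF t_braid(1,2)]
        by (intro rel F.m_closed) (simp_all add: Psi_gen flip: F.m_assoc)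
    next
      case (t_comm i j)
      have c: "gen (GenT j) \<in> carrier F" "gen (GenT i) \<in> carrier F" and g: "GenT j \<in> hb_gens n" "GenT i \<in> hb_gens n"
        using t_comm by (intro gen_closed gens_T; simp)+
      have "rep_t n j (rep_t n i y) = rep_t n i (rep_t n j y)" for y
        using t_comm V.t_comm[of i j y] V.t_comm[of j i y] by auto
      then show ?thesis unfolding t_comm(6)
        using c g by (intro rel F.m_closed) (simp_all add: Psi_gen flip: F.m_assoc)
    next
      case (quad a)
      let ?a = "gen a"
      have c: "?a \<in> carrier F" "sF q \<in> carrier F" using quad by auto
      have hquad: "gen_op a (gen_op a y) = Sc q (gen_op a y) - gen_op a y + Sc q y" for y
        using quad(1) by (rule gens_cases) (simp_all add: V.u_quad V.t_quad)
      have "Psi (g \<bullet> ((?a \<oplus>\<^bsub>F\<^esub> \<one>\<^bsub>F\<^esub>) \<bullet> (?a \<ominus>\<^bsub>F\<^esub> sF q))) \<in> rep_Z n" if g: "g \<in> carrier F" for g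
      proof -
        let ?h = "g \<bullet> ?a \<oplus>\<^bsub>F\<^esub> g"
        have h: "?h \<in> carrier F" using c g by simp
        have "g \<bullet> ((?a \<oplus>\<^bsub>F\<^esub> \<one>\<^bsub>F\<^esub>) \<bullet> (?a \<ominus>\<^bsub>F\<^esub> sF q)) = ?h \<bullet> (?a \<ominus>\<^bsub>F\<^esub> sF q)"
          using c g by (subst F.m_assoc[symmetric]) (simp_all add: F.r_distr)
        also have "\<dots> = ?h \<bullet> ?a \<ominus>\<^bsub>F\<^esub> ?h \<bullet> sF q"
          using c h by (simp add: a_minus_def F.r_distr F.r_minus)
        finally have e: "g \<bullet> ((?a \<oplus>\<^bsub>F\<^esub> \<one>\<^bsub>F\<^esub>) \<bullet> (?a \<ominus>\<^bsub>F\<^esub> sF q)) = ?h \<bullet> ?a \<ominus>\<^bsub>F\<^esub> ?h \<bullet> sF q" .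
        have Ph: "Psi ?h \<doteq> gen_op a (Psi g) + Psi g"
          using Psi_add[of "g \<bullet> ?a" g] Psi_gen[of g a] c g quad by simp
        have "Psi (?h \<bullet> ?a \<ominus>\<^bsub>F\<^esub> ?h \<bullet> sF q) \<doteq> Psi (?h \<bullet> ?a) - Psi (?h \<bullet> sF q)"
          using c h by (intro Psi_diff) auto
        also have "\<dots> \<doteq> gen_op a (Psi ?h) - Sc q (Psi ?h)"
          using h quad Psi_scalar[OF h q_closed(1)] by (intro zeq_diff) (simp_all add: Psi_gen)
        also have "\<dots> \<doteq> gen_op a (gen_op a (Psi g) + Psi g) - Sc q (gen_op a (Psi g) + Psi g)"
          using Ph quad by (intro zeq_diff zeq_gen_op zeq_Q)
        also have "\<dots> = 0"
          by (simp add: additive_map_simps[OF gen_op_additive] Sc_simps hquad)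
        finally show ?thesis using V.zero_Z unfolding e by (rule zeq_Z)
      qed
      then show ?thesis unfolding quad(2) using c by auto
    qed
  qed
  then have "I \<subseteq> ?N" unfolding hb_ideal_def by (rule F.genideal_minimal[OF N])
  with assms have "f \<in> ?N" by blast
  then have "f \<in> carrier F" "Psi (\<one>\<^bsub>F\<^esub> \<bullet> f) \<in> rep_Z n" by blast+
  then show ?thesis by simp
qed

lemma phi_Psi: "f \<in> carrier F \<Longrightarrow> phi n (Psi f) = cl f"
proof (induction rule: F_induct)
  case (scalar c)
  have "phi n (Psi (sF c) - base n c) = \<zero>\<^bsub>H\<^esub>" using Psi_sF[OF scalar] by (intro phi_Z) (auto simp: zeq_def)
  then show ?case using scalar phi_base[of c n] by (simp add: phi_diff sc_cl)
next
  case (gen f g)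
  then show ?case by (simp add: Psi_gen phi_gen_op)
next
  case (add f g)
  have "phi n (Psi (f \<oplus>\<^bsub>F\<^esub> g) - (Psi f + Psi g)) = \<zero>\<^bsub>H\<^esub>" using Psi_add[OF add.hyps] by (intro phi_Z) (auto simp: zeq_def)
  then show ?case using add by (simp add: phi_diff phi_add)
qed


section \<open>Transport of exactness to the Hecke algebra\<close>

inductive_set AugH :: "nat \<Rightarrow> (hb_gen list \<Rightarrow> 'a) set set" for m where
  AugH_zero: "\<zero>\<^bsub>H\<^esub> \<in> AugH m"
| AugH_gen: "g \<in> hb_gens m \<Longrightarrow> y \<in> carrier H \<Longrightarrow> y \<star> hgen g \<ominus>\<^bsub>H\<^esub> sc q \<star> y \<in> AugH m"
| AugH_diff: "x \<in> AugH m \<Longrightarrow> y \<in> AugH m \<Longrightarrow> x \<ominus>\<^bsub>H\<^esub> y \<in> AugH m"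

lemma AugH_closed: "x \<in> AugH m \<Longrightarrow> m \<le> n \<Longrightarrow> x \<in> carrier H"
proof (induction rule: AugH.induct)
  case (AugH_gen g y)
  then have "g \<in> hb_gens n" using gens_mono by blast
  then show ?case using AugH_gen by (intro H.minus_closed H.m_closed cl_closed gen_closed sc_closed q_closed)
qed auto

lemma phi_J: "f \<in> V.Aug m \<Longrightarrow> m \<le> n \<Longrightarrow> phi n f \<in> AugH m"
proof (induction rule: V.Aug.induct)
  case (Aug_Z f)
  then show ?case by (simp add: phi_Z AugH_zero)
next
  case (Aug_u f)
  then have "phi n (rep_u n f - Sc q f) = phi n f \<star> HU \<ominus>\<^bsub>H\<^esub> sc q \<star> phi n f"
    by (simp add: phi_diff phi_u phi_Sc)
  moreover have "GenU \<in> hb_gens m" using Aug_u by (simp add: hb_gens_def)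
  ultimately show ?case using AugH_gen by (metis order_refl phi_closed)
next
  case (Aug_t j f)
  then have "phi n (rep_t n j f - Sc q f) = phi n f \<star> hgen (GenT j) \<ominus>\<^bsub>H\<^esub> sc q \<star> phi n f"
    by (simp add: phi_diff phi_t phi_Sc HT_hgen)
  moreover have "GenT j \<in> hb_gens m" using Aug_t by (simp add: hb_gens_def)
  ultimately show ?case using AugH_gen by (metis order_refl phi_closed)
next
  case (Aug_diff f g)
  then show ?case by (simp add: phi_diff AugH_diff)
qed

lemma Psi_cong:
  assumes "f \<in> carrier F" "g \<in> carrier F" "cl f = cl g"
  shows "Psi f \<doteq> Psi g"
proof -
  have "f \<ominus>\<^bsub>F\<^esub> g \<in> I" using assms cl_eq by simp
  then have "Psi (f \<ominus>\<^bsub>F\<^esub> g) \<in> rep_Z n" by (rule Psi_ideal)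
  then have "Psi f - Psi g \<in> rep_Z n" by (rule zeq_Z[OF zeq_sym[OF Psi_diff[OF assms(1,2)]]])
  then show ?thesis by (simp add: zeq_def)
qed

lemma cl_minus: "f \<in> carrier F \<Longrightarrow> g \<in> carrier F \<Longrightarrow> cl (f \<ominus>\<^bsub>F\<^esub> g) = cl f \<ominus>\<^bsub>H\<^esub> cl g"
  by (simp add: a_minus_def cl_add)

lemma Psi_AugH: "x \<in> AugH m \<Longrightarrow> m \<le> n \<Longrightarrow> h \<in> carrier F \<Longrightarrow> cl h = x \<Longrightarrow> Psi h \<in> V.Aug m"
proof (induction arbitrary: h rule: AugH.induct)
  case AugH_zero
  then show ?case by (intro V.Aug_Z Psi_ideal) (simp add: cl_eq_zero)
next
  case (AugH_gen g y)
  obtain f where f: "f \<in> carrier F" "y = cl f" using cl_surj AugH_gen by blast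
  have g: "g \<in> hb_gens n" using AugH_gen gens_mono by blast
  have c: "f \<bullet> gen g \<in> carrier F" "f \<bullet> sF q \<in> carrier F" using f g by auto
  have "cl h = cl (f \<bullet> gen g \<ominus>\<^bsub>F\<^esub> f \<bullet> sF q)"
    using AugH_gen f g sc_comm[of q y] by (simp add: cl_minus[OF c] cl_mult sc_cl)
  then have "Psi h \<doteq> Psi (f \<bullet> gen g \<ominus>\<^bsub>F\<^esub> f \<bullet> sF q)"
    using AugH_gen c by (intro Psi_cong F.minus_closed)
  also have "\<dots> \<doteq> Psi (f \<bullet> gen g) - Psi (f \<bullet> sF q)" by (rule Psi_diff[OF c])
  also have "\<dots> \<doteq> gen_op g (Psi f) - Sc q (Psi f)"
    unfolding Psi_gen[OF f(1) g] by (intro zeq_diff zeq_refl Psi_scalar f q_closed)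
  finally have "Psi h \<doteq> gen_op g (Psi f) - Sc q (Psi f)" .
  moreover have "gen_op g (Psi f) - Sc q (Psi f) \<in> V.Aug m"
    using AugH_gen(1) by (rule gens_cases) (simp_all add: V.Aug_u V.Aug_t)
  ultimately show ?case by (rule zeq_J)
next
  case (AugH_diff x y)
  obtain f g where f: "f \<in> carrier F" "x = cl f" and g: "g \<in> carrier F" "y = cl g"
    using cl_surj AugH_closed AugH_diff by metis
  have "cl h = cl (f \<ominus>\<^bsub>F\<^esub> g)" using AugH_diff f g by (simp add: cl_minus)
  then have "Psi h \<doteq> Psi (f \<ominus>\<^bsub>F\<^esub> g)" using AugH_diff f g by (intro Psi_cong F.minus_closed)
  also have "\<dots> \<doteq> Psi f - Psi g" using f g by (intro Psi_diff)
  finally show ?case using AugH_diff f g by (intro zeq_J[of "Psi h" "Psi f - Psi g"] V.Aug_diff) auto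
qed

text \<open>The case \<open>k = 0\<close> is singled out since \<open>T\<^sub>m\<close> need not exist there.\<close>

primrec bdryH :: "nat \<Rightarrow> nat \<Rightarrow> (hb_gen list \<Rightarrow> 'a) set \<Rightarrow> (hb_gen list \<Rightarrow> 'a) set" where
  "bdryH 0 m x = \<zero>\<^bsub>H\<^esub>"
| "bdryH (Suc k) m x = (if k = 0 then x else x \<ominus>\<^bsub>H\<^esub> sc (inv q) \<star> (bdryH k (Suc m) x \<star> HT m))"

lemma bdryH_closed: "x \<in> carrier H \<Longrightarrow> 1 \<le> m \<Longrightarrow> m + k \<le> Suc n \<Longrightarrow> bdryH k m x \<in> carrier H"
proof (induction k arbitrary: m)
  case (Suc k)
  then show ?case by (cases k) (auto intro!: H.minus_closed H.m_closed)
qed simp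

lemma phi_bdry: "1 \<le> m \<Longrightarrow> m + k \<le> Suc n \<Longrightarrow> phi n (V.bdry k m f) = bdryH k m (phi n f)"
proof (induction k arbitrary: m)
  case (Suc k)
  show ?case
  proof (cases "k = 0")
    case True
    then show ?thesis by (simp add: V.op_simps)
  next
    case False
    then show ?thesis using Suc by (simp add: phi_diff phi_Sc phi_t)
  qed
qed (simp add: phi_zero)

text \<open>\<open>bdryH\<close> lives on classes and \<open>Psi\<close> on representatives; hence a
  representative of the boundary is carried through the recursion.\<close>

lemma Psi_bdry:
  assumes f: "f \<in> carrier F"
  shows "1 \<le> m \<Longrightarrow> m + k \<le> Suc n \<Longrightarrow> \<exists>h\<in>carrier F. cl h = bdryH k m (cl f) \<and> Psi h \<doteq> V.bdry k m (Psi f)"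
proof (induction k arbitrary: m)
  case 0
  then show ?case by (intro bexI[of _ "\<zero>\<^bsub>F\<^esub>"]) (simp_all add: Psi_zero)
next
  case (Suc k)
  show ?case
  proof (cases "k = 0")
    case True
    then show ?thesis using f by (intro bexI[of _ f]) (simp_all add: V.op_simps)
  next
    case False
    obtain h where h: "h \<in> carrier F" "cl h = bdryH k (Suc m) (cl f)" "Psi h \<doteq> V.bdry k (Suc m) (Psi f)"
      using Suc.IH[of "Suc m"] Suc.prems by auto
    have g: "GenT m \<in> hb_gens n" using Suc.prems False by (intro gens_T) auto
    have hg: "h \<bullet> gen (GenT m) \<in> carrier F" using h g by auto
    let ?h = "h \<bullet> gen (GenT m) \<bullet> sF (inv q)"
    have c: "?h \<in> carrier F" using hg by auto
    have "cl h \<star> hgen (GenT m) \<in> carrier H"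
      using cl_closed[OF hg] h(1) g by (simp add: cl_mult)
    from sc_comm[OF q_closed(2) this] have "cl (f \<ominus>\<^bsub>F\<^esub> ?h) = bdryH (Suc k) m (cl f)"
      using False h g hg by (simp add: cl_minus[OF f c] cl_mult HT_hgen sc_cl)
    moreover have "Psi (f \<ominus>\<^bsub>F\<^esub> ?h) \<doteq> V.bdry (Suc k) m (Psi f)"
    proof -
      have "Psi (f \<ominus>\<^bsub>F\<^esub> ?h) \<doteq> Psi f - Psi ?h" by (rule Psi_diff[OF f c])
      also have "\<dots> \<doteq> Psi f - Qi (Psi (h \<bullet> gen (GenT m)))"
        by (intro zeq_diff zeq_refl Psi_scalar hg q_closed)
      also have "Psi (h \<bullet> gen (GenT m)) = gen_op (GenT m) (Psi h)" by (rule Psi_gen[OF h(1) g])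
      also have "Psi f - Qi (gen_op (GenT m) (Psi h)) \<doteq> Psi f - Qi (gen_op (GenT m) (V.bdry k (Suc m) (Psi f)))"
        by (intro zeq_diff zeq_refl zeq_Qi zeq_gen_op h g)
      finally show ?thesis by simp
    qed
    ultimately show ?thesis using F.minus_closed[OF f c] by blast
  qed
qed

text \<open>A cycle is lifted by \<open>Psi\<close>, bounded in the iterated module by
  \<open>rep_exact\<close>, and projected by \<open>phi\<close>. As
  \<open>phi n (Psi f) = cl f\<close>, the projection bounds the original cycle.\<close>

theorem H_exact:
  assumes m: "1 \<le> m" "m + k \<le> n" and x: "x \<in> carrier H" and cycle: "bdryH k (Suc m) x \<in> AugH (Suc m)"
  shows "\<exists>y\<in>carrier H. x \<ominus>\<^bsub>H\<^esub> bdryH (Suc k) m y \<in> AugH m"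
proof (cases "k = 0")
  case True
  then show ?thesis using x AugH_zero by (intro bexI[of _ x]) (simp_all add: a_minus_def H.r_neg)
next
  case False
  obtain f where f: "f \<in> carrier F" "x = cl f" using cl_surj x by blast
  obtain h where h: "h \<in> carrier F" "cl h = bdryH k (Suc m) x" "Psi h \<doteq> V.bdry k (Suc m) (Psi f)"
    using Psi_bdry[OF f(1), of "Suc m" k] m f by auto
  have "Psi h \<in> V.Aug (Suc m)" using cycle h m False by (intro Psi_AugH) auto
  then have "V.bdry k (Suc m) (Psi f) \<in> V.Aug (Suc m)" by (rule zeq_J[OF zeq_sym[OF h(3)]])
  then obtain y where "Psi f - V.bdry (Suc k) m y \<in> V.Aug m"
    using rep_exact[of n] m unfolding V.exact_def by blast
  then have "phi n (Psi f - V.bdry (Suc k) m y) \<in> AugH m" using m by (intro phi_J) auto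
  then have "x \<ominus>\<^bsub>H\<^esub> bdryH (Suc k) m (phi n y) \<in> AugH m"
    using f m by (simp add: phi_diff phi_Psi phi_bdry del: V.bdry.simps bdryH.simps)
  then show ?thesis by (intro bexI[of _ "phi n y"]) simp_all
qed

end

section \<open>The trivial character\<close>

context hb_ring
begin

abbreviation "eps \<equiv> free_eval R q"

lemma eps_superset:
  assumes "finite S" "{w. f w \<noteq> \<zero>} \<subseteq> S" "\<And>w. f w \<in> carrier R"
  shows "eps f = (\<Oplus>w\<in>S. f w \<otimes> q [^] length w)"
  unfolding free_eval_def using assms by (intro add.finprod_mono_neutral_cong_left) auto

lemma eps_closed [simp]: "f \<in> carrier F \<Longrightarrow> eps f \<in> carrier R"
  unfolding free_eval_def by (intro finsum_closed) (auto simp: F_closed)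

lemma eps_add:
  assumes f: "f \<in> carrier F" and g: "g \<in> carrier F"
  shows "eps (f \<oplus>\<^bsub>F\<^esub> g) = eps f \<oplus> eps g"
proof -
  let ?S = "{w. f w \<noteq> \<zero>} \<union> {w. g w \<noteq> \<zero>}"
  have S: "finite ?S" using support[OF f] support[OF g] by auto
  have "eps (f \<oplus>\<^bsub>F\<^esub> g) = (\<Oplus>w\<in>?S. (f \<oplus>\<^bsub>F\<^esub> g) w \<otimes> q [^] length w)"
    using S f g by (intro eps_superset) (auto simp: free_algebra_simps F_closed)
  also have "\<dots> = (\<Oplus>w\<in>?S. f w \<otimes> q [^] length w \<oplus> g w \<otimes> q [^] length w)"
    using f g by (intro finsum_cong') (auto simp: free_algebra_simps F_closed l_distr)
  also have "\<dots> = (\<Oplus>w\<in>?S. f w \<otimes> q [^] length w) \<oplus> (\<Oplus>w\<in>?S. g w \<otimes> q [^] length w)"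
    using f g by (intro finsum_addf) (auto simp: F_closed)
  also have "\<dots> = eps f \<oplus> eps g"
    using S f g by (subst (1 2) eps_superset[of ?S]) (auto simp: F_closed)
  finally show ?thesis .
qed

lemma eps_gen:
  assumes f: "f \<in> carrier F" and g: "g \<in> hb_gens n"
  shows "eps (f \<bullet> gen g) = eps f \<otimes> q"
proof -
  let ?S = "{w. f w \<noteq> \<zero>}"
  have fg: "f \<bullet> gen g \<in> carrier F" using f g by simp
  have "eps (f \<bullet> gen g) = (\<Oplus>w\<in>(\<lambda>w. w @ [g]) ` ?S. (f \<bullet> gen g) w \<otimes> q [^] length w)"
  proof (rule eps_superset)
    show "{w. (f \<bullet> gen g) w \<noteq> \<zero>} \<subseteq> (\<lambda>w. w @ [g]) ` ?S"
    proof
      fix w assume "w \<in> {w. (f \<bullet> gen g) w \<noteq> \<zero>}"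
      then show "w \<in> (\<lambda>w. w @ [g]) ` ?S"
        using f g by (cases w rule: rev_cases) (auto simp: mult_gen split: if_splits)
    qed
  qed (use support[OF f] F_closed[OF fg] in auto)
  also have "\<dots> = (\<Oplus>w\<in>?S. (f \<bullet> gen g) (w @ [g]) \<otimes> q [^] length (w @ [g]))"
    using F_closed[OF fg] by (intro add.finprod_reindex) (auto simp: inj_on_def)
  also have "\<dots> = (\<Oplus>w\<in>?S. f w \<otimes> q [^] length w \<otimes> q)"
    using f g by (intro finsum_cong') (auto simp: mult_gen F_closed m_assoc)
  also have "\<dots> = eps f \<otimes> q"
    unfolding free_eval_def using support[OF f] F_closed[OF f] by (intro finsum_ldistr[symmetric]) auto
  finally show ?thesis .
qed

lemma eps_scalar:
  assumes f: "f \<in> carrier F" and c: "c \<in> carrier R"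
  shows "eps (f \<bullet> sF c) = eps f \<otimes> c"
proof -
  let ?S = "{w. f w \<noteq> \<zero>}"
  have "eps (f \<bullet> sF c) = (\<Oplus>w\<in>?S. (f \<bullet> sF c) w \<otimes> q [^] length w)"
    using support[OF f] F_closed[OF f] c by (intro eps_superset) (auto simp: mult_sF[OF f c])
  also have "\<dots> = (\<Oplus>w\<in>?S. f w \<otimes> q [^] length w \<otimes> c)"
    using f c by (intro finsum_cong') (auto simp: mult_sF F_closed m_ac)
  also have "\<dots> = eps f \<otimes> c"
    unfolding free_eval_def using support[OF f] F_closed[OF f] c by (intro finsum_ldistr[symmetric]) auto
  finally show ?thesis .
qed

lemma eps_one: "eps \<one>\<^bsub>F\<^esub> = \<one>"
proof -
  have "eps \<one>\<^bsub>F\<^esub> = (\<Oplus>w\<in>{[]}. \<one>\<^bsub>F\<^esub> w \<otimes> q [^] length w)"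
    by (intro eps_superset) (auto simp: free_algebra_simps split: if_splits)
  then show ?thesis by (simp add: free_algebra_simps)
qed

lemma eps_sF: "c \<in> carrier R \<Longrightarrow> eps (sF c) = c"
  using eps_scalar[of "\<one>\<^bsub>F\<^esub>" c] by (simp add: eps_one)

lemma eps_mult:
  assumes f: "f \<in> carrier F" and g: "g \<in> carrier F"
  shows "eps (f \<bullet> g) = eps f \<otimes> eps g"
  using g
proof (induction rule: F_induct)
  case (scalar c)
  then show ?case using f by (simp add: eps_scalar eps_sF)
next
  case (gen h g)
  then show ?case using f by (simp add: eps_gen m_assoc flip: F.m_assoc)
next
  case (add h g)
  then show ?case using f by (simp add: F.r_distr eps_add r_distr)
qed

lemma eps_hom: "eps \<in> ring_hom F R"
  by (intro ring_hom_memI) (auto simp: eps_mult eps_add eps_one)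

sublocale eps: ring_hom_ring F R eps
  by (rule ring_hom_ringI2[OF F.ring_axioms ring_axioms eps_hom])

lemma eps_gen1: "g \<in> hb_gens n \<Longrightarrow> eps (gen g) = q"
  using eps_gen[of "\<one>\<^bsub>F\<^esub>" g] by (simp add: eps_one)

lemma eps_minus: "f \<in> carrier F \<Longrightarrow> g \<in> carrier F \<Longrightarrow> eps (f \<ominus>\<^bsub>F\<^esub> g) = eps f \<ominus> eps g"
  by (simp add: a_minus_def eps_add)

text \<open>In the braid and commutation relators both monomials have the same length and hence the
  same value; each quadratic relator has the factor x - q, whose value is zero.\<close>

lemma eps_ideal:
  assumes "f \<in> I"
  shows "eps f = \<zero>"
proof -
  have "hb_relators R q n \<subseteq> a_kernel F R eps"
  proof
    fix x assume x: "x \<in> hb_relators R q n"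
    then have "eps x = \<zero>"
    proof (cases rule: relators_cases)
      case u_braid
      have g: "GenU \<in> hb_gens n" "GenT 1 \<in> hb_gens n"
        using u_braid by (intro gens_U gens_T1; simp)+
      show ?thesis unfolding u_braid(2) using g
        by (subst eps_minus; (intro F.m_closed gen_closed)?) (simp_all add: eps_gen eps_gen1 a_minus_def r_neg)
    next
      case (u_comm i)
      have g: "GenU \<in> hb_gens n" "GenT i \<in> hb_gens n"
        using u_comm by (intro gens_U gens_T; simp)+
      show ?thesis unfolding u_comm(3) using g
        by (subst eps_minus; (intro F.m_closed gen_closed)?) (simp_all add: eps_gen eps_gen1 a_minus_def r_neg)
    next
      case (t_braid i)
      have g: "GenT (i + 1) \<in> hb_gens n" "GenT i \<in> hb_gens n"
        using t_braid by (intro gens_T; simp)+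
      show ?thesis unfolding t_braid(3) using g
        by (subst eps_minus; (intro F.m_closed gen_closed)?) (simp_all add: eps_gen eps_gen1 a_minus_def r_neg)
    next
      case (t_comm i j)
      have g: "GenT j \<in> hb_gens n" "GenT i \<in> hb_gens n"
        using t_comm by (intro gens_T; simp)+
      show ?thesis unfolding t_comm(6) using g
        by (subst eps_minus; (intro F.m_closed gen_closed)?) (simp_all add: eps_gen eps_gen1 a_minus_def r_neg)
    next
      case (quad g)
      then have "gen g \<ominus>\<^bsub>F\<^esub> sF q \<in> carrier F" by (intro F.minus_closed) auto
      moreover have "eps (gen g \<ominus>\<^bsub>F\<^esub> sF q) = \<zero>"
        using quad by (subst eps_minus) (simp_all add: eps_gen1 eps_sF a_minus_def r_neg)
      ultimately show ?thesis unfolding quad(2) using quad(1) by (subst eps_mult) simp_all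
    qed
    then show "x \<in> a_kernel F R eps" unfolding a_kernel_def' using x relators_closed by blast
  qed
  then have "I \<subseteq> a_kernel F R eps"
    unfolding hb_ideal_def by (rule F.genideal_minimal[OF eps.kernel_is_ideal])
  then show ?thesis using assms unfolding a_kernel_def' by blast
qed

definition epsH :: "(hb_gen list \<Rightarrow> 'a) set \<Rightarrow> 'a" where
  "epsH x = the_elem (eps ` x)"

lemma epsH_cl:
  assumes "f \<in> carrier F"
  shows "epsH (cl f) = eps f"
proof -
  have "eps (i \<oplus>\<^bsub>F\<^esub> f) = eps f" if "i \<in> I" for i
    using that assms I.a_subset by (auto simp: eps_add eps_ideal)
  moreover have "f \<in> I +>\<^bsub>F\<^esub> f" using assms by (rule I.a_rcos_self)
  ultimately have "eps ` cl f = {eps f}"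
    unfolding hb_class_def by (auto simp: a_r_coset_def r_coset_def)
  then show ?thesis by (simp add: epsH_def)
qed

lemma epsH_closed [simp]: "x \<in> carrier H \<Longrightarrow> epsH x \<in> carrier R"
  using cl_surj[of x] by (auto simp: epsH_cl)

lemma epsH_mult:
  assumes "x \<in> carrier H" "y \<in> carrier H"
  shows "epsH (x \<star> y) = epsH x \<otimes> epsH y"
proof -
  obtain f g where f: "f \<in> carrier F" "x = cl f" and g: "g \<in> carrier F" "y = cl g"
    using cl_surj assms by metis
  have "epsH (cl (f \<bullet> g)) = eps f \<otimes> eps g" using f g by (subst epsH_cl) (simp_all add: eps_mult)
  then show ?thesis using f g by (simp add: cl_mult epsH_cl)
qed

lemma epsH_add:
  assumes "x \<in> carrier H" "y \<in> carrier H"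
  shows "epsH (x \<oplus>\<^bsub>H\<^esub> y) = epsH x \<oplus> epsH y"
proof -
  obtain f g where f: "f \<in> carrier F" "x = cl f" and g: "g \<in> carrier F" "y = cl g"
    using cl_surj assms by metis
  have "epsH (cl (f \<oplus>\<^bsub>F\<^esub> g)) = eps f \<oplus> eps g" using f g by (subst epsH_cl) (simp_all add: eps_add)
  then show ?thesis using f g by (simp add: cl_add epsH_cl)
qed

lemma epsH_sc: "c \<in> carrier R \<Longrightarrow> epsH (sc c) = c"
  by (simp add: sc_cl epsH_cl eps_sF)

lemma epsH_gen: "g \<in> hb_gens n \<Longrightarrow> epsH (hgen g) = q"
  by (simp add: epsH_cl eps_gen1)

lemma epsH_one: "epsH \<one>\<^bsub>H\<^esub> = \<one>"
  using epsH_sc[of \<one>] by (simp add: sc_one)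

lemma epsH_minus: "x \<in> carrier H \<Longrightarrow> epsH (\<ominus>\<^bsub>H\<^esub> x) = \<ominus> epsH x"
proof -
  assume x: "x \<in> carrier H"
  have "epsH (\<ominus>\<^bsub>H\<^esub> x) \<oplus> epsH x = epsH \<zero>\<^bsub>H\<^esub>" using x epsH_add[of "\<ominus>\<^bsub>H\<^esub> x" x] by (simp add: H.l_neg)
  also have "\<dots> = \<zero>" using epsH_sc[of \<zero>] by (simp add: sc_zero)
  finally show ?thesis using x by (intro minus_equality[symmetric]) auto
qed

abbreviation "Bs \<equiv> hb_sub R q n"
abbreviation "M \<equiv> hb_triv R q n"

lemma Bs_gens: "m \<le> n \<Longrightarrow> sc ` carrier R \<union> (cl \<circ> gen) ` hb_gens m \<subseteq> carrier H"
  using gens_mono[of m n] by auto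

lemma Bs_closed: "m \<le> n \<Longrightarrow> Bs m \<subseteq> carrier H"
  unfolding hb_sub_def by (rule H.generate_ring_incl[OF Bs_gens])

lemma Bs_mono: "m \<le> m' \<Longrightarrow> m' \<le> n \<Longrightarrow> Bs m \<subseteq> Bs m'"
  unfolding hb_sub_def by (rule H.mono_generate_ring[OF _ Bs_gens]) (use gens_mono[of m m'] in auto)

lemma sc_Bs: "c \<in> carrier R \<Longrightarrow> sc c \<in> Bs m"
  unfolding hb_sub_def by (rule generate_ring.incl) auto

lemma hgen_Bs: "g \<in> hb_gens m \<Longrightarrow> hgen g \<in> Bs m"
  unfolding hb_sub_def by (rule generate_ring.incl) auto

lemma AugH_minus: "x \<in> AugH m \<Longrightarrow> m \<le> n \<Longrightarrow> \<ominus>\<^bsub>H\<^esub> x \<in> AugH m"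
  using AugH_diff[OF AugH_zero, of x m] by (simp add: a_minus_def AugH_closed)

lemma AugH_add: "x \<in> AugH m \<Longrightarrow> y \<in> AugH m \<Longrightarrow> m \<le> n \<Longrightarrow> x \<oplus>\<^bsub>H\<^esub> y \<in> AugH m"
  using AugH_diff[OF _ AugH_minus, of x m y] by (simp add: a_minus_def AugH_closed)

text \<open>For a product b c the generating condition is applied to c at y b and then to b at
  \<epsilon>(c) y, where \<epsilon> is the trivial character. The middle terms cancel because
  scalars are central.\<close>

lemma AugH_Bs:
  assumes "b \<in> Bs m" "m \<le> n" "y \<in> carrier H"
  shows "y \<star> b \<ominus>\<^bsub>H\<^esub> sc (epsH b) \<star> y \<in> AugH m"
  using assms(1,3) unfolding hb_sub_def
proof (induction arbitrary: y rule: generate_ring.induct)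
  case one
  then show ?case by (simp add: epsH_one sc_one a_minus_def H.r_neg AugH_zero)
next
  case (incl h)
  then consider c where "c \<in> carrier R" "h = sc c" | g where "g \<in> hb_gens m" "h = hgen g" by auto
  then show ?case
  proof cases
    case 1
    then show ?thesis using incl sc_comm[of c y] by (simp add: epsH_sc a_minus_def H.r_neg AugH_zero)
  next
    case 2
    then have "g \<in> hb_gens n" using gens_mono[OF assms(2)] by auto
    then show ?thesis using 2 incl by (simp add: epsH_gen AugH_gen)
  qed
next
  case (a_inv h)
  then have h: "h \<in> carrier H" using H.generate_ring_in_carrier[OF Bs_gens[OF assms(2)]] by blast
  have "sc (\<ominus> epsH h) = \<ominus>\<^bsub>H\<^esub> sc (epsH h)"
    using h sc_add[of "\<ominus> epsH h" "epsH h"] by (intro H.minus_equality[symmetric]) (simp_all add: l_neg sc_zero)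
  moreover have "\<ominus>\<^bsub>H\<^esub> (y \<star> h \<ominus>\<^bsub>H\<^esub> sc (epsH h) \<star> y) \<in> AugH m"
    using a_inv assms(2) by (intro AugH_minus) auto
  ultimately show ?case using h a_inv.prems
    by (simp add: epsH_minus a_minus_def H.minus_add H.r_minus H.l_minus)
next
  case (eng_add b c)
  then have bc: "b \<in> carrier H" "c \<in> carrier H" using H.generate_ring_in_carrier[OF Bs_gens[OF assms(2)]] by blast+
  have "(y \<star> b \<ominus>\<^bsub>H\<^esub> sc (epsH b) \<star> y) \<oplus>\<^bsub>H\<^esub> (y \<star> c \<ominus>\<^bsub>H\<^esub> sc (epsH c) \<star> y) \<in> AugH m"
    using eng_add assms(2) by (intro AugH_add) auto
  then show ?case using bc eng_add.prems
    by (simp add: epsH_add sc_add a_minus_def H.r_distr H.l_distr H.minus_add H.a_ac)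
next
  case (eng_mult b c)
  then have bc: "b \<in> carrier H" "c \<in> carrier H" using H.generate_ring_in_carrier[OF Bs_gens[OF assms(2)]] by blast+
  let ?b = "sc (epsH b)" and ?c = "sc (epsH c)"
  have e: "?b \<in> carrier H" "?c \<in> carrier H" using bc by auto
  have 1: "y \<star> b \<star> c \<ominus>\<^bsub>H\<^esub> ?c \<star> (y \<star> b) \<in> AugH m"
    using eng_mult bc by auto
  have 2: "(?c \<star> y) \<star> b \<ominus>\<^bsub>H\<^esub> ?b \<star> (?c \<star> y) \<in> AugH m"
    using eng_mult bc e by auto
  have s: "sc (epsH (b \<star> c)) = ?b \<star> ?c" using bc by (simp add: epsH_mult sc_mult)
  have cancel: "(p \<ominus>\<^bsub>H\<^esub> r) \<oplus>\<^bsub>H\<^esub> (r \<ominus>\<^bsub>H\<^esub> z) = p \<ominus>\<^bsub>H\<^esub> z" if "p \<in> carrier H" "r \<in> carrier H" "z \<in> carrier H" for p r z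
    using that by (simp add: a_minus_def H.a_assoc H.r_neg1)
  have "y \<star> (b \<star> c) \<ominus>\<^bsub>H\<^esub> sc (epsH (b \<star> c)) \<star> y
    = (y \<star> b \<star> c \<ominus>\<^bsub>H\<^esub> ?c \<star> (y \<star> b)) \<oplus>\<^bsub>H\<^esub> ((?c \<star> y) \<star> b \<ominus>\<^bsub>H\<^esub> ?b \<star> (?c \<star> y))"
    using bc e eng_mult.prems cancel[of "y \<star> (b \<star> c)" "?c \<star> (y \<star> b)" "?b \<star> (?c \<star> y)"]
    by (simp add: s H.m_assoc)
  then show ?case using AugH_add[OF 1 2 assms(2)] by simp
qed

lemma H_finsum_minus:
  "(\<And>j. j \<le> r \<Longrightarrow> f j \<in> carrier H) \<Longrightarrow>
    \<ominus>\<^bsub>H\<^esub> (\<Oplus>\<^bsub>H\<^esub>j\<in>{..r::nat}. f j) = (\<Oplus>\<^bsub>H\<^esub>j\<in>{..r}. \<ominus>\<^bsub>H\<^esub> f j)"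
proof (induction r)
  case (Suc r)
  then show ?case by (subst (1 2) H.finsum_Suc) (auto simp: H.minus_add)
qed simp

text \<open>In the recursion, multiplying by T_m on the right extends each descending product by one
  factor, and the factor -1/q supplies its sign and power; summand j for \<open>Suc m\<close>
  becomes summand j + 1 for \<open>m\<close>.\<close>

lemma bdryH_sum:
  assumes x: "x \<in> carrier H"
  shows "1 \<le> m \<Longrightarrow> m + r \<le> n \<Longrightarrow>
    bdryH (Suc r) m x = (\<Oplus>\<^bsub>H\<^esub>j\<in>{..r}. sc ((\<ominus> \<one>) [^] j \<otimes> (inv q) [^] j) \<star> (x \<star> desc (m + j) m))"
proof (induction r arbitrary: m)
  case 0
  then show ?case using x by (simp add: sc_one)
next
  case (Suc r)
  let ?c = "\<lambda>j::nat. (\<ominus> \<one>) [^] j \<otimes> (inv q) [^] j :: 'a"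
  have c: "?c j \<in> carrier R" for j by simp
  have HTm: "HT m \<in> carrier H" using Suc.prems by simp
  have tpc: "desc (Suc m + j) (Suc m) \<in> carrier H" "desc (m + j) m \<in> carrier H" "desc (Suc m + j) m \<in> carrier H" if "j \<le> r" for j
    using that Suc.prems by (auto intro!: desc_closed)
  have tpe: "desc (Suc m + j) (Suc m) \<star> HT m = desc (Suc m + j) m" if "j \<le> r" for j
    using that Suc.prems by (intro desc_T_end) auto
  have cs: "sc (?c (Suc j)) = \<ominus>\<^bsub>H\<^esub> (sc (inv q) \<star> sc (?c j))" for j
  proof -
    have "?c (Suc j) = \<ominus> (inv q \<otimes> ?c j)" by (simp add: l_minus r_minus m_ac)
    moreover have "sc (\<ominus> d) = \<ominus>\<^bsub>H\<^esub> sc d" if "d \<in> carrier R" for d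
      using that sc_add[of "\<ominus> d" d] by (intro H.minus_equality[symmetric]) (simp_all add: l_neg sc_zero)
    ultimately show ?thesis by (simp add: sc_mult)
  qed
  have "bdryH (Suc (Suc r)) m x = x \<ominus>\<^bsub>H\<^esub> sc (inv q) \<star> (bdryH (Suc r) (Suc m) x \<star> HT m)"
    by (simp only: bdryH.simps(2)[of "Suc r"]) simp
  also have "bdryH (Suc r) (Suc m) x = (\<Oplus>\<^bsub>H\<^esub>j\<in>{..r}. sc (?c j) \<star> (x \<star> desc (Suc m + j) (Suc m)))"
    using Suc.prems by (intro Suc.IH) auto
  also have "\<dots> \<star> HT m = (\<Oplus>\<^bsub>H\<^esub>j\<in>{..r}. sc (?c j) \<star> (x \<star> desc (Suc m + j) (Suc m)) \<star> HT m)"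
    using x tpc HTm by (intro H.finsum_ldistr) auto
  also have "sc (inv q) \<star> \<dots> = (\<Oplus>\<^bsub>H\<^esub>j\<in>{..r}. sc (inv q) \<star> (sc (?c j) \<star> (x \<star> desc (Suc m + j) (Suc m)) \<star> HT m))"
    using x tpc HTm by (intro H.finsum_rdistr) auto
  also have "x \<ominus>\<^bsub>H\<^esub> \<dots> = (\<Oplus>\<^bsub>H\<^esub>j\<in>{..r}. \<ominus>\<^bsub>H\<^esub> (sc (inv q) \<star> (sc (?c j) \<star> (x \<star> desc (Suc m + j) (Suc m)) \<star> HT m))) \<oplus>\<^bsub>H\<^esub> x"
    unfolding a_minus_def using x tpc HTm by (subst H_finsum_minus) (auto intro!: H.a_comm H.finsum_closed)
  also have "(\<Oplus>\<^bsub>H\<^esub>j\<in>{..r}. \<ominus>\<^bsub>H\<^esub> (sc (inv q) \<star> (sc (?c j) \<star> (x \<star> desc (Suc m + j) (Suc m)) \<star> HT m)))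
    = (\<Oplus>\<^bsub>H\<^esub>j\<in>{..r}. sc (?c (Suc j)) \<star> (x \<star> desc (m + Suc j) m))"
  proof (rule H.finsum_cong')
    fix j assume "j \<in> {..r}"
    then have j: "j \<le> r" by simp
    then have "sc (?c (Suc j)) \<star> (x \<star> desc (m + Suc j) m)
      = \<ominus>\<^bsub>H\<^esub> (sc (inv q) \<star> sc (?c j)) \<star> (x \<star> (desc (Suc m + j) (Suc m) \<star> HT m))"
      unfolding cs tpe[OF j] by simp
    then show "\<ominus>\<^bsub>H\<^esub> (sc (inv q) \<star> (sc (?c j) \<star> (x \<star> desc (Suc m + j) (Suc m)) \<star> HT m))
      = sc (?c (Suc j)) \<star> (x \<star> desc (m + Suc j) m)"
      using x tpc[OF j] HTm c[of j] by (simp add: H.m_assoc H.l_minus del: nat_pow_Suc)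
  qed (use x tpc c in \<open>auto simp del: nat_pow_Suc\<close>)
  also have "\<dots> \<oplus>\<^bsub>H\<^esub> x = (\<Oplus>\<^bsub>H\<^esub>j\<in>{..Suc r}. sc (?c j) \<star> (x \<star> desc (m + j) m))"
    using x c Suc.prems by (subst H.finsum_Suc2) (auto simp: sc_one intro!: desc_closed)
  finally show ?case .
qed

lemma bdryH_diff:
  assumes "x \<in> carrier H" "y \<in> carrier H"
  shows "1 \<le> m \<Longrightarrow> m + k \<le> Suc n \<Longrightarrow> bdryH k m (x \<ominus>\<^bsub>H\<^esub> y) = bdryH k m x \<ominus>\<^bsub>H\<^esub> bdryH k m y"
proof (induction k arbitrary: m)
  case 0
  then show ?case by (simp add: a_minus_def)
next
  case (Suc k)
  show ?case
  proof (cases "k = 0")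
    case False
    let ?d = "\<lambda>x. bdryH k (Suc m) x"
    have c: "?d x \<in> carrier H" "?d y \<in> carrier H" "HT m \<in> carrier H"
      using assms Suc.prems False by (auto intro!: bdryH_closed)
    have IH: "?d (x \<ominus>\<^bsub>H\<^esub> y) = ?d x \<ominus>\<^bsub>H\<^esub> ?d y" using Suc by simp
    show ?thesis using False c assms unfolding bdryH.simps IH
      by (simp add: a_minus_def H.l_distr H.r_distr H.l_minus H.r_minus H.minus_add H.a_ac)
  qed simp
qed


section \<open>The tensor product as a quotient by the left ideal\<close>

abbreviation "FG \<equiv> free_Abelian_group (carrier H \<times> carrier R)"
abbreviation "null m \<equiv> tensor_null H (Bs m) M"
abbreviation "TP m \<equiv> tensor_product H (Bs m) M"
abbreviation "pt m x \<equiv> pure_tensor H (Bs m) M x \<one>"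

lemma M_simps: "carrier M = carrier R" "v \<oplus>\<^bsub>M\<^esub> w = v \<oplus> w" "b \<odot>\<^bsub>M\<^esub> v = epsH b \<otimes> v"
  by (simp_all add: hb_triv_def epsH_def)

sublocale FG: comm_group FG
  by (rule abelian_free_Abelian_group)

lemma FG_diff: "c \<in> carrier FG \<Longrightarrow> d \<in> carrier FG \<Longrightarrow> c - d \<in> carrier FG"
  using keys_diff[of c d] by (auto simp: carrier_free_Abelian_group_iff)

lemma tensor_relators_closed:
  assumes "m \<le> n"
  shows "tensor_relators H (Bs m) M \<subseteq> carrier FG"
proof
  fix z assume "z \<in> tensor_relators H (Bs m) M"
  then consider x y v where "z = frag_of (x \<oplus>\<^bsub>H\<^esub> y, v) - frag_of (x, v) - frag_of (y, v)" "x \<in> carrier H" "y \<in> carrier H" "v \<in> carrier R"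
     | x v w where "z = frag_of (x, v \<oplus> w) - frag_of (x, v) - frag_of (x, w)" "x \<in> carrier H" "v \<in> carrier R" "w \<in> carrier R"
     | x b v where "z = frag_of (x \<star> b, v) - frag_of (x, epsH b \<otimes> v)" "x \<in> carrier H" "b \<in> Bs m" "v \<in> carrier R"
    unfolding tensor_relators_def M_simps by blast
  then show "z \<in> carrier FG"
    using Bs_closed[OF assms] by cases (auto intro!: FG_diff simp del: carrier_free_Abelian_group_iff)
qed

lemma null_subgroup: "m \<le> n \<Longrightarrow> subgroup (null m) FG"
  unfolding tensor_null_def M_simps by (rule FG.generate_is_subgroup[OF tensor_relators_closed])

lemma null_closed: "m \<le> n \<Longrightarrow> z \<in> null m \<Longrightarrow> z \<in> carrier FG"
  using subgroup.subset[OF null_subgroup] by blast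

lemma null_add: "m \<le> n \<Longrightarrow> y \<in> null m \<Longrightarrow> z \<in> null m \<Longrightarrow> y + z \<in> null m"
  using subgroup.m_closed[OF null_subgroup] by simp

lemma null_minus: "m \<le> n \<Longrightarrow> z \<in> null m \<Longrightarrow> - z \<in> null m"
  using subgroup.m_inv_closed[OF null_subgroup, of m z] null_closed[of m z] by simp

lemma null_diff: "m \<le> n \<Longrightarrow> y \<in> null m \<Longrightarrow> z \<in> null m \<Longrightarrow> y - z \<in> null m"
  using null_add[OF _ _ null_minus, of m y z] by simp

lemma null_relator: "z \<in> tensor_relators H (Bs m) M \<Longrightarrow> z \<in> null m"
  unfolding tensor_null_def by (rule generate.incl)

lemma null_add_left: "x \<in> carrier H \<Longrightarrow> y \<in> carrier H \<Longrightarrow> v \<in> carrier R \<Longrightarrow>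
    frag_of (x \<oplus>\<^bsub>H\<^esub> y, v) - frag_of (x, v) - frag_of (y, v) \<in> null m"
  by (rule null_relator) (unfold tensor_relators_def M_simps, blast)

lemma null_balanced: "x \<in> carrier H \<Longrightarrow> b \<in> Bs m \<Longrightarrow> v \<in> carrier R \<Longrightarrow>
    frag_of (x \<star> b, v) - frag_of (x, epsH b \<otimes> v) \<in> null m"
  by (rule null_relator) (unfold tensor_relators_def M_simps, blast)

lemma null_diff_left:
  assumes "m \<le> n" "x \<in> carrier H" "y \<in> carrier H" "v \<in> carrier R"
  shows "frag_of (x \<ominus>\<^bsub>H\<^esub> y, v) - (frag_of (x, v) - frag_of (y, v)) \<in> null m"
proof -
  have "(x \<ominus>\<^bsub>H\<^esub> y) \<oplus>\<^bsub>H\<^esub> y = x" using assms by (simp add: a_minus_def H.a_assoc H.l_neg)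
  then have "frag_of (x, v) - frag_of (x \<ominus>\<^bsub>H\<^esub> y, v) - frag_of (y, v) \<in> null m"
    using null_add_left[of "x \<ominus>\<^bsub>H\<^esub> y" y v m] assms H.minus_closed by simp
  from null_minus[OF assms(1) this] show ?thesis by (simp add: algebra_simps)
qed

lemma null_zero_left:
  assumes "m \<le> n" "v \<in> carrier R"
  shows "frag_of (\<zero>\<^bsub>H\<^esub>, v) \<in> null m"
  using null_minus[OF assms(1) null_add_left[of "\<zero>\<^bsub>H\<^esub>" "\<zero>\<^bsub>H\<^esub>" v m]] assms(2) by simp

lemma null_scalar:
  assumes "m \<le> n" "x \<in> carrier H" "v \<in> carrier R"
  shows "frag_of (x, v) - frag_of (x \<star> sc v, \<one>) \<in> null m"
  using null_minus[OF assms(1) null_balanced[OF assms(2) sc_Bs[OF assms(3), of m] one_closed]] assms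
  by (simp add: epsH_sc)

text \<open>Scalars belong to every \<open>Bs m\<close>, even for \<open>m = 0\<close>, so the right
  factor can always be moved to the left.\<close>

lemma tensor_pure:
  assumes "m \<le> n" "z \<in> carrier FG"
  shows "\<exists>x\<in>carrier H. z - frag_of (x, \<one>) \<in> null m"
proof -
  have "Poly_Mapping.keys z \<subseteq> carrier H \<times> carrier R" using assms(2) by simp
  then show ?thesis
  proof (induction rule: frag_induction)
    case zero
    show ?case using null_minus[OF assms(1) null_zero_left[OF assms(1) one_closed]]
      by (intro bexI[of _ "\<zero>\<^bsub>H\<^esub>"]) auto
  next
    case (diff y z)
    then obtain a b where a: "a \<in> carrier H" "y - frag_of (a, \<one>) \<in> null m"
      and b: "b \<in> carrier H" "z - frag_of (b, \<one>) \<in> null m" by blast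
    have "(y - frag_of (a, \<one>)) - (z - frag_of (b, \<one>)) - (frag_of (a \<ominus>\<^bsub>H\<^esub> b, \<one>) - (frag_of (a, \<one>) - frag_of (b, \<one>))) \<in> null m"
      by (rule null_diff[OF assms(1) null_diff[OF assms(1) a(2) b(2)] null_diff_left[OF assms(1) a(1) b(1) one_closed]])
    then show ?case using H.minus_closed[OF a(1) b(1)] by (intro bexI[of _ "a \<ominus>\<^bsub>H\<^esub> b"]) (simp_all add: algebra_simps)
  next
    case (one a)
    then obtain x v where "a = (x, v)" "x \<in> carrier H" "v \<in> carrier R" by blast
    then show ?case using null_scalar[OF assms(1), of x v] by (intro bexI[of _ "x \<star> sc v"]) auto
  qed
qed

text \<open>Sending the pair (x, v) to x v kills the additivity relators and sends the balancing
  ones into \<open>AugH m\<close> by \<open>AugH_Bs\<close>. Conversely, for a generator g of HB_m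
  both x g and q x represent x tensored with q, so a generator of the left ideal represents
  zero.\<close>

lemma null_AugH:
  assumes m: "m \<le> n" and x: "x \<in> carrier H"
  shows "frag_of (x, \<one>) \<in> null m \<longleftrightarrow> x \<in> AugH m"
proof
  assume null: "frag_of (x, \<one>) \<in> null m"
  obtain h where h: "h \<in> hom FG (add_monoid H)"
    and h_frag: "\<And>p. p \<in> carrier H \<times> carrier R \<Longrightarrow> h (frag_of p) = fst p \<star> sc (snd p)"
    by (rule comm_group.free_Abelian_group_universal[OF H.a_comm_group, of "\<lambda>p. fst p \<star> sc (snd p)" "carrier H \<times> carrier R"])
      auto
  have h_closed: "h z \<in> carrier H" if "z \<in> carrier FG" for z using h that by (auto simp: hom_def)
  have h_add: "h (y + z) = h y \<oplus>\<^bsub>H\<^esub> h z" if "y \<in> carrier FG" "z \<in> carrier FG" for y z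
    using h that by (simp add: hom_def)
  have h0: "h 0 = \<zero>\<^bsub>H\<^esub>" using group_hom.hom_one[OF group_hom.intro[OF FG.is_group H.a_group group_hom_axioms.intro[OF h]]] by simp
  have h_minus: "h (- z) = \<ominus>\<^bsub>H\<^esub> h z" if "z \<in> carrier FG" for z
    using that h_add[of "- z" z] h_closed[of z] h_closed[of "- z"] h0
    by (intro H.minus_equality[symmetric]) auto
  have h_diff: "h (y - z) = h y \<ominus>\<^bsub>H\<^esub> h z" if "y \<in> carrier FG" "z \<in> carrier FG" for y z
    using that h_add[of y "- z"] h_minus[of z] by (simp add: a_minus_def)
  have rel: "h z \<in> AugH m" if z: "z \<in> tensor_relators H (Bs m) M" for z
  proof -
    consider x y v where "z = frag_of (x \<oplus>\<^bsub>H\<^esub> y, v) - frag_of (x, v) - frag_of (y, v)" "x \<in> carrier H" "y \<in> carrier H" "v \<in> carrier R"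
     | x v w where "z = frag_of (x, v \<oplus> w) - frag_of (x, v) - frag_of (x, w)" "x \<in> carrier H" "v \<in> carrier R" "w \<in> carrier R"
     | x b v where "z = frag_of (x \<star> b, v) - frag_of (x, epsH b \<otimes> v)" "x \<in> carrier H" "b \<in> Bs m" "v \<in> carrier R"
      using z unfolding tensor_relators_def M_simps by blast
    then show ?thesis
    proof cases
      case 1
      have "h z = (x \<oplus>\<^bsub>H\<^esub> y) \<star> sc v \<ominus>\<^bsub>H\<^esub> x \<star> sc v \<ominus>\<^bsub>H\<^esub> y \<star> sc v"
        unfolding 1(1) using 1(2-) by (subst h_diff; (intro FG_diff)?) (simp_all add: h_diff h_frag)
      also have "\<dots> = \<zero>\<^bsub>H\<^esub>"
        using 1(2-) H.r_neg[of "(x \<oplus>\<^bsub>H\<^esub> y) \<star> sc v"] by (simp add: a_minus_def H.l_distr H.minus_add H.a_assoc)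
      finally show ?thesis by (simp add: AugH_zero)
    next
      case 2
      have "h z = x \<star> sc (v \<oplus> w) \<ominus>\<^bsub>H\<^esub> x \<star> sc v \<ominus>\<^bsub>H\<^esub> x \<star> sc w"
        unfolding 2(1) using 2(2-) by (subst h_diff; (intro FG_diff)?) (simp_all add: h_diff h_frag)
      also have "\<dots> = \<zero>\<^bsub>H\<^esub>"
        using 2(2-) H.r_neg[of "x \<star> sc (v \<oplus> w)"] by (simp add: a_minus_def sc_add H.r_distr H.minus_add H.a_assoc)
      finally show ?thesis by (simp add: AugH_zero)
    next
      case 3
      have b: "b \<in> carrier H" using 3 Bs_closed[OF m] by blast
      have "h z = x \<star> b \<star> sc v \<ominus>\<^bsub>H\<^esub> x \<star> sc (epsH b \<otimes> v)"
        unfolding 3(1) using 3(2,4) b by (subst h_diff) (simp_all add: h_frag)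
      also have "\<dots> = (x \<star> sc v) \<star> b \<ominus>\<^bsub>H\<^esub> sc (epsH b) \<star> (x \<star> sc v)"
        using 3(2,4) b sc_comm[of v b] sc_comm[of "epsH b" x] by (simp add: sc_mult H.m_assoc flip: H.m_assoc[of "sc (epsH b)" x])
      finally show ?thesis using AugH_Bs[OF 3(3) m, of "x \<star> sc v"] 3(2,4) by simp
    qed
  qed
  have "h z \<in> AugH m" if "z \<in> null m" for z
    using that unfolding tensor_null_def M_simps
  proof (induction rule: generate.induct)
    case one
    show ?case by (simp add: h0 AugH_zero)
  next
    case (incl z)
    then show ?case by (rule rel)
  next
    case (inv z)
    then have "z \<in> carrier FG" using tensor_relators_closed[OF m] by blast
    then show ?case using AugH_minus[OF rel[OF inv] m] h_minus[of z] by simp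
  next
    case (eng y z)
    then have "y \<in> null m" "z \<in> null m" unfolding tensor_null_def M_simps by auto
    then show ?case using eng null_closed[OF m] AugH_add[OF _ _ m] by (simp add: h_add)
  qed
  from this[OF null] show "x \<in> AugH m" using h_frag[of "(x, \<one>)"] x by (simp add: sc_one)
next
  assume "x \<in> AugH m"
  then show "frag_of (x, \<one>) \<in> null m"
  proof (induction rule: AugH.induct)
    case AugH_zero
    show ?case using m by (intro null_zero_left) auto
  next
    case (AugH_gen g y)
    have g: "g \<in> hb_gens n" using AugH_gen gens_mono[OF m] by blast
    have 1: "frag_of (y \<star> hgen g, \<one>) - frag_of (y, q) \<in> null m"
      using null_balanced[of y "hgen g" m \<one>] AugH_gen hgen_Bs[OF AugH_gen(1)] g by (simp add: epsH_gen)
    have 2: "frag_of (y, q) - frag_of (sc q \<star> y, \<one>) \<in> null m"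
      using null_scalar[of m y q] m AugH_gen sc_comm[of q y] by simp
    have 3: "frag_of (y \<star> hgen g \<ominus>\<^bsub>H\<^esub> sc q \<star> y, \<one>) - (frag_of (y \<star> hgen g, \<one>) - frag_of (sc q \<star> y, \<one>)) \<in> null m"
      using m AugH_gen g by (intro null_diff_left) auto
    show ?case using null_add[OF m null_add[OF m 1 2] 3] by simp
  next
    case (AugH_diff x y)
    have 3: "frag_of (x \<ominus>\<^bsub>H\<^esub> y, \<one>) - (frag_of (x, \<one>) - frag_of (y, \<one>)) \<in> null m"
      using m AugH_diff AugH_closed by (intro null_diff_left) auto
    show ?case using null_add[OF m 3 null_diff[OF m AugH_diff.IH]] by simp
  qed
qed

end

context hb_ring
begin

abbreviation "tc m z \<equiv> tensor_class H (Bs m) M z"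

lemma tc_eq:
  assumes m: "m \<le> n" and a: "a \<in> carrier FG" "b \<in> carrier FG"
  shows "tc m a = tc m b \<longleftrightarrow> a - b \<in> null m"
proof
  assume "tc m a = tc m b"
  then have "a \<in> null m #>\<^bsub>FG\<^esub> b"
    unfolding tensor_class_def M_simps using FG.rcos_self[OF a(1) null_subgroup[OF m]] by blast
  then show "a - b \<in> null m" by (auto simp: r_coset_def)
next
  assume "a - b \<in> null m"
  then have "a \<in> null m #>\<^bsub>FG\<^esub> b" by (auto simp: r_coset_def intro!: bexI[of _ "a - b"])
  then show "tc m a = tc m b"
    unfolding tensor_class_def M_simps using FG.repr_independence[OF _ a(2) null_subgroup[OF m]] by blast
qed

lemma tc_zero: "m \<le> n \<Longrightarrow> tc m 0 = null m"
  unfolding tensor_class_def M_simps using FG.coset_mult_one[of "null m"] null_closed[of m] by fastforce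

lemma frag_FG: "x \<in> carrier H \<Longrightarrow> v \<in> carrier R \<Longrightarrow> frag_of (x, v) \<in> carrier FG"
  by simp

lemma null_normal: "m \<le> n \<Longrightarrow> null m \<lhd> FG"
  by (rule FG.subgroup_imp_normal[OF null_subgroup])

lemma TP_simps:
  "carrier (TP m) = carrier (FG Mod null m)" "\<zero>\<^bsub>TP m\<^esub> = null m"
  "x \<oplus>\<^bsub>TP m\<^esub> y = x \<otimes>\<^bsub>FG Mod null m\<^esub> y"
  "a \<odot>\<^bsub>TP m\<^esub> x = tensor_map H (Bs m) M (\<lambda>x. a \<star> x) x"
  unfolding tensor_product_def Let_def M_simps by (simp_all add: FactGroup_def)

lemma TP_add: "m \<le> n \<Longrightarrow> a \<in> carrier FG \<Longrightarrow> b \<in> carrier FG \<Longrightarrow> tc m a \<oplus>\<^bsub>TP m\<^esub> tc m b = tc m (a + b)"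
  unfolding TP_simps tensor_class_def M_simps using normal.rcos_sum[OF null_normal, of m a b] by simp

lemma TP_carrier: "m \<le> n \<Longrightarrow> carrier (TP m) = pt m ` carrier H"
proof -
  assume m: "m \<le> n"
  have c: "carrier (TP m) = tc m ` carrier FG"
    unfolding TP_simps tensor_class_def M_simps by (auto simp: FactGroup_def RCOSETS_def)
  have "tc m z \<in> pt m ` carrier H" if z: "z \<in> carrier FG" for z
  proof -
    obtain x where x: "x \<in> carrier H" "z - frag_of (x, \<one>) \<in> null m" using tensor_pure[OF m z] by blast
    then have "tc m z = pt m x" unfolding pure_tensor_def using tc_eq[OF m z frag_FG[OF x(1) one_closed]] by blast
    then show ?thesis using x by blast
  qed
  moreover have "pt m x \<in> tc m ` carrier FG" if "x \<in> carrier H" for x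
    unfolding pure_tensor_def using frag_FG[OF that one_closed] by blast
  ultimately show ?thesis unfolding c by blast
qed

lemma pt_closed: "m \<le> n \<Longrightarrow> x \<in> carrier H \<Longrightarrow> pt m x \<in> carrier (TP m)"
  by (simp add: TP_carrier)

lemma pt_add:
  assumes "m \<le> n" "x \<in> carrier H" "y \<in> carrier H"
  shows "pt m x \<oplus>\<^bsub>TP m\<^esub> pt m y = pt m (x \<oplus>\<^bsub>H\<^esub> y)"
proof -
  have "(frag_of (x, \<one>) + frag_of (y, \<one>)) - frag_of (x \<oplus>\<^bsub>H\<^esub> y, \<one>) \<in> null m"
    using null_minus[OF assms(1) null_add_left[OF assms(2,3) one_closed]] by (simp add: algebra_simps)
  then have "tc m (frag_of (x, \<one>) + frag_of (y, \<one>)) = tc m (frag_of (x \<oplus>\<^bsub>H\<^esub> y, \<one>))"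
    using assms frag_FG FG.m_closed[of "frag_of (x, \<one>)" "frag_of (y, \<one>)"] by (subst tc_eq) auto
  then show ?thesis unfolding pure_tensor_def using assms by (subst TP_add) (simp_all add: frag_FG)
qed

lemma pt_zero_iff: "m \<le> n \<Longrightarrow> x \<in> carrier H \<Longrightarrow> pt m x = \<zero>\<^bsub>TP m\<^esub> \<longleftrightarrow> x \<in> AugH m"
  unfolding pure_tensor_def TP_simps using tc_eq[of m "frag_of (x, \<one>)" 0] null_AugH[of m x] tc_zero[of m] by simp

lemma pt_eq:
  assumes "m \<le> n" "x \<in> carrier H" "y \<in> carrier H" "x \<ominus>\<^bsub>H\<^esub> y \<in> AugH m"
  shows "pt m x = pt m y"
proof -
  have c: "x \<ominus>\<^bsub>H\<^esub> y \<in> carrier H" by (rule H.minus_closed[OF assms(2,3)])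
  have "frag_of (x \<ominus>\<^bsub>H\<^esub> y, \<one>) - (frag_of (x \<ominus>\<^bsub>H\<^esub> y, \<one>) - (frag_of (x, \<one>) - frag_of (y, \<one>))) \<in> null m"
    using null_AugH[OF assms(1) c] assms by (intro null_diff null_diff_left) auto
  then have "frag_of (x, \<one>) - frag_of (y, \<one>) \<in> null m" by simp
  then show ?thesis unfolding pure_tensor_def using assms by (subst tc_eq) (auto simp: frag_FG)
qed

lemma TP_abelian_group: "m \<le> n \<Longrightarrow> abelian_group (TP m)"
proof -
  assume m: "m \<le> n"
  have zero: "\<zero>\<^bsub>TP m\<^esub> = pt m \<zero>\<^bsub>H\<^esub>" using pt_zero_iff[OF m H.zero_closed] AugH_zero by simp
  show ?thesis
  proof (rule abelian_groupI)
    show "\<zero>\<^bsub>TP m\<^esub> \<in> carrier (TP m)" unfolding zero using m by (intro pt_closed) auto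
    fix x assume "x \<in> carrier (TP m)"
    then obtain a where a: "a \<in> carrier H" "x = pt m a" using TP_carrier[OF m] by auto
    show "\<zero>\<^bsub>TP m\<^esub> \<oplus>\<^bsub>TP m\<^esub> x = x" unfolding zero a(2) using a m by (subst pt_add) auto
    show "\<exists>y\<in>carrier (TP m). y \<oplus>\<^bsub>TP m\<^esub> x = \<zero>\<^bsub>TP m\<^esub>"
      unfolding zero a(2) using a m by (intro bexI[of _ "pt m (\<ominus>\<^bsub>H\<^esub> a)"] pt_closed) (auto simp: pt_add H.l_neg)
    fix y assume "y \<in> carrier (TP m)"
    then obtain b where b: "b \<in> carrier H" "y = pt m b" using TP_carrier[OF m] by auto
    show "x \<oplus>\<^bsub>TP m\<^esub> y \<in> carrier (TP m)" unfolding a(2) b(2) using a b m by (subst pt_add) (auto intro: pt_closed)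
    show "x \<oplus>\<^bsub>TP m\<^esub> y = y \<oplus>\<^bsub>TP m\<^esub> x" unfolding a(2) b(2) using a b m by (simp add: pt_add H.a_comm)
    fix z assume "z \<in> carrier (TP m)"
    then obtain c where c: "c \<in> carrier H" "z = pt m c" using TP_carrier[OF m] by auto
    show "x \<oplus>\<^bsub>TP m\<^esub> y \<oplus>\<^bsub>TP m\<^esub> z = x \<oplus>\<^bsub>TP m\<^esub> (y \<oplus>\<^bsub>TP m\<^esub> z)"
      unfolding a(2) b(2) c(2) using a b c m by (simp add: pt_add H.a_assoc)
  qed
qed

lemma epsH_closed_M: "m \<le> n \<Longrightarrow> b \<in> Bs m \<Longrightarrow> v \<in> carrier M \<Longrightarrow> b \<odot>\<^bsub>M\<^esub> v \<in> carrier M"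
  unfolding M_simps using subsetD[OF Bs_closed, of m b] by simp

lemma TP_scalar:
  assumes "m \<le> n" "c \<in> carrier R" "x \<in> carrier H"
  shows "sc c \<odot>\<^bsub>TP m\<^esub> pt m x = pt m (sc c \<star> x)"
  unfolding TP_simps
proof (rule tensor_map_pure)
  show "ring H" by (rule H.ring_axioms)
  show "Bs m \<subseteq> carrier H" by (rule Bs_closed[OF assms(1)])
  fix x b assume x: "x \<in> carrier H"
  show "sc c \<star> x \<in> carrier H" using x assms by simp
  show "sc c \<star> (x \<oplus>\<^bsub>H\<^esub> y) = sc c \<star> x \<oplus>\<^bsub>H\<^esub> sc c \<star> y" if "y \<in> carrier H" for y
    using x that assms by (simp add: H.r_distr)
  assume "b \<in> Bs m"
  then show "sc c \<star> (x \<star> b) = sc c \<star> x \<star> b"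
    using x assms Bs_closed[OF assms(1)] by (intro H.m_assoc[symmetric]) auto
qed (use assms epsH_closed_M in \<open>auto simp: M_simps(1,2)\<close>)

text \<open>T_{m+1}, ..., T_{a-1} commute with U, T_1, ..., T_{m-1}. Therefore right multiplication
  by the descending product respects balancing, and the face maps are well defined.\<close>

lemma Bs_tp_comm:
  assumes "b \<in> Bs m" "Suc m \<le> a" "a \<le> n"
  shows "b \<star> desc a (Suc m) = desc a (Suc m) \<star> b"
proof -
  have mn: "m \<le> n" and t: "desc a (Suc m) \<in> carrier H" using assms by auto
  have c: "b \<in> carrier H" if "b \<in> generate_ring H (sc ` carrier R \<union> (cl \<circ> gen) ` hb_gens m)" for b
    using H.generate_ring_in_carrier[OF Bs_gens[OF mn] that] .
  show ?thesis using assms(1) unfolding hb_sub_def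
  proof (induction rule: generate_ring.induct)
    case one
    then show ?case using t by simp
  next
    case (incl h)
    then consider c where "c \<in> carrier R" "h = sc c" | g where "g \<in> hb_gens m" "h = hgen g" by auto
    then show ?case
    proof cases
      case 1
      then show ?thesis using sc_comm t by simp
    next
      case 2
      from 2(1) show ?thesis
      proof (cases rule: gens_cases)
        case 1
        then show ?thesis using 2 assms desc_U_comm[of "Suc m" a] by simp
      next
        case (2 j)
        then show ?thesis using \<open>h = hgen g\<close> assms desc_T_comm[of "Suc m" a j] by (simp add: HT_hgen)
      qed
    qed
  next
    case (a_inv h)
    then show ?case using c t by (simp add: H.l_minus H.r_minus)
  next
    case (eng_add x y)
    then show ?case using c t by (simp add: H.l_distr H.r_distr)
  next
    case (eng_mult x y)
    then have "x \<star> y \<star> desc a (Suc m) = desc a (Suc m) \<star> (x \<star> y)"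
      using c t by (intro mult_shift) auto
    then show ?case .
  qed
qed

section \<open>Homology of the complex\<close>

lemma D_chains_TP:
  assumes "m \<le> n"
  shows "D_chains R q n (int n - 1 - int m) = TP m"
proof -
  have "nat (int n - (int n - 1 - int m) - 1) = m" by simp
  then show ?thesis unfolding D_chains_def using assms by simp
qed

lemma D_face_pt:
  assumes r: "r < n" and j: "j \<le> r" and x: "x \<in> carrier H"
  shows "D_face R q n r j (pt (n - r - 1) x) = pt (n - r) (x \<star> desc (n - r + j) (n - r))"
  unfolding D_face_def
proof (rule tensor_map_pure)
  have t: "desc (n - r + j) (n - r) \<in> carrier H" using r j by (intro desc_closed) auto
  show "ring H" by (rule H.ring_axioms)
  show "Bs (n - r) \<subseteq> carrier H" using Bs_closed[of "n - r"] by simp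
  show "Bs (n - r - 1) \<subseteq> Bs (n - r)" by (rule Bs_mono) auto
  show "b \<odot>\<^bsub>M\<^esub> v \<in> carrier M" if "b \<in> Bs (n - r)" "v \<in> carrier M" for b v
    using epsH_closed_M[of "n - r"] that by simp
  fix x b assume x: "x \<in> carrier H"
  show "x \<star> desc (n - r + j) (n - r) \<in> carrier H" using x t by simp
  show "(x \<oplus>\<^bsub>H\<^esub> y) \<star> desc (n - r + j) (n - r) = x \<star> desc (n - r + j) (n - r) \<oplus>\<^bsub>H\<^esub> y \<star> desc (n - r + j) (n - r)"
    if "y \<in> carrier H" for y using x t that by (simp add: H.l_distr)
  assume b: "b \<in> Bs (n - r - 1)"
  then have "b \<in> carrier H" using Bs_closed[of "n - r - 1"] by auto
  moreover have "b \<star> desc (n - r + j) (n - r) = desc (n - r + j) (n - r) \<star> b"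
    using Bs_tp_comm[OF b, of "n - r + j"] r j by (simp add: Suc_diff_Suc)
  ultimately show "x \<star> b \<star> desc (n - r + j) (n - r) = x \<star> desc (n - r + j) (n - r) \<star> b"
    using x t by (simp add: H.m_assoc)
qed (use x in \<open>auto simp: M_simps(1,2)\<close>)

lemma pt_finsum:
  assumes m: "m \<le> n"
  shows "(\<And>j. j \<le> r \<Longrightarrow> f j \<in> carrier H) \<Longrightarrow>
    (\<Oplus>\<^bsub>TP m\<^esub>j\<in>{..r::nat}. pt m (f j)) = pt m (\<Oplus>\<^bsub>H\<^esub>j\<in>{..r}. f j)"
proof (induction r)
  case 0
  interpret TP: abelian_group "TP m" by (rule TP_abelian_group[OF m])
  show ?case using 0 pt_closed[OF m] by simp
next
  case (Suc r)
  interpret TP: abelian_group "TP m" by (rule TP_abelian_group[OF m])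
  have "(\<Oplus>\<^bsub>TP m\<^esub>j\<in>{..Suc r}. pt m (f j)) = pt m (f (Suc r)) \<oplus>\<^bsub>TP m\<^esub> (\<Oplus>\<^bsub>TP m\<^esub>j\<in>{..r}. pt m (f j))"
    using Suc.prems pt_closed[OF m] by (intro TP.finsum_Suc) auto
  also have "\<dots> = pt m (f (Suc r) \<oplus>\<^bsub>H\<^esub> (\<Oplus>\<^bsub>H\<^esub>j\<in>{..r}. f j))"
    using Suc m by (simp add: pt_add H.finsum_closed Pi_def)
  also have "f (Suc r) \<oplus>\<^bsub>H\<^esub> (\<Oplus>\<^bsub>H\<^esub>j\<in>{..r}. f j) = (\<Oplus>\<^bsub>H\<^esub>j\<in>{..Suc r}. f j)"
    using Suc.prems by (intro H.finsum_Suc[symmetric]) auto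
  finally show ?case .
qed

text \<open>Degree n - m is a tensor product over HB_{m-1} and degree n - m - 1 one over HB_m. The
  sum has n - m + 1 terms, one for each face.\<close>

lemma D_bd_pt:
  assumes m: "1 \<le> m" "m \<le> n" and x: "x \<in> carrier H"
  shows "D_bd R q n (int n - int m) (pt (m - 1) x) = pt m (bdryH (Suc (n - m)) m x)"
proof -
  interpret TP: abelian_group "TP m" by (rule TP_abelian_group[OF m(2)])
  let ?r = "n - m"
  have r: "?r < n" "n - ?r = m" "n - ?r - 1 = m - 1" using m by auto
  have nr: "nat (int n - int m) = ?r" by simp
  have D: "D_chains R q n (int n - int m - 1) = TP m"
    using D_chains_TP[OF m(2)] by (simp add: algebra_simps)
  let ?c = "\<lambda>j::nat. (\<ominus> \<one>) [^] j \<otimes> (inv q) [^] j"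
  have t: "desc (m + j) m \<in> carrier H" if "j \<le> ?r" for j using that m by (intro desc_closed) auto
  have summand: "sc (?c j) \<odot>\<^bsub>TP m\<^esub> D_face R q n ?r j (pt (m - 1) x) = pt m (sc (?c j) \<star> (x \<star> desc (m + j) m))" if "j \<le> ?r" for j
    using D_face_pt[OF r(1) that x] TP_scalar[OF m(2), of "?c j" "x \<star> desc (m + j) m"] x t[OF that]
    unfolding r by simp
  have "D_bd R q n (int n - int m) (pt (m - 1) x)
    = (\<Oplus>\<^bsub>TP m\<^esub>j\<in>{..?r}. sc (?c j) \<odot>\<^bsub>TP m\<^esub> D_face R q n ?r j (pt (m - 1) x))"
    unfolding D_bd_def D nr using m by simp
  also have "\<dots> = (\<Oplus>\<^bsub>TP m\<^esub>j\<in>{..?r}. pt m (sc (?c j) \<star> (x \<star> desc (m + j) m)))"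
  proof (rule TP.finsum_cong')
    show "(\<lambda>j. pt m (sc (?c j) \<star> (x \<star> desc (m + j) m))) \<in> {..?r} \<rightarrow> carrier (TP m)"
      using x t m by (auto intro!: pt_closed)
  qed (use summand in auto)
  also have "\<dots> = pt m (\<Oplus>\<^bsub>H\<^esub>j\<in>{..?r}. sc (?c j) \<star> (x \<star> desc (m + j) m))"
    using x t m by (intro pt_finsum) auto
  also have "\<dots> = pt m (bdryH (Suc ?r) m x)"
    using bdryH_sum[OF x m(1), of ?r] m by simp
  finally show ?thesis .
qed

text \<open>Each coset of a cycle is the set of boundaries itself; a nonempty kernel ensures that
  the quotient has this element.\<close>

lemma homology_trivial:
  assumes K: "a_kernel (C d) (C (d - 1)) (bd d) \<noteq> {}"
    and coset: "\<And>x. x \<in> a_kernel (C d) (C (d - 1)) (bd d) \<Longrightarrow> bd (d + 1) ` carrier (C (d + 1)) +>\<^bsub>C d\<^esub> x = bd (d + 1) ` carrier (C (d + 1))"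
  shows "carrier (homology C bd d) = {\<one>\<^bsub>homology C bd d\<^esub>}"
  using assms unfolding homology_def A_FactGroup_def FactGroup_def RCOSETS_def a_r_coset_def r_coset_def
  by auto

lemma homology_D:
  assumes "1 \<le> n" "d \<le> int n - 2"
  shows "carrier (homology (D_chains R q n) (D_bd R q n) d) = {\<one>\<^bsub>homology (D_chains R q n) (D_bd R q n) d\<^esub>}"
proof (cases "d < -1")
  case True
  have C: "D_chains R q n d = zero_module" "D_chains R q n (d - 1) = zero_module"
    using True by (simp_all add: D_chains_def)
  have "carrier (D_chains R q n (d + 1)) \<noteq> {}"
  proof (cases "d + 1 = -1")
    case True
    then have "d + 1 = int n - 1 - int n" by simp
    then have "D_chains R q n (d + 1) = TP n" by (simp only: D_chains_TP[OF order_refl])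
    then show ?thesis using TP_carrier[of n] H.one_closed by auto
  next
    case False
    then show ?thesis using True by (simp add: D_chains_def zero_module_def)
  qed
  moreover have "D_bd R q n (d + 1) z = {}" for z
    using True C by (simp add: D_bd_def zero_module_def)
  ultimately have im: "D_bd R q n (d + 1) ` carrier (D_chains R q n (d + 1)) = {{}}" by auto
  have ker: "a_kernel (D_chains R q n d) (D_chains R q n (d - 1)) (D_bd R q n d) = {{}}"
    using True by (auto simp: a_kernel_def' C zero_module_def D_bd_def)
  show ?thesis
  proof (rule homology_trivial)
    show "a_kernel (D_chains R q n d) (D_chains R q n (d - 1)) (D_bd R q n d) \<noteq> {}"
      unfolding ker by simp
    show "D_bd R q n (d + 1) ` carrier (D_chains R q n (d + 1)) +>\<^bsub>D_chains R q n d\<^esub> x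
      = D_bd R q n (d + 1) ` carrier (D_chains R q n (d + 1))" for x
      unfolding im C by (simp add: zero_module_def a_r_coset_def r_coset_def)
  qed
next
  case False
  \<comment> \<open>\<open>1 \<le> m\<close> is exactly the bound \<open>d \<le> int n - 2\<close>,
    and \<open>m \<le> n\<close> says that the degree is at least -1.\<close>
  define m where "m = nat (int n - 1 - d)"
  have m: "1 \<le> m" "m \<le> n" "d = int n - 1 - int m" using False assms by (auto simp: m_def)
  let ?k = "n - m"
  have Cd: "D_chains R q n d = TP m" using D_chains_TP[OF m(2)] m(3) by simp
  have "D_chains R q n (d + 1) = TP (m - 1)"
    using D_chains_TP[of "m - 1"] m by (simp add: of_nat_diff)
  then have C1: "carrier (D_chains R q n (d + 1)) = pt (m - 1) ` carrier H"
    using TP_carrier[of "m - 1"] m by simp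
  let ?d = "\<lambda>y. pt m (bdryH (Suc ?k) m y)"
  have dc: "bdryH (Suc ?k) m y \<in> carrier H" if "y \<in> carrier H" for y
    using that m by (intro bdryH_closed) auto
  have d1: "d + 1 = int n - int m" using m(3) by simp
  have "D_bd R q n (d + 1) (pt (m - 1) y) = ?d y" if "y \<in> carrier H" for y
    unfolding d1 by (rule D_bd_pt[OF m(1,2) that])
  then have im: "D_bd R q n (d + 1) ` carrier (D_chains R q n (d + 1)) = ?d ` carrier H"
    unfolding C1 by (force simp: image_iff)
  have d_zero: "bdryH k' m' \<zero>\<^bsub>H\<^esub> = \<zero>\<^bsub>H\<^esub>" if "1 \<le> m'" "m' + k' \<le> Suc n" for k' m'
    using bdryH_diff[OF H.zero_closed H.zero_closed that] bdryH_closed[OF H.zero_closed that]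
    by (simp add: a_minus_def H.r_neg)
  have bd: "D_bd R q n d (pt m x) = \<zero>\<^bsub>D_chains R q n (d - 1)\<^esub> \<longleftrightarrow> bdryH ?k (Suc m) x \<in> AugH (Suc m)"
    if x: "x \<in> carrier H" for x
  proof (cases "m = n")
    \<comment> \<open>In degree -1 every chain is a cycle; correspondingly \<open>?k = 0\<close> and
      the sum on the other side is empty.\<close>
    case True
    then have "\<not> 0 \<le> d" using m by simp
    then show ?thesis using True by (simp add: D_bd_def AugH_zero)
  next
    case False
    then have mn: "Suc m \<le> n" using m by simp
    have e: "d - 1 = int n - 1 - int (Suc m)" "d = int n - int (Suc m)" using m(3) by simp_all
    have C: "D_chains R q n (d - 1) = TP (Suc m)" unfolding e(1) by (rule D_chains_TP[OF mn])
    have k: "Suc (n - Suc m) = ?k" using mn by simp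
    have "D_bd R q n d (pt m x) = pt (Suc m) (bdryH ?k (Suc m) x)"
      using D_bd_pt[OF _ mn x] unfolding k e(2) by simp
    then show ?thesis unfolding C using x mn by (simp add: pt_zero_iff bdryH_closed)
  qed
  show ?thesis
  proof (rule homology_trivial)
    have "pt m \<zero>\<^bsub>H\<^esub> \<in> a_kernel (D_chains R q n d) (D_chains R q n (d - 1)) (D_bd R q n d)"
      using bd[OF H.zero_closed] d_zero[of "Suc m" ?k] AugH_zero m(2) pt_closed[OF m(2) H.zero_closed]
      unfolding a_kernel_def' Cd by simp
    then show "a_kernel (D_chains R q n d) (D_chains R q n (d - 1)) (D_bd R q n d) \<noteq> {}" by blast
    fix z assume "z \<in> a_kernel (D_chains R q n d) (D_chains R q n (d - 1)) (D_bd R q n d)"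
    then have z: "z \<in> carrier (TP m)" "D_bd R q n d z = \<zero>\<^bsub>D_chains R q n (d - 1)\<^esub>"
      by (simp_all add: a_kernel_def' Cd)
    then obtain x where x: "x \<in> carrier H" "z = pt m x" using TP_carrier[OF m(2)] by auto
    have "bdryH ?k (Suc m) x \<in> AugH (Suc m)" using bd[OF x(1)] z x by simp
    then obtain y where y: "y \<in> carrier H" "x \<ominus>\<^bsub>H\<^esub> bdryH (Suc ?k) m y \<in> AugH m"
      using H_exact[OF m(1) _ x(1), of ?k] m by auto
    have zy: "z = ?d y" unfolding x(2) using m x y dc by (intro pt_eq) auto
    have neg: "bdryH (Suc ?k) m (\<ominus>\<^bsub>H\<^esub> u) = \<ominus>\<^bsub>H\<^esub> bdryH (Suc ?k) m u" if "u \<in> carrier H" for u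
      using bdryH_diff[OF H.zero_closed that, of m "Suc ?k"] d_zero[of m "Suc ?k"] dc[OF that] that m
      by (simp add: a_minus_def)
    have plus: "?d u \<oplus>\<^bsub>TP m\<^esub> ?d v = ?d (u \<oplus>\<^bsub>H\<^esub> v)" if "u \<in> carrier H" "v \<in> carrier H" for u v
      using bdryH_diff[of u "\<ominus>\<^bsub>H\<^esub> v" m "Suc ?k"] that m dc neg[of v]
      by (simp add: a_minus_def pt_add)
    show "D_bd R q n (d + 1) ` carrier (D_chains R q n (d + 1)) +>\<^bsub>D_chains R q n d\<^esub> z
      = D_bd R q n (d + 1) ` carrier (D_chains R q n (d + 1))"
      unfolding im Cd zy
    proof
      show "?d ` carrier H +>\<^bsub>TP m\<^esub> ?d y \<subseteq> ?d ` carrier H"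
        using plus y(1) by (auto simp: a_r_coset_def r_coset_def)
      show "?d ` carrier H \<subseteq> ?d ` carrier H +>\<^bsub>TP m\<^esub> ?d y"
      proof
        fix w assume "w \<in> ?d ` carrier H"
        then obtain u where u: "u \<in> carrier H" "w = ?d u" by blast
        have "w = ?d (u \<ominus>\<^bsub>H\<^esub> y) \<oplus>\<^bsub>TP m\<^esub> ?d y"
          using plus[of "u \<ominus>\<^bsub>H\<^esub> y" y] u y(1) H.minus_closed[of u y]
          by (simp add: a_minus_def H.a_assoc H.l_neg)
        then show "w \<in> ?d ` carrier H +>\<^bsub>TP m\<^esub> ?d y"
          using H.minus_closed[OF u(1) y(1)] by (auto simp: a_r_coset_def r_coset_def)
      qed
    qed
  qed
qed

end

theorem theorem2:
  fixes R :: "('a, 'm) ring_scheme" and q :: 'a and n :: nat and d :: int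
  assumes "cring R"
    and "q \<in> Units R"
    and "n \<ge> 1"
    and "d \<le> int n - 2"
  shows "carrier (homology (D_chains R q n) (D_bd R q n) d)
    = {\<one>\<^bsub>homology (D_chains R q n) (D_bd R q n) d\<^esub>}"
proof -
  interpret R: cring R by fact
  \<comment> \<open>Evaluation of formal sums in R, from the universal property of the free abelian
    group on the whole type; symbols outside the carrier evaluate to zero.\<close>
  obtain ev where ev: "ev \<in> hom (free_Abelian_group UNIV) (add_monoid R)"
    "\<And>r. ev (frag_of r) = (if r \<in> carrier R then r else \<zero>\<^bsub>R\<^esub>)"
    by (rule comm_group.free_Abelian_group_universal[OF R.a_comm_group,
          of "\<lambda>r. if r \<in> carrier R then r else \<zero>\<^bsub>R\<^esub>" UNIV]) auto
  interpret hb_ring R q n ev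
    using ev assms(2) by unfold_locales (auto simp: hom_def Pi_def)
  show ?thesis using assms by (intro homology_D)
qed

end
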